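(* $C_{2,2}(\Gamma^\infty)=1$ and $C_{2,2}(I^\infty)=1/\pi$.
   Context: A pm-space is a triple $X=(X,d_X,m_X)$ with $(X,d_X)$ a complete separable metric space and $m_X$ a Borel probability measure. Two pm-spaces are isomorphic if there is an isometry $\operatorname{supp} m_X\to\operatorname{supp} m_Y$ pushing $m_X$ forward to $m_Y$; $\mathcal X$ is the set of isomorphism classes, and a class is always represented by a space with $\operatorname{supp}m_X=X$. Lipschitz order: $Y\prec X$ iff there is a $1$-Lipschitz map $\phi:X\to Y$ with $\phi_\#m_X=m_Y$; $\mathcal PX=\{Y\in\mathcal X\mid Y\prec X\}$. Box distance: a parameter of $X$ is a Borel map $a:[0,1]\to X$ with $a_\#\mathcal L^1=m_X$; $\square(X,Y)$ is the infimum of $\epsilon>0$ such that there are parameters $a$ of $X$, $b$ of $Y$ and a Borel set $I_0\subset[0,1]$ with $\mathcal L^1(I_0)\ge1-\epsilon$ and $|d_X(a(s),a(t))-d_Y(b(s),b(t))|\le\epsilon$ for all $s,t\in I_0$. For a pm-space $X$, $X_2^n=(X^n,d_{\ell_2},m_X^{\otimes n})$ and $X_2^\infty=\overline{\bigcup_{n\ge1}\mathcal PX_2^n}\subset\mathcal X$ (closure for $\square$). $\Gamma^\infty=(\mathbb R,|\cdot|,\gamma^1)_2^\infty$ with $\gamma^1$ the standard Gaussian measure; $I^\infty=([0,1],|\cdot|,\mathcal L^1)_2^\infty$. For $f:X\to\mathbb R$, $\mathrm{lip}_a(f)(x)=\lim_{r\to0}\mathrm{Lip}(f|_{B_r(x)})$,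 where $B_r(x)$ is the closed ball and $\mathrm{Lip}$ is the best Lipschitz constant ($0$ on one-point sets). $C_{2,2}(X)\in[0,\infty]$ is the infimum of $C$ such that $\frac12\int_{X\times X}(f(x)-f(y))^2dm_X^{\otimes2}\le C^2\int_X\mathrm{lip}_a(f)^2dm_X$ for all bounded Lipschitz $f:X\to\mathbb R$ ($\inf\emptyset=\infty$). For $P=\Gamma^\infty$ or $I^\infty$ (these are pyramids), $C_{2,2}(P)=\sup_{X\in P}C_{2,2}(X)$. *)

theory Defs
  imports "HOL-Probability.Probability"
begin

record 'a pm =
  met :: "'a metric"
  meas :: "'a measure"

definition pm_space :: "'a pm \<Rightarrow> bool" where
  "pm_space X \<longleftrightarrow>
     mcomplete_of (met X) \<and> separable_space (mtopology_of (met X)) \<and>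
     space (meas X) = mspace (met X) \<and>
     sets (meas X) = sigma_sets (mspace (met X)) {U. openin (mtopology_of (met X)) U} \<and>
     prob_space (meas X)"

definition pm_support :: "'a pm \<Rightarrow> 'a set" where
  "pm_support X =
     {x \<in> mspace (met X). \<forall>U. openin (mtopology_of (met X)) U \<and> x \<in> U \<longrightarrow> 0 < emeasure (meas X) U}"

text \<open>
  Isomorphism classes are represented by fully supported spaces.  A complete separable metric space
  has at most continuum many points, so every class has a representative whose carrier is a set of
  real numbers (with an arbitrary metric, unrelated to the usual one).  The set of all classes is
  therefore rendered by the following set of representatives.  It is not quotiented by isomorphism:
  the Lipschitz order, the box distance and the Poincare constant below are invariant under
  isomorphism, so that \<open>lip_below\<close> and \<open>box_closure\<close> are unions of full
  isomorphism classes.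
\<close>
definition pm_classes :: "real pm set" where
  "pm_classes = {X. pm_space X \<and> pm_support X = mspace (met X)}"

text \<open>Lipschitz order; the two spaces may live on different types.\<close>
definition lip_le :: "'b pm \<Rightarrow> 'a pm \<Rightarrow> bool"  (infix "\<prec>\<^sub>L" 50) where
  "Y \<prec>\<^sub>L X \<longleftrightarrow>
     (\<exists>\<phi> \<in> mspace (met X) \<rightarrow> mspace (met Y).
        (\<forall>x \<in> mspace (met X). \<forall>y \<in> mspace (met X). mdist (met Y) (\<phi> x) (\<phi> y) \<le> mdist (met X) x y) \<and>
        distr (meas X) (meas Y) \<phi> = meas Y)"

definition lip_below :: "'a pm \<Rightarrow> real pm set" where
  "lip_below X = {Y \<in> pm_classes. Y \<prec>\<^sub>L X}"

definition unit_leb :: "real measure" where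
  "unit_leb = restrict_space lborel {0..1}"

definition parameter :: "'a pm \<Rightarrow> (real \<Rightarrow> 'a) \<Rightarrow> bool" where
  "parameter X a \<longleftrightarrow> a \<in> measurable unit_leb (meas X) \<and> distr unit_leb (meas X) a = meas X"

definition box_dist :: "'a pm \<Rightarrow> 'b pm \<Rightarrow> ennreal" where
  "box_dist X Y = Inf {ennreal \<epsilon> | \<epsilon>. 0 < \<epsilon> \<and>
     (\<exists>a b I\<^sub>0. parameter X a \<and> parameter Y b \<and>
        I\<^sub>0 \<in> sets unit_leb \<and> 1 - \<epsilon> \<le> measure unit_leb I\<^sub>0 \<and>
        (\<forall>s \<in> I\<^sub>0. \<forall>t \<in> I\<^sub>0. \<bar>mdist (met X) (a s) (a t) - mdist (met Y) (b s) (b t)\<bar> \<le> \<epsilon>))}"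

definition box_closure :: "real pm set \<Rightarrow> real pm set" where
  "box_closure A = {Y \<in> pm_classes. \<forall>\<epsilon>>0. \<exists>Z \<in> A. box_dist Y Z < \<epsilon>}"

text \<open>Finite \<open>l\<^sub>2\<close>-powers; the points of the \<open>n\<close>-th power are the extensional functions on \<open>{..<n}\<close>.\<close>
definition l2_dist :: "nat \<Rightarrow> 'a metric \<Rightarrow> (nat \<Rightarrow> 'a) \<Rightarrow> (nat \<Rightarrow> 'a) \<Rightarrow> real" where
  "l2_dist n m x y = L2_set (\<lambda>i. mdist m (x i) (y i)) {..<n}"

definition l2_metric :: "nat \<Rightarrow> 'a metric \<Rightarrow> (nat \<Rightarrow> 'a) metric" where
  "l2_metric n m = metric ({..<n} \<rightarrow>\<^sub>E mspace m, l2_dist n m)"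

lemma Metric_space_l2: "Metric_space ({..<n} \<rightarrow>\<^sub>E mspace m) (l2_dist n m)"
proof -
  interpret m: Metric_space "mspace m" "mdist m"
    by (rule Metric_space_mspace_mdist)
  show ?thesis
  proof
    show "0 \<le> l2_dist n m x y" for x y
      by (simp add: l2_dist_def L2_set_nonneg)
    show "l2_dist n m x y = l2_dist n m y x" for x y
      by (simp add: l2_dist_def m.commute)
    show "l2_dist n m x y = 0 \<longleftrightarrow> x = y"
      if x: "x \<in> {..<n} \<rightarrow>\<^sub>E mspace m" and y: "y \<in> {..<n} \<rightarrow>\<^sub>E mspace m" for x y
    proof -
      have "l2_dist n m x y = 0 \<longleftrightarrow> (\<forall>i\<in>{..<n}. mdist m (x i) (y i) = 0)"
        by (simp add: l2_dist_def L2_set_eq_0_iff)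
      also have "\<dots> \<longleftrightarrow> (\<forall>i\<in>{..<n}. x i = y i)"
        using x y by (intro ball_cong refl m.zero) (auto dest: PiE_mem)
      also have "\<dots> \<longleftrightarrow> x = y"
        using PiE_ext[OF x y] by auto
      finally show ?thesis .
    qed
    show "l2_dist n m x z \<le> l2_dist n m x y + l2_dist n m y z"
      if x: "x \<in> {..<n} \<rightarrow>\<^sub>E mspace m" and y: "y \<in> {..<n} \<rightarrow>\<^sub>E mspace m"
        and z: "z \<in> {..<n} \<rightarrow>\<^sub>E mspace m" for x y z
    proof -
      have "l2_dist n m x z \<le> L2_set (\<lambda>i. mdist m (x i) (y i) + mdist m (y i) (z i)) {..<n}"
        unfolding l2_dist_def
        by (rule L2_set_mono) (use x y z in \<open>auto intro!: m.triangle dest: PiE_mem\<close>)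
      also have "\<dots> \<le> l2_dist n m x y + l2_dist n m y z"
        unfolding l2_dist_def by (rule L2_set_triangle_ineq)
      finally show ?thesis .
    qed
  qed
qed

lemma mspace_l2_metric [simp]: "mspace (l2_metric n m) = {..<n} \<rightarrow>\<^sub>E mspace m"
  and mdist_l2_metric [simp]: "mdist (l2_metric n m) = l2_dist n m"
  by (simp_all add: l2_metric_def Metric_space.mspace_metric Metric_space.mdist_metric Metric_space_l2)

definition l2_power :: "nat \<Rightarrow> 'a pm \<Rightarrow> (nat \<Rightarrow> 'a) pm" where
  "l2_power n X = \<lparr>met = l2_metric n (met X), meas = PiM {..<n} (\<lambda>_. meas X)\<rparr>"

definition l2_infinity :: "'a pm \<Rightarrow> real pm set" where
  "l2_infinity X = box_closure (\<Union>n\<in>{1..}. lip_below (l2_power n X))"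

definition gauss_line :: "real pm" where
  "gauss_line = \<lparr>met = euclidean_metric, meas = density lborel (\<lambda>x. ennreal (std_normal_density x))\<rparr>"

definition unit_interval :: "real pm" where
  "unit_interval = \<lparr>met = submetric euclidean_metric {0..1}, meas = unit_leb\<rparr>"

definition Gamma_infinity :: "real pm set" where
  "Gamma_infinity = l2_infinity gauss_line"

definition I_infinity :: "real pm set" where
  "I_infinity = l2_infinity unit_interval"

definition lip_const :: "'a metric \<Rightarrow> ('a \<Rightarrow> real) \<Rightarrow> 'a set \<Rightarrow> ennreal" where
  "lip_const m f A =
     Inf {ennreal L | L. 0 \<le> L \<and> (\<forall>x\<in>A. \<forall>y\<in>A. \<bar>f x - f y\<bar> \<le> L * mdist m x y)}"

definition lip_a :: "'a metric \<Rightarrow> ('a \<Rightarrow> real) \<Rightarrow> 'a \<Rightarrow> ennreal" where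
  "lip_a m f x = Lim (at_right 0) (\<lambda>r. lip_const m f (mcball_of m x r))"

text \<open>The infimum of the empty set is \<open>\<infinity>\<close> in \<^typ>\<open>ennreal\<close>.\<close>
definition C22 :: "'a pm \<Rightarrow> ennreal" where
  "C22 X = Inf {ennreal C | C. 0 \<le> C \<and>
     (\<forall>f. Lipschitz_continuous_map (met X) euclidean_metric f \<and> bounded (f ` mspace (met X)) \<longrightarrow>
        ennreal (1/2) * (\<integral>\<^sup>+ (x, y). ennreal ((f x - f y)\<^sup>2) \<partial>(meas X \<Otimes>\<^sub>M meas X))
          \<le> ennreal (C\<^sup>2) * (\<integral>\<^sup>+ x. (lip_a (met X) f x)\<^sup>2 \<partial>meas X))}"

definition C22_pyramid :: "real pm set \<Rightarrow> ennreal" where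
  "C22_pyramid P = (SUP X\<in>P. C22 X)"

lemma pm_space_gauss_line: "pm_space gauss_line"
proof -
  have "mcomplete_of (euclidean_metric :: real metric)"
    by (simp add: mcomplete_of_def complete_UNIV)
  moreover have "separable_space (euclidean :: real topology)"
  proof -
    obtain T :: "real set" where "countable T" "UNIV \<subseteq> closure T"
      by (rule separable)
    then show ?thesis
      unfolding separable_space_def by (intro exI[of _ T]) (simp add: top.extremum_unique)
  qed
  ultimately show ?thesis
    by (simp add: pm_space_def gauss_line_def prob_space_normal_density borel_def)
qed

lemma pm_space_unit_interval: "pm_space unit_interval"
proof -
  have "mcomplete_of (submetric (euclidean_metric :: real metric) {0..1})"
  proof -
    interpret Submetric "UNIV :: real set" dist "{0..1}"
      by unfold_locales auto
    have "sub.mcomplete"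
      by (rule closedin_mcomplete_imp_mcomplete) (simp_all add: complete_UNIV)
    then show ?thesis
      by (simp add: mcomplete_of_def)
  qed
  moreover have "separable_space (top_of_set {0..1::real})"
  proof -
    obtain T where T: "countable T" "T \<subseteq> {0..1::real}" "{0..1} \<subseteq> closure T"
      by (rule separable)
    then have "top_of_set {0..1} closure_of T = {0..1}"
      by (simp add: closure_of_subtopology Int_absorb1 Int_absorb2)
    with T show ?thesis
      unfolding separable_space_def by (intro exI[of _ T]) simp
  qed
  moreover have "sets unit_leb = sigma_sets {0..1} {U. openin (top_of_set {0..1}) U}"
  proof -
    have "sets unit_leb = (\<inter>) {0..1} ` sigma_sets UNIV {S. open S}"
      by (simp add: unit_leb_def sets_restrict_space borel_def)
    also have "\<dots> = sigma_sets {0..1} ((\<inter>) {0..1} ` {S. open S})"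
    proof (rule sigma_sets_Int[OF _ subset_UNIV])
      have "{0..1::real} \<in> sets borel"
        by simp
      then show "{0..1::real} \<in> sigma_sets UNIV {S. open S}"
        by (simp add: borel_def)
    qed
    also have "(\<inter>) {0..1} ` {S. open S} = {U. openin (top_of_set {0..1::real}) U}"
      by (auto simp: openin_open)
    finally show ?thesis .
  qed
  moreover have "prob_space unit_leb"
    by (rule prob_spaceI) (simp add: unit_leb_def space_restrict_space emeasure_restrict_space)
  ultimately show ?thesis
    by (simp add: pm_space_def unit_interval_def mtopology_of_submetric unit_leb_def space_restrict_space)
qed

end

theory Submission
  imports Defs
begin

text \<open>
  The upper bounds go through a nonlocal Poincare inequality, in which the local Lipschitz constant of
  the test function is taken on balls of a fixed radius.  On \<open>\<real>\<^sup>n\<close> with a product measure it follows from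
  the one-dimensional inequality: averaging over small segments in each coordinate direction makes a
  Lipschitz function differentiable, with gradient bounded by the local Lipschitz constant, and
  variance is subadditive over the factors of a product.  It passes to 1-Lipschitz images.
  If \<open>X\<close> is box-close to such an image \<open>Z\<close>, a function on \<open>X\<close> is transplanted to \<open>Z\<close> by a McShane
  extension with variable slopes, which nearly preserves the local Lipschitz constants; letting the
  distance and then the radius tend to zero gives the inequality with \<^const>\<open>lip_a\<close> on \<open>X\<close>.  In
  dimension one, the sharp constants come from comparison with the eigenfunctions \<open>x\<close> (Gauss measure)
  and \<open>- cos (\<pi> x)\<close> (unit interval), and these functions also show that the constants are attained.
\<close>

section \<open>Smoothing Lipschitz functions\<close>

text \<open>Box-closeness controls distances only up to an error \<epsilon>, and only off a set of
  measure \<epsilon>. It sees nothing below scale \<epsilon>, whereas \<open>lip_a\<close> lives at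
  scale zero; a local constant read on balls of fixed radius r tolerates every \<epsilon> much
  smaller than r. This dictates the order of limits: \<epsilon> to 0 with r and a slope margin
  \<eta> fixed, then \<eta> to 0, and r to 0 last. Averaging takes the place of almost everywhere
  differentiability: afterwards each partial derivative is an explicit Lipschitz function with a
  uniform quadratic remainder, so the gradient bound is a pointwise argument. The price is a ball
  radius smaller by n times the averaging length, which can be made as short as desired. Both base
  spaces are treated on all of R^n, by pulling back along a 1-Lipschitz retraction of the line onto
  the carrier: the identity, respectively clipping to [0,1]. The one-dimensional constant reappears
  unchanged for every n, so the bound survives the union over n and the closure.\<close>

text \<open>
  Points of \<open>\<real>\<^sup>n\<close> are functions on \<^typ>\<open>nat\<close> of which only the values below \<open>n\<close> matter, so that one can
  induct on the dimension.
\<close>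
definition rdist :: "nat \<Rightarrow> (nat \<Rightarrow> real) \<Rightarrow> (nat \<Rightarrow> real) \<Rightarrow> real" where
  "rdist n x y = L2_set (\<lambda>i. x i - y i) {..<n}"

text \<open>\<open>rdist n\<close> is only a pseudometric on \<open>nat \<Rightarrow> real\<close>,
  so this condition also forces independence from the coordinates beyond \<open>n\<close>. The sign
  of \<open>L\<close> is left open; \<open>lipn_nonneg\<close> normalises it.\<close>

definition lipn :: "nat \<Rightarrow> real \<Rightarrow> ((nat \<Rightarrow> real) \<Rightarrow> real) \<Rightarrow> bool" where
  "lipn n L F \<longleftrightarrow> (\<forall>x y. \<bar>F x - F y\<bar> \<le> L * rdist n x y)"

text \<open>Vacuous for \<open>r \<le> 0\<close>, so a radius can be decreased without a side
  condition.\<close>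

definition loclip :: "nat \<Rightarrow> real \<Rightarrow> real \<Rightarrow> (nat \<Rightarrow> real) \<Rightarrow> ((nat \<Rightarrow> real) \<Rightarrow> real) \<Rightarrow> bool" where
  "loclip n r \<rho> x F \<longleftrightarrow>
     (\<forall>y y'. rdist n y x < r \<longrightarrow> rdist n y' x < r \<longrightarrow> \<bar>F y - F y'\<bar> \<le> \<rho> * rdist n y y')"

text \<open>\<open>G\<close> is the \<open>i\<close>-th partial derivative of \<open>F\<close>, with a uniform quadratic remainder.\<close>
definition partial_quad ::
  "nat \<Rightarrow> real \<Rightarrow> ((nat \<Rightarrow> real) \<Rightarrow> real) \<Rightarrow> ((nat \<Rightarrow> real) \<Rightarrow> real) \<Rightarrow> bool" where
  "partial_quad i K F G \<longleftrightarrow> (\<forall>x h. \<bar>F (x(i := x i + h)) - F x - h * G x\<bar> \<le> K * h\<^sup>2)"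

text \<open>A one-sided Steklov average. Parametrised over the unit interval it is an average of
  translates, so Lipschitz and sup bounds pass through unchanged; its derivative along coordinate
  \<open>i\<close> is a difference quotient of \<open>F\<close>.\<close>

definition avg :: "real \<Rightarrow> nat \<Rightarrow> ((nat \<Rightarrow> real) \<Rightarrow> real) \<Rightarrow> (nat \<Rightarrow> real) \<Rightarrow> real" where
  "avg \<epsilon> i F x = integral {0..1} (\<lambda>s. F (x(i := x i + \<epsilon> * s)))"

lemma rdist_nonneg [simp]: "0 \<le> rdist n x y"
  by (simp add: rdist_def L2_set_nonneg)

lemma rdist_commute: "rdist n x y = rdist n y x"
  by (simp add: rdist_def L2_set_def power2_commute)

lemma rdist_self [simp]: "rdist n x x = 0"
  by (simp add: rdist_def L2_set_def)

lemma rdist_triangle: "rdist n x z \<le> rdist n x y + rdist n y z"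
  using L2_set_triangle_ineq[of "\<lambda>i. x i - y i" "\<lambda>i. y i - z i" "{..<n}"]
  by (simp add: rdist_def)

lemma rdist_shift: "rdist n (x(i := x i + c)) (y(i := y i + c)) = rdist n x y"
  unfolding rdist_def by (intro L2_set_cong) auto

lemma rdist_upd_le: "rdist n (x(i := a)) (x(i := b)) \<le> \<bar>a - b\<bar>"
proof (cases "i < n")
  case True
  have "(\<Sum>j<n. ((x(i := a)) j - (x(i := b)) j)\<^sup>2) = (\<Sum>j<n. if j = i then (a - b)\<^sup>2 else 0)"
    by (intro sum.cong) auto
  also have "\<dots> = (a - b)\<^sup>2"
    using True by simp
  finally show ?thesis
    by (simp add: rdist_def L2_set_def)
next
  case False
  then have "rdist n (x(i := a)) (x(i := b)) = L2_set (\<lambda>j. 0) {..<n}"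
    unfolding rdist_def by (intro L2_set_cong) auto
  then show ?thesis by (simp add: L2_set_def)
qed

lemma rdist_upd_self_le: "rdist n (x(i := x i + c)) x \<le> \<bar>c\<bar>"
  using rdist_upd_le[of n x i "x i + c" "x i"] by simp

lemma lipnD: "lipn n L F \<Longrightarrow> \<bar>F x - F y\<bar> \<le> L * rdist n x y"
  by (simp add: lipn_def)

lemma lipn_mono: "lipn n L F \<Longrightarrow> L \<le> L' \<Longrightarrow> lipn n L' F"
  unfolding lipn_def by (meson mult_right_mono order_trans rdist_nonneg)

lemma partial_quad_mono: "partial_quad i K F G \<Longrightarrow> K \<le> K' \<Longrightarrow> partial_quad i K' F G"
  unfolding partial_quad_def by (meson mult_right_mono order_trans zero_le_power2)

lemma lipn_nonneg: "lipn n L F \<Longrightarrow> lipn n (max L 0) F"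
  by (erule lipn_mono) simp

lemma lipn_slice:
  assumes "lipn n L F" "0 \<le> L"
  shows "\<bar>F (x(i := a)) - F (x(i := b))\<bar> \<le> L * \<bar>a - b\<bar>"
  using lipnD[OF assms(1), of "x(i:=a)" "x(i:=b)"]
    mult_left_mono[OF rdist_upd_le[of n x i a b] assms(2)] by linarith

lemma continuous_on_lip_real:
  fixes k :: "real \<Rightarrow> real"
  assumes "\<And>a b. \<bar>k a - k b\<bar> \<le> L * \<bar>a - b\<bar>" "0 \<le> L"
  shows "continuous_on S k"
proof (rule lipschitz_on_continuous_on)
  show "L-lipschitz_on S k"
    by (rule lipschitz_onI) (use assms in \<open>auto simp: dist_real_def\<close>)
qed

lemma lipn_slice_continuous:
  assumes "lipn n L F"
  shows "continuous_on S (\<lambda>t. F (x(i := t)))"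
  by (rule continuous_on_lip_real[OF lipn_slice[OF lipn_nonneg[OF assms]]]) auto

lemma lipn_shift_continuous:
  assumes "lipn n L F"
  shows "continuous_on S (\<lambda>s. F (x(i := x i + \<epsilon> * s)))"
  by (rule continuous_on_compose2[OF lipn_slice_continuous[OF assms, of UNIV]])
    (auto intro!: continuous_intros)

lemma lipn_shift_integrable:
  assumes "lipn n L F"
  shows "(\<lambda>s. F (x(i := x i + \<epsilon> * s))) integrable_on {0..1}"
  by (rule integrable_continuous_interval[OF lipn_shift_continuous[OF assms]])

lemma avg_diff:
  assumes "lipn n L F" "lipn n' L' G"
  shows "avg \<epsilon> i F x - avg \<epsilon> j G y =
    integral {0..1} (\<lambda>s. F (x(i := x i + \<epsilon> * s)) - G (y(j := y j + \<epsilon> * s)))"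
  unfolding avg_def
  by (rule integral_diff[symmetric]) (intro lipn_shift_integrable[OF assms(1)] lipn_shift_integrable[OF assms(2)])+

lemma integral_unit_bound:
  fixes u :: "real \<Rightarrow> real"
  assumes "continuous_on {0..1} u" "\<And>s. s \<in> {0..1} \<Longrightarrow> \<bar>u s\<bar> \<le> c"
  shows "\<bar>integral {0..1} u\<bar> \<le> c"
  using integral_bound[of 0 1 u c] assms by auto

lemma avg_diff_le:
  assumes F: "lipn n L F" and G: "lipn n' L' G"
    and le: "\<And>s. s \<in> {0..1} \<Longrightarrow> \<bar>F (x(i := x i + \<epsilon> * s)) - G (y(j := y j + \<epsilon> * s))\<bar> \<le> c"
  shows "\<bar>avg \<epsilon> i F x - avg \<epsilon> j G y\<bar> \<le> c"
  unfolding avg_diff[OF F G]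
  by (rule integral_unit_bound[OF _ le])
    (intro continuous_intros lipn_shift_continuous[OF F] lipn_shift_continuous[OF G])

lemma lipn_avg:
  assumes F: "lipn n L F"
  shows "lipn n L (avg \<epsilon> i F)"
  unfolding lipn_def
proof (intro allI avg_diff_le[OF F F])
  fix x y s
  show "\<bar>F (x(i := x i + \<epsilon> * s)) - F (y(i := y i + \<epsilon> * s))\<bar> \<le> L * rdist n x y"
    using lipnD[OF F, of "x(i := x i + \<epsilon> * s)" "y(i := y i + \<epsilon> * s)"] by (simp add: rdist_shift)
qed

text \<open>Translates move a point by at most \<open>\<epsilon>\<close>, so they carry the smaller
  ball into the larger one, and they preserve \<open>rdist\<close>.\<close>

lemma loclip_avg:
  assumes F: "lipn n L F" and loc: "loclip n r \<rho> x F" and e: "0 \<le> \<epsilon>"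
  shows "loclip n (r - \<epsilon>) \<rho> x (avg \<epsilon> i F)"
  unfolding loclip_def
proof (intro allI impI avg_diff_le[OF F F])
  fix y y' s
  assume y: "rdist n y x < r - \<epsilon>" and y': "rdist n y' x < r - \<epsilon>" and s: "s \<in> {0..1::real}"
  have "rdist n (z(i := z i + \<epsilon> * s)) x < r" if "rdist n z x < r - \<epsilon>" for z
  proof -
    have "rdist n (z(i := z i + \<epsilon> * s)) x \<le> rdist n (z(i := z i + \<epsilon> * s)) z + rdist n z x"
      by (rule rdist_triangle)
    moreover have "rdist n (z(i := z i + \<epsilon> * s)) z \<le> \<bar>\<epsilon> * s\<bar>"
      by (rule rdist_upd_self_le)
    moreover have "\<bar>\<epsilon> * s\<bar> \<le> \<epsilon>"
      using s e by (auto simp: abs_mult intro: mult_left_le)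
    ultimately show ?thesis using that by linarith
  qed
  from loc[unfolded loclip_def, rule_format, OF this[OF y] this[OF y']]
  show "\<bar>F (y(i := y i + \<epsilon> * s)) - F (y'(i := y' i + \<epsilon> * s))\<bar> \<le> \<rho> * rdist n y y'"
    by (simp add: rdist_shift)
qed

lemma avg_close:
  assumes F: "lipn n L F" and e: "0 \<le> \<epsilon>" and L: "0 \<le> L"
  shows "\<bar>avg \<epsilon> i F x - F x\<bar> \<le> L * \<epsilon>"
proof -
  have "avg \<epsilon> i F x - F x = integral {0..1} (\<lambda>s. F (x(i := x i + \<epsilon> * s)) - F x)"
    unfolding avg_def using lipn_shift_integrable[OF F] by (subst integral_diff) auto
  moreover have "\<bar>integral {0..1} (\<lambda>s. F (x(i := x i + \<epsilon> * s)) - F x)\<bar> \<le> L * \<epsilon>"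
  proof (rule integral_unit_bound)
    show "continuous_on {0..1} (\<lambda>s. F (x(i := x i + \<epsilon> * s)) - F x)"
      by (intro continuous_intros lipn_shift_continuous[OF F])
    fix s :: real assume s: "s \<in> {0..1}"
    have "\<bar>F (x(i := x i + \<epsilon> * s)) - F x\<bar> \<le> L * rdist n (x(i := x i + \<epsilon> * s)) x"
      by (rule lipnD[OF F])
    also have "\<dots> \<le> L * \<bar>\<epsilon> * s\<bar>"
      by (intro mult_left_mono rdist_upd_self_le L)
    also have "\<dots> \<le> L * \<epsilon>"
      using s e by (intro mult_left_mono L) (auto simp: abs_mult intro: mult_left_le)
    finally show "\<bar>F (x(i := x i + \<epsilon> * s)) - F x\<bar> \<le> L * \<epsilon>" .
  qed
  ultimately show ?thesis by simp
qed

lemma avg_bound: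
  assumes F: "lipn n L F" and M: "\<And>x. \<bar>F x\<bar> \<le> M"
  shows "\<bar>avg \<epsilon> i F x\<bar> \<le> M"
  unfolding avg_def by (rule integral_unit_bound[OF lipn_shift_continuous[OF F]]) (rule M)

text \<open>Translation along coordinate \<open>j\<close> commutes with incrementing coordinate
  \<open>i\<close>, so the remainder estimate can be integrated with the same
  \<open>K\<close>.\<close>

lemma partial_quad_avg_other:
  assumes F: "lipn n L F" and G: "lipn n L' G" and pd: "partial_quad i K F G" and ij: "i \<noteq> j"
  shows "partial_quad i K (avg \<epsilon> j F) (avg \<epsilon> j G)"
  unfolding partial_quad_def
proof (intro allI)
  fix x :: "nat \<Rightarrow> real" and h :: real
  let ?x = "x(i := x i + h)"
  let ?s = "\<lambda>s x. x(j := x j + \<epsilon> * s)"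
  have "avg \<epsilon> j F ?x - avg \<epsilon> j F x - h * avg \<epsilon> j G x =
      integral {0..1} (\<lambda>s. (F (?s s ?x) - F (?s s x)) - h * G (?s s x))"
    unfolding avg_diff[OF F F]
    unfolding avg_def integral_mult_right[symmetric]
    by (rule integral_diff[symmetric])
      (intro integrable_continuous_interval continuous_intros lipn_shift_continuous[OF F] lipn_shift_continuous[OF G])+
  also have "\<bar>\<dots>\<bar> \<le> K * h\<^sup>2"
  proof (rule integral_unit_bound)
    show "continuous_on {0..1} (\<lambda>s. (F (?s s ?x) - F (?s s x)) - h * G (?s s x))"
      by (intro continuous_intros lipn_shift_continuous[OF F] lipn_shift_continuous[OF G])
    fix s
    have "?s s ?x = (?s s x)(i := (?s s x) i + h)"
      using ij by (auto simp: fun_eq_iff)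
    then show "\<bar>(F (?s s ?x) - F (?s s x)) - h * G (?s s x)\<bar> \<le> K * h\<^sup>2"
      using pd unfolding partial_quad_def by metis
  qed
  finally show "\<bar>avg \<epsilon> j F ?x - avg \<epsilon> j F x - h * avg \<epsilon> j G x\<bar> \<le> K * h\<^sup>2" .
qed

text \<open>Mean value inequality for P(u) - u k(t): its derivative k(u) - k(t) is at most L|h|
  between t and t + h.\<close>

lemma antiderivative_lip_quad:
  fixes k P :: "real \<Rightarrow> real"
  assumes P: "\<And>t. t \<in> {a..b} \<Longrightarrow> (P has_vector_derivative k t) (at t within {a..b})"
    and k: "\<And>s t. \<bar>k s - k t\<bar> \<le> L * \<bar>s - t\<bar>" and L: "0 \<le> L"
    and t: "t \<in> {a..b}" "t + h \<in> {a..b}"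
  shows "\<bar>P (t + h) - P t - h * k t\<bar> \<le> L * h\<^sup>2"
proof -
  let ?Q = "\<lambda>u. P u - u * k t"
  have "norm (?Q (t + h) - ?Q t) \<le> (L * \<bar>h\<bar>) * norm (t + h - t)"
  proof (rule differentiable_bound[where f = ?Q and f' = "\<lambda>u v. v * (k u - k t)" and S = "closed_segment t (t+h)"])
    fix u assume u: "u \<in> closed_segment t (t + h)"
    have sub: "closed_segment t (t + h) \<subseteq> {a..b}"
      by (rule closed_segment_subset) (use t in auto)
    have "(P has_real_derivative k u) (at u within closed_segment t (t + h))"
      using has_vector_derivative_within_subset[OF P[of u] sub] u sub
      by (auto simp: has_real_derivative_iff_has_vector_derivative)
    then have "(?Q has_real_derivative (k u - k t)) (at u within closed_segment t (t + h))"
      by (auto intro!: derivative_eq_intros)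
    then show "(?Q has_derivative (\<lambda>v. v * (k u - k t))) (at u within closed_segment t (t + h))"
      by (simp add: has_field_derivative_def mult_commute_abs)
    have "\<bar>k u - k t\<bar> \<le> L * \<bar>u - t\<bar>" by (rule k)
    also have "\<dots> \<le> L * \<bar>h\<bar>"
      using u L by (intro mult_left_mono) (auto simp: closed_segment_eq_real_ivl split: if_splits)
    finally show "onorm (\<lambda>v. v * (k u - k t)) \<le> L * \<bar>h\<bar>"
      by (intro onorm_le) (auto simp: abs_mult mult.commute intro!: mult_left_mono)
  qed auto
  then show ?thesis
    by (simp add: algebra_simps power2_eq_square)
qed

text \<open>In the variable t = x i the average equals (P(t + \<epsilon>) - P(t)) / \<epsilon>, with
  P an antiderivative of the slice. The expansions of P at t + \<epsilon> and at t are subtracted;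
  each costs L h^2 / \<epsilon>.\<close>

lemma partial_quad_avg_same:
  assumes F: "lipn n L F" and L: "0 \<le> L" and e: "0 < \<epsilon>"
  shows "partial_quad i (2 * L / \<epsilon>) (avg \<epsilon> i F) (\<lambda>x. (F (x(i := x i + \<epsilon>)) - F x) / \<epsilon>)"
  unfolding partial_quad_def
proof (intro allI)
  fix x :: "nat \<Rightarrow> real" and h :: real
  let ?k = "\<lambda>t. F (x(i := t))"
  let ?t = "x i"
  \<comment> \<open>The antiderivative is taken on a compact interval; this one contains t, t + h
    and their translates by \<epsilon>.\<close>
  define a b where "a = ?t - \<bar>h\<bar>" and "b = ?t + \<epsilon> + \<bar>h\<bar>"
  have k: "\<bar>?k s - ?k t\<bar> \<le> L * \<bar>s - t\<bar>" for s t
    by (rule lipn_slice[OF F L])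
  obtain P where P: "\<And>t. t \<in> {a..b} \<Longrightarrow> (P has_vector_derivative ?k t) (at t within {a..b})"
    using antiderivative_continuous[of a b ?k, OF lipn_slice_continuous[OF F]] by blast
  have A: "integral {0..1} (\<lambda>s. ?k (t + \<epsilon> * s)) = (P (t + \<epsilon>) - P t) / \<epsilon>"
    if t: "t \<in> {a..b}" "t + \<epsilon> \<in> {a..b}" for t
  proof -
    have "((\<lambda>s. ?k (t + \<epsilon> * s)) has_integral (P (t + \<epsilon> * 1) / \<epsilon> - P (t + \<epsilon> * 0) / \<epsilon>)) {0..1}"
    proof (rule fundamental_theorem_of_calculus)
      fix s :: real assume s: "s \<in> {0..1}"
      have *: "(P has_real_derivative ?k (t + \<epsilon> * s)) (at (t + \<epsilon> * s) within {a..b})"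
      proof -
        have "0 \<le> \<epsilon> * s" "\<epsilon> * s \<le> \<epsilon>" using s e by (auto intro: mult_left_le)
        then have "t + \<epsilon> * s \<in> {a..b}" using t by auto
        from P[OF this] show ?thesis by (simp add: has_real_derivative_iff_has_vector_derivative)
      qed
      have img: "(\<lambda>s. t + \<epsilon> * s) ` {0..1} \<subseteq> {a..b}"
      proof safe
        fix s :: real assume "s \<in> {0..1}"
        then have "0 \<le> \<epsilon> * s" "\<epsilon> * s \<le> \<epsilon>" using e by (auto intro: mult_left_le)
        then show "t + \<epsilon> * s \<in> {a..b}" using t by auto
      qed
      have "((\<lambda>s. t + \<epsilon> * s) has_real_derivative \<epsilon>) (at s within {0..1})"
        by (auto intro!: derivative_eq_intros)
      from DERIV_image_chain[OF DERIV_subset[OF * img] this]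
      have "((\<lambda>s. P (t + \<epsilon> * s)) has_real_derivative ?k (t + \<epsilon> * s) * \<epsilon>) (at s within {0..1})"
        by (simp add: o_def)
      then have "((\<lambda>s. P (t + \<epsilon> * s) / \<epsilon>) has_real_derivative ?k (t + \<epsilon> * s)) (at s within {0..1})"
        by (rule DERIV_cdivide[THEN DERIV_cong]) (use e in simp)
      then show "((\<lambda>s. P (t + \<epsilon> * s) / \<epsilon>) has_vector_derivative ?k (t + \<epsilon> * s)) (at s within {0..1})"
        by (simp add: has_real_derivative_iff_has_vector_derivative)
    qed simp
    then show ?thesis by (simp add: integral_unique diff_divide_distrib)
  qed
  have mem: "?t \<in> {a..b}" "?t + \<epsilon> \<in> {a..b}" "?t + h \<in> {a..b}" "?t + \<epsilon> + h \<in> {a..b}" "?t + h + \<epsilon> \<in> {a..b}"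
    using e by (auto simp: a_def b_def)
  have "avg \<epsilon> i F (x(i := ?t + h)) = (P (?t + h + \<epsilon>) - P (?t + h)) / \<epsilon>"
    using A[OF mem(3,5)] by (simp add: avg_def)
  moreover have "avg \<epsilon> i F x = (P (?t + \<epsilon>) - P ?t) / \<epsilon>"
    using A[OF mem(1,2)] by (simp add: avg_def)
  moreover have "\<bar>P (?t + \<epsilon> + h) - P (?t + \<epsilon>) - h * ?k (?t + \<epsilon>)\<bar> \<le> L * h\<^sup>2"
    by (rule antiderivative_lip_quad[OF P k L mem(2,4)])
  moreover have "\<bar>P (?t + h) - P ?t - h * ?k ?t\<bar> \<le> L * h\<^sup>2"
    by (rule antiderivative_lip_quad[OF P k L mem(1,3)])
  moreover have "?k ?t = F x" by simp
  ultimately show "\<bar>avg \<epsilon> i F (x(i := x i + h)) - avg \<epsilon> i F x - h * ((F (x(i := x i + \<epsilon>)) - F x) / \<epsilon>)\<bar>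
      \<le> 2 * L / \<epsilon> * h\<^sup>2"
  proof -
    assume *: "avg \<epsilon> i F (x(i := ?t + h)) = (P (?t + h + \<epsilon>) - P (?t + h)) / \<epsilon>"
      "avg \<epsilon> i F x = (P (?t + \<epsilon>) - P ?t) / \<epsilon>"
      and b1: "\<bar>P (?t + \<epsilon> + h) - P (?t + \<epsilon>) - h * ?k (?t + \<epsilon>)\<bar> \<le> L * h\<^sup>2"
      and b2: "\<bar>P (?t + h) - P ?t - h * ?k ?t\<bar> \<le> L * h\<^sup>2" and kt: "?k ?t = F x"
    have "avg \<epsilon> i F (x(i := x i + h)) - avg \<epsilon> i F x - h * ((F (x(i := x i + \<epsilon>)) - F x) / \<epsilon>)
      = ((P (?t + \<epsilon> + h) - P (?t + \<epsilon>) - h * ?k (?t + \<epsilon>)) - (P (?t + h) - P ?t - h * ?k ?t)) / \<epsilon>"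
      unfolding * using e by (simp add: field_simps)
    also have "\<bar>\<dots>\<bar> \<le> 2 * L * h\<^sup>2 / \<epsilon>"
      unfolding abs_divide using e b1 b2 by (simp add: divide_right_mono)
    finally show ?thesis by simp
  qed
qed

text \<open>The new derivative must be Lipschitz itself, in order to be averaged again and to be
  followed along a path in \<open>gradient_le_loclip\<close>. That the constant blows up as
  \<epsilon> tends to 0 is harmless: it enters no final estimate.\<close>

lemma lipn_quotient:
  assumes F: "lipn n L F" and e: "0 < \<epsilon>"
  shows "lipn n (2 * L / \<epsilon>) (\<lambda>x. (F (x(i := x i + \<epsilon>)) - F x) / \<epsilon>)"
  unfolding lipn_def
proof (intro allI)
  fix x y
  have "\<bar>F (x(i := x i + \<epsilon>)) - F (y(i := y i + \<epsilon>))\<bar> \<le> L * rdist n x y"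
    using lipnD[OF F, of "x(i := x i + \<epsilon>)" "y(i := y i + \<epsilon>)"] by (simp add: rdist_shift)
  moreover have "\<bar>F x - F y\<bar> \<le> L * rdist n x y" by (rule lipnD[OF F])
  ultimately have "\<bar>(F (x(i := x i + \<epsilon>)) - F x) - (F (y(i := y i + \<epsilon>)) - F y)\<bar> \<le> 2 * L * rdist n x y"
    by linarith
  then have "\<bar>(F (x(i := x i + \<epsilon>)) - F x) - (F (y(i := y i + \<epsilon>)) - F y)\<bar> / \<epsilon> \<le> 2 * L * rdist n x y / \<epsilon>"
    using e by (simp add: divide_right_mono)
  then show "\<bar>(F (x(i := x i + \<epsilon>)) - F x) / \<epsilon> - (F (y(i := y i + \<epsilon>)) - F y) / \<epsilon>\<bar> \<le> 2 * L / \<epsilon> * rdist n x y"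
    using e by (simp flip: diff_divide_distrib)
qed

text \<open>\<open>k\<close> counts the coordinates averaged so far and is finally taken to be
  \<open>n\<close>. One step averages along coordinate \<open>k\<close>: the earlier derivatives are
  averaged together with the function and remain its derivatives, and the difference quotient
  supplies the new one.\<close>

lemma smoothing:
  assumes F: "lipn n L F" and L: "0 \<le> L" and e: "0 < \<epsilon>" and M: "\<And>x. \<bar>F x\<bar> \<le> M"
  shows "\<exists>F' G K. lipn n L F' \<and> (\<forall>x. \<bar>F' x\<bar> \<le> M) \<and> (\<forall>x. \<bar>F' x - F x\<bar> \<le> real k * L * \<epsilon>) \<and>
    (\<forall>r \<rho> x. loclip n r \<rho> x F \<longrightarrow> loclip n (r - real k * \<epsilon>) \<rho> x F') \<and>
    (\<forall>i<k. lipn n K (G i) \<and> partial_quad i K F' (G i))"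
proof (induction k)
  case 0
  show ?case
    by (rule exI[of _ F]) (use F M in auto)
next
  case (Suc k)
  then obtain F' G K where F': "lipn n L F'" and M': "\<And>x. \<bar>F' x\<bar> \<le> M"
    and cl: "\<And>x. \<bar>F' x - F x\<bar> \<le> real k * L * \<epsilon>"
    and loc: "\<And>r \<rho> x. loclip n r \<rho> x F \<Longrightarrow> loclip n (r - real k * \<epsilon>) \<rho> x F'"
    and G: "\<And>i. i < k \<Longrightarrow> lipn n K (G i)" and pd: "\<And>i. i < k \<Longrightarrow> partial_quad i K F' (G i)"
    by metis
  define K' where "K' = max K (2 * L / \<epsilon>)"
  define G' where "G' i = (if i < k then avg \<epsilon> k (G i) else (\<lambda>x. (F' (x(i := x i + \<epsilon>)) - F' x) / \<epsilon>))" for i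
  have "lipn n K' (G' i) \<and> partial_quad i K' (avg \<epsilon> k F') (G' i)" if "i < Suc k" for i
  proof (cases "i < k")
    case True
    then have "lipn n K (G' i)" "partial_quad i K (avg \<epsilon> k F') (G' i)"
      using lipn_avg[OF G] partial_quad_avg_other[OF F' G pd] by (auto simp: G'_def)
    then show ?thesis
      by (auto simp: K'_def intro: lipn_mono partial_quad_mono)
  next
    case False
    with that have "i = k" by simp
    then have "lipn n (2 * L / \<epsilon>) (G' i)" "partial_quad i (2 * L / \<epsilon>) (avg \<epsilon> k F') (G' i)"
      using lipn_quotient[OF F' e] partial_quad_avg_same[OF F' L e] by (auto simp: G'_def)
    then show ?thesis
      by (auto simp: K'_def intro: lipn_mono partial_quad_mono)
  qed
  moreover have "\<bar>avg \<epsilon> k F' x - F x\<bar> \<le> real (Suc k) * L * \<epsilon>" for x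
    using avg_close[OF F' less_imp_le[OF e] L, of k x] cl[of x] by (simp add: algebra_simps)
  moreover have "loclip n (r - real (Suc k) * \<epsilon>) \<rho> x (avg \<epsilon> k F')" if "loclip n r \<rho> x F" for r \<rho> x
    using loclip_avg[OF F' loc[OF that], of \<epsilon> k] e by (simp add: algebra_simps)
  ultimately show ?case
    using lipn_avg[OF F', of \<epsilon> k] avg_bound[OF F' M', of \<epsilon> k]
    by (intro exI[of _ "avg \<epsilon> k F'"] exI[of _ G'] exI[of _ K']) auto
qed

text \<open>Walk from \<open>x\<close> in the direction of the gradient, one coordinate at a time.\<close>
lemma gradient_le_loclip:
  assumes G: "\<And>i. i < n \<Longrightarrow> lipn n K (G i)" and pd: "\<And>i. i < n \<Longrightarrow> partial_quad i K F (G i)"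
    and loc: "loclip n r \<rho> x F" and r: "0 < r" and \<rho>: "0 \<le> \<rho>"
  shows "(\<Sum>i<n. (G i x)\<^sup>2) \<le> \<rho>\<^sup>2"
proof -
  define v where "v i = G i x" for i
  define S where "S = (\<Sum>i<n. (v i)\<^sup>2)"
  define y where "y t k = (\<lambda>i. if i < k then x i + t * v i else x i)" for t :: real and k
  have S0: "0 \<le> S" by (simp add: S_def sum_nonneg)
  have dist: "rdist n (y t k) x \<le> t * sqrt S" if "k \<le> n" "0 \<le> t" for t k
  proof -
    have "(\<Sum>i<n. (y t k i - x i)\<^sup>2) \<le> (\<Sum>i<n. t\<^sup>2 * (v i)\<^sup>2)"
      by (intro sum_mono) (auto simp: y_def power_mult_distrib)
    also have "\<dots> = t\<^sup>2 * S" by (simp add: S_def sum_distrib_left)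
    finally have "rdist n (y t k) x \<le> sqrt (t\<^sup>2 * S)"
      by (simp add: rdist_def L2_set_def)
    then show ?thesis using that by (simp add: real_sqrt_mult)
  qed
  \<comment> \<open>Second-order errors of the walk, divided by t^2: \<open>G k\<close> has drifted
    by at most K t sqrt S after the earlier coordinates moved, and the quadratic remainder adds the
    term with (v k)^2.\<close>
  define C where "C = (\<Sum>k<n. max K 0 * \<bar>v k\<bar> * sqrt S + max K 0 * (v k)\<^sup>2)"
  have step: "t * (v k)\<^sup>2 - t\<^sup>2 * (max K 0 * \<bar>v k\<bar> * sqrt S + max K 0 * (v k)\<^sup>2) \<le> F (y t (Suc k)) - F (y t k)"
    if k: "k < n" and t: "0 \<le> t" for t k
  proof -
    have eq: "y t (Suc k) = (y t k)(k := y t k k + t * v k)"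
      by (auto simp: y_def fun_eq_iff less_Suc_eq)
    have "\<bar>F (y t (Suc k)) - F (y t k) - (t * v k) * G k (y t k)\<bar> \<le> K * (t * v k)\<^sup>2"
      using pd[OF k] unfolding eq partial_quad_def by blast
    also have "\<dots> \<le> max K 0 * (t * v k)\<^sup>2" by (intro mult_right_mono) auto
    finally have 1: "(t * v k) * G k (y t k) - max K 0 * (t * v k)\<^sup>2 \<le> F (y t (Suc k)) - F (y t k)"
      by linarith
    have "\<bar>G k (y t k) - v k\<bar> \<le> max K 0 * rdist n (y t k) x"
      unfolding v_def by (rule lipnD[OF lipn_nonneg[OF G[OF k]]])
    also have "\<dots> \<le> max K 0 * (t * sqrt S)"
      using dist[of k t] k t by (intro mult_left_mono) auto
    finally have "\<bar>t * v k\<bar> * \<bar>G k (y t k) - v k\<bar> \<le> \<bar>t * v k\<bar> * (max K 0 * (t * sqrt S))"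
      by (intro mult_left_mono) auto
    then have "\<bar>(t * v k) * G k (y t k) - t * (v k)\<^sup>2\<bar> \<le> t\<^sup>2 * (max K 0 * \<bar>v k\<bar> * sqrt S)"
      using t by (simp add: abs_mult[symmetric] algebra_simps power2_eq_square) (simp add: abs_mult algebra_simps)
    with 1 show ?thesis
      by (simp add: algebra_simps power_mult_distrib)
  qed
  have main: "t * S - t\<^sup>2 * C \<le> \<rho> * (t * sqrt S)" if t: "0 < t" "t * sqrt S < r" for t
  proof -
    have "t * S - t\<^sup>2 * C = (\<Sum>k<n. t * (v k)\<^sup>2 - t\<^sup>2 * (max K 0 * \<bar>v k\<bar> * sqrt S + max K 0 * (v k)\<^sup>2))"
      by (simp add: S_def C_def sum_distrib_left sum_subtractf)
    also have "\<dots> \<le> (\<Sum>k<n. F (y t (Suc k)) - F (y t k))"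
      using step t by (intro sum_mono) auto
    also have "\<dots> = F (y t n) - F (y t 0)"
      by (rule sum_lessThan_telescope)
    also have "\<dots> \<le> \<rho> * rdist n (y t n) (y t 0)"
    proof -
      have "rdist n (y t n) x < r" "rdist n (y t 0) x < r"
        using dist[of n t] dist[of 0 t] t by auto
      then have "\<bar>F (y t n) - F (y t 0)\<bar> \<le> \<rho> * rdist n (y t n) (y t 0)"
        using loc unfolding loclip_def by blast
      then show ?thesis by linarith
    qed
    also have "y t 0 = x" by (simp add: y_def)
    finally have "t * S - t\<^sup>2 * C \<le> \<rho> * rdist n (y t n) x" .
    also have "\<dots> \<le> \<rho> * (t * sqrt S)"
      using dist[of n t] t \<rho> by (intro mult_left_mono) auto
    finally show ?thesis .
  qed
  \<comment> \<open>Divide \<open>main\<close> by t and let t tend to 0, which removes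
    \<open>C\<close>; cancelling sqrt S then gives the bound on the gradient.\<close>
  have "S \<le> \<rho> * sqrt S"
  proof (rule tendsto_lowerbound)
    show "((\<lambda>t. \<rho> * sqrt S + t * C) \<longlongrightarrow> \<rho> * sqrt S) (at_right 0)"
      by (auto intro!: tendsto_eq_intros)
    have "eventually (\<lambda>t::real. t < r / (sqrt S + 1)) (at_right 0)"
      using r S0 by (intro order_tendstoD(2)[OF tendsto_ident_at]) (auto intro!: divide_pos_pos add_nonneg_pos)
    moreover have "eventually (\<lambda>t::real. 0 < t) (at_right 0)"
      by (simp add: eventually_at_right_less)
    ultimately show "eventually (\<lambda>t. S \<le> \<rho> * sqrt S + t * C) (at_right 0)"
    proof eventually_elim
      case (elim t)
      have "0 < sqrt S + 1" using S0 by (simp add: add_nonneg_pos)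
      with elim have "t * (sqrt S + 1) < r" by (simp add: field_simps)
      then have "t * sqrt S < r" using elim by (simp add: algebra_simps)
      from main[OF elim(2) this]
      have "t * S \<le> t * (\<rho> * sqrt S + t * C)" by (simp add: algebra_simps power2_eq_square)
      then show ?case using elim by simp
    qed
  qed simp
  then have "sqrt S * sqrt S \<le> \<rho> * sqrt S" using S0 by simp
  then have "sqrt S \<le> \<rho>"
    using \<rho> S0 mult_right_le_imp_le[of "sqrt S" "sqrt S" \<rho>] by (cases "S = 0") auto
  then have "(sqrt S)\<^sup>2 \<le> \<rho>\<^sup>2"
    using S0 by (intro power_mono) auto
  then show ?thesis using S0 by (simp add: S_def v_def)
qed

section \<open>The Poincare inequality in dimension one\<close>

text \<open>The variance, in moment form so that Fubini applies termwise. By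
  \<open>half_double_integral_eq_vari\<close> it is the left side of the inequality in
  \<open>C22\<close>.\<close>

definition vari :: "'a measure \<Rightarrow> ('a \<Rightarrow> real) \<Rightarrow> real" where
  "vari M f = (\<integral>x. (f x)\<^sup>2 \<partial>M) - (\<integral>x. f x \<partial>M)\<^sup>2"

lemma (in prob_space) integrable_bounded:
  fixes f :: "'a \<Rightarrow> real"
  assumes "f \<in> borel_measurable M" "\<And>x. x \<in> space M \<Longrightarrow> \<bar>f x\<bar> \<le> B"
  shows "integrable M f"
  by (rule integrable_const_bound[where B = B]) (use assms in auto)

lemma (in prob_space) integrable_bounded_square:
  fixes f :: "'a \<Rightarrow> real"
  assumes "f \<in> borel_measurable M" "\<And>x. x \<in> space M \<Longrightarrow> \<bar>f x\<bar> \<le> B"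
  shows "integrable M (\<lambda>x. (f x)\<^sup>2)"
proof (rule integrable_bounded[where B = "B\<^sup>2"])
  show "\<bar>(f x)\<^sup>2\<bar> \<le> B\<^sup>2" if "x \<in> space M" for x
    using power_mono[OF assms(2)[OF that], of 2] by simp
qed (use assms in measurable)

lemma (in prob_space) half_double_integral_eq_vari:
  assumes f[measurable]: "f \<in> borel_measurable M"
    and i1: "integrable M f" and i2: "integrable M (\<lambda>x. (f x)\<^sup>2)"
  shows "ennreal (1/2) * (\<integral>\<^sup>+ (x, y). ennreal ((f x - f y)\<^sup>2) \<partial>(M \<Otimes>\<^sub>M M)) = ennreal (vari M f)"
proof -
  define m s where "m = (\<integral>x. f x \<partial>M)" and "s = (\<integral>x. (f x)\<^sup>2 \<partial>M)"
  have inner: "(\<integral>\<^sup>+ y. ennreal ((f x - f y)\<^sup>2) \<partial>M) = ennreal ((f x)\<^sup>2 - 2 * f x * m + s)" for x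
  proof -
    have "(\<integral>\<^sup>+ y. ennreal ((f x - f y)\<^sup>2) \<partial>M) = ennreal (\<integral>y. (f x - f y)\<^sup>2 \<partial>M)"
    proof (rule nn_integral_eq_integral)
      show "integrable M (\<lambda>y. (f x - f y)\<^sup>2)"
        unfolding power2_diff using i1 i2 by simp
    qed simp
    also have "(\<integral>y. (f x - f y)\<^sup>2 \<partial>M) = (f x)\<^sup>2 - 2 * f x * m + s"
      unfolding power2_diff using i1 i2 by (simp add: m_def s_def prob_space)
    finally show ?thesis .
  qed
  have nn: "0 \<le> (f x)\<^sup>2 - 2 * f x * m + s" for x
  proof -
    have "0 \<le> (\<integral>y. (f x - f y)\<^sup>2 \<partial>M)" by simp
    also have "\<dots> = (f x)\<^sup>2 - 2 * f x * m + s"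
      unfolding power2_diff using i1 i2 by (simp add: m_def s_def prob_space)
    finally show ?thesis .
  qed
  have "(\<integral>\<^sup>+ (x, y). ennreal ((f x - f y)\<^sup>2) \<partial>(M \<Otimes>\<^sub>M M)) = (\<integral>\<^sup>+ x. \<integral>\<^sup>+ y. ennreal ((f x - f y)\<^sup>2) \<partial>M \<partial>M)"
    by (subst nn_integral_fst[symmetric]) auto
  also have "\<dots> = (\<integral>\<^sup>+ x. ennreal ((f x)\<^sup>2 - 2 * f x * m + s) \<partial>M)"
    by (simp add: inner)
  also have "\<dots> = ennreal (\<integral>x. (f x)\<^sup>2 - 2 * f x * m + s \<partial>M)"
    using i1 i2 nn by (intro nn_integral_eq_integral) auto
  also have "(\<integral>x. (f x)\<^sup>2 - 2 * f x * m + s \<partial>M) = 2 * vari M f"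
    using i1 i2 by (simp add: m_def[symmetric] s_def[symmetric] prob_space vari_def) (simp add: power2_eq_square)
  finally have "(\<integral>\<^sup>+ (x, y). ennreal ((f x - f y)\<^sup>2) \<partial>(M \<Otimes>\<^sub>M M)) = ennreal (2 * vari M f)" .
  moreover have "ennreal (1/2) * ennreal (2 * vari M f) = ennreal (vari M f)"
    by (subst ennreal_mult'[symmetric]) auto
  ultimately show ?thesis by (simp only:)
qed

text \<open>\<open>c\<close> plays the role of the square of the constant in \<open>C22\<close>. The
  test functions are those that arise as coordinate slices of smoothed functions.\<close>

definition poincare_line :: "real \<Rightarrow> real measure \<Rightarrow> bool" where
  "poincare_line c \<mu> \<longleftrightarrow>
     (\<forall>g g'. (\<forall>t. (g has_real_derivative g' t) (at t)) \<longrightarrow> continuous_on UNIV g' \<longrightarrow>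
        bounded (range g) \<longrightarrow> bounded (range g') \<longrightarrow>
        vari \<mu> g \<le> c * (\<integral>t. (g' t)\<^sup>2 \<partial>\<mu>))"

text \<open>Cauchy-Schwarz with weight \<phi>', in the form that (g' - c \<phi>')^2 / \<phi>' has
  nonnegative integral; c is the ratio of the increments of g and \<phi>, which minimises this
  integral.\<close>

lemma square_increment_le_weighted:
  fixes g \<phi> :: "real \<Rightarrow> real"
  assumes g: "\<And>t. (g has_real_derivative g' t) (at t)" and cg: "continuous_on UNIV g'"
    and \<phi>: "\<And>t. (\<phi> has_real_derivative \<phi>' t) (at t)" and cp: "continuous_on UNIV \<phi>'"
    and pos: "\<And>t. t \<in> {x..y} \<Longrightarrow> 0 < \<phi>' t" and xy: "x < y"
  shows "ennreal ((g x - g y)\<^sup>2) \<le>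
    ennreal (\<phi> y - \<phi> x) * (\<integral>\<^sup>+ t. ennreal ((g' t)\<^sup>2 / \<phi>' t) * indicator {x..y} t \<partial>lborel)"
proof -
  have c0: "continuous_on {x..y} (\<lambda>t. (g' t)\<^sup>2 / \<phi>' t)"
    using pos by (intro continuous_intros continuous_on_subset[OF cg] continuous_on_subset[OF cp]) fastforce+
  define I where "I = integral {x..y} (\<lambda>t. (g' t)\<^sup>2 / \<phi>' t)"
  have I: "((\<lambda>t. (g' t)\<^sup>2 / \<phi>' t) has_integral I) {x..y}"
    unfolding I_def by (intro integrable_integral integrable_continuous_interval c0)
  have Ig: "(g' has_integral (g y - g x)) {x..y}"
    using g xy by (intro fundamental_theorem_of_calculus)
      (auto simp: has_real_derivative_iff_has_vector_derivative[symmetric] intro: DERIV_subset)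
  have Ip: "(\<phi>' has_integral (\<phi> y - \<phi> x)) {x..y}"
    using \<phi> xy by (intro fundamental_theorem_of_calculus)
      (auto simp: has_real_derivative_iff_has_vector_derivative[symmetric] intro: DERIV_subset)
  obtain z where z: "x < z" "z < y" "\<phi> y - \<phi> x = (y - x) * \<phi>' z"
    using MVT2[OF xy, of \<phi> \<phi>'] \<phi> by blast
  have p: "0 < \<phi> y - \<phi> x"
    unfolding z(3) using z pos[of z] xy by auto
  define c where "c = (g y - g x) / (\<phi> y - \<phi> x)"
  have "((\<lambda>t. (g' t)\<^sup>2 / \<phi>' t - 2 * c * g' t + c\<^sup>2 * \<phi>' t) has_integral (I - 2 * c * (g y - g x) + c\<^sup>2 * (\<phi> y - \<phi> x))) {x..y}"
    by (intro has_integral_add has_integral_diff has_integral_mult_right I Ig Ip)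
  then have "0 \<le> I - 2 * c * (g y - g x) + c\<^sup>2 * (\<phi> y - \<phi> x)"
  proof (rule has_integral_nonneg)
    fix t assume "t \<in> {x..y}"
    then have q: "0 < \<phi>' t" by (rule pos)
    have "(g' t)\<^sup>2 / \<phi>' t - 2 * c * g' t + c\<^sup>2 * \<phi>' t = (g' t - c * \<phi>' t)\<^sup>2 / \<phi>' t"
      using q by (simp add: field_simps power2_eq_square)
    then show "0 \<le> (g' t)\<^sup>2 / \<phi>' t - 2 * c * g' t + c\<^sup>2 * \<phi>' t"
      using q by simp
  qed
  also have "\<dots> = I - (g y - g x)\<^sup>2 / (\<phi> y - \<phi> x)"
  proof -
    have "c * (g y - g x) = (g y - g x)\<^sup>2 / (\<phi> y - \<phi> x)"
      by (simp add: c_def power2_eq_square)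
    moreover have "c\<^sup>2 * (\<phi> y - \<phi> x) = (g y - g x)\<^sup>2 / (\<phi> y - \<phi> x)"
      using p by (simp add: c_def power2_eq_square)
    ultimately show ?thesis by (simp add: mult.assoc)
  qed
  finally have le: "(g x - g y)\<^sup>2 \<le> (\<phi> y - \<phi> x) * I"
    using p by (simp add: field_simps power2_commute)
  have I0: "0 \<le> I"
    using I by (rule has_integral_nonneg) (use pos in \<open>auto intro!: divide_nonneg_pos\<close>)
  have "(\<integral>\<^sup>+ t. ennreal ((g' t)\<^sup>2 / \<phi>' t) * indicator {x..y} t \<partial>lborel) = ennreal I"
  proof (rule nn_integral_has_integral_lebesgue'[OF _ I])
    show "0 \<le> (g' t)\<^sup>2 / \<phi>' t" if "t \<in> {x..y}" for t
      using pos[OF that] by simp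
  qed
  then show ?thesis
    using le I0 p by (simp add: ennreal_mult[symmetric])
qed

text \<open>
  \<open>\<phi>\<close> is the first eigenfunction: the tail condition is the integrated form of
  \<open>- (p \<phi>')' = p \<phi> / c\<close>.  Integrating the bound of \<open>square_increment_le_weighted\<close> over \<open>x < y\<close> and exchanging
  integrals, the weight of \<open>(g' t)\<^sup>2 / \<phi>' t\<close> is exactly \<open>c * p t * \<phi>' t\<close>.
\<close>
lemma poincare_line_density:
  fixes p \<phi> \<phi>' :: "real \<Rightarrow> real" and J :: "real set"
  assumes p[measurable]: "p \<in> borel_measurable borel" and p0: "\<And>t. 0 \<le> p t"
    and prob: "prob_space (density lborel (\<lambda>x. ennreal (p x)))"
    and \<phi>: "\<And>t. (\<phi> has_real_derivative \<phi>' t) (at t)" and cp: "continuous_on UNIV \<phi>'"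
    and J: "J \<in> sets borel" "\<And>x y. x \<in> J \<Longrightarrow> y \<in> J \<Longrightarrow> {x..y} \<subseteq> J"
    and AEJ: "AE x in density lborel (\<lambda>x. ennreal (p x)). x \<in> J"
    and pos: "\<And>t. t \<in> J \<Longrightarrow> 0 < \<phi>' t"
    and int: "integrable (density lborel (\<lambda>x. ennreal (p x))) \<phi>"
    and mean: "(\<integral>x. \<phi> x \<partial>density lborel (\<lambda>x. ennreal (p x))) = 0"
    and tail: "\<And>t. t \<in> J \<Longrightarrow>
      (\<integral>x. indicator {t..} x * \<phi> x \<partial>density lborel (\<lambda>x. ennreal (p x))) = c * p t * \<phi>' t"
    and c: "0 \<le> c"
  shows "poincare_line c (density lborel (\<lambda>x. ennreal (p x)))"
proof -
  let ?\<mu> = "density lborel (\<lambda>x. ennreal (p x))"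
  interpret prob_space ?\<mu> by fact
  interpret P: pair_sigma_finite ?\<mu> ?\<mu> ..
  interpret L: pair_sigma_finite ?\<mu> lborel ..
  have [measurable]: "J \<in> sets borel" by fact
  have contphi: "continuous_on UNIV \<phi>"
    using \<phi> by (meson DERIV_continuous_on DERIV_subset subset_UNIV)
  have [measurable]: "\<phi> \<in> borel_measurable borel" "\<phi>' \<in> borel_measurable borel"
    using contphi cp by (auto intro: borel_measurable_continuous_onI)
  have mono: "\<phi> x \<le> \<phi> y" if "x \<in> J" "y \<in> J" "x \<le> y" for x y
  proof (rule DERIV_nonneg_imp_nondecreasing[OF that(3)])
    fix t assume "x \<le> t" "t \<le> y"
    then have "t \<in> J" using J(2)[OF that(1,2)] by auto
    then show "\<exists>z. (\<phi> has_real_derivative z) (at t) \<and> 0 \<le> z"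
      using \<phi> pos less_imp_le by blast
  qed
  \<comment> \<open>Integrating over y gives \<beta> - q \<phi>(x); integrating this over x \<le> t
    gives \<beta> times the mass of {..t}, minus q times the lower tail of \<phi>. Mean zero makes
    that tail equal to -\<beta>, and the two masses add up to 1.\<close>
  have key: "(\<integral>\<^sup>+ x. \<integral>\<^sup>+ y. ennreal (\<phi> y - \<phi> x) * indicator {..t} x * indicator {t..} y \<partial>?\<mu> \<partial>?\<mu>)
      = ennreal (c * p t * \<phi>' t)" if t: "t \<in> J" for t
  proof -
    define \<beta> q where "\<beta> = c * p t * \<phi>' t" and "q = measure ?\<mu> {t..}"
    have it: "integrable ?\<mu> (\<lambda>y. indicator {t..} y * \<phi> y)" "integrable ?\<mu> (\<lambda>y. indicator {..t} y * \<phi> y)"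
      using integrable_mult_indicator[OF _ int, of "{t..}"] integrable_mult_indicator[OF _ int, of "{..t}"]
      by simp_all
    have iq: "integrable ?\<mu> (\<lambda>y. indicator {t..} y :: real)" "integrable ?\<mu> (\<lambda>y. indicator {..t} y :: real)"
      by (auto intro!: integrable_real_indicator simp: emeasure_eq_measure)
    have inner: "(\<integral>\<^sup>+ y. ennreal (\<phi> y - \<phi> x) * indicator {..t} x * indicator {t..} y \<partial>?\<mu>)
        = ennreal (indicator {..t} x * (\<beta> - q * \<phi> x))"
      and inner0: "0 \<le> indicator {..t} x * (\<beta> - q * \<phi> x)" if x: "x \<in> J" for x
    proof -
      have nn: "AE y in ?\<mu>. 0 \<le> indicator {..t} x * (indicator {t..} y * \<phi> y - \<phi> x * indicator {t..} y)"
        using AEJ by eventually_elim (use x mono in \<open>auto simp: indicator_def\<close>)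
      have int': "integrable ?\<mu> (\<lambda>y. indicator {..t} x * (indicator {t..} y * \<phi> y - \<phi> x * indicator {t..} y))"
        using it iq by auto
      have val: "(\<integral>y. indicator {..t} x * (indicator {t..} y * \<phi> y - \<phi> x * indicator {t..} y) \<partial>?\<mu>)
        = indicator {..t} x * (\<beta> - q * \<phi> x)"
        using it iq tail[OF t] by (simp add: \<beta>_def q_def)
      have "(\<integral>\<^sup>+ y. ennreal (\<phi> y - \<phi> x) * indicator {..t} x * indicator {t..} y \<partial>?\<mu>)
        = (\<integral>\<^sup>+ y. ennreal (indicator {..t} x * (indicator {t..} y * \<phi> y - \<phi> x * indicator {t..} y)) \<partial>?\<mu>)"
        by (intro nn_integral_cong) (auto simp: indicator_def)
      also have "\<dots> = ennreal (\<integral>y. indicator {..t} x * (indicator {t..} y * \<phi> y - \<phi> x * indicator {t..} y) \<partial>?\<mu>)"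
        by (rule nn_integral_eq_integral[OF int' nn])
      finally show "(\<integral>\<^sup>+ y. ennreal (\<phi> y - \<phi> x) * indicator {..t} x * indicator {t..} y \<partial>?\<mu>)
        = ennreal (indicator {..t} x * (\<beta> - q * \<phi> x))" unfolding val .
      show "0 \<le> indicator {..t} x * (\<beta> - q * \<phi> x)"
        using integral_nonneg_AE[OF nn] unfolding val .
    qed
    have t0: "emeasure ?\<mu> {t} = 0"
      by (simp add: emeasure_density)
    have one: "measure ?\<mu> {..t} + q = 1"
    proof -
      have "1 = measure ?\<mu> ({..<t} \<union> {t..})"
      proof -
        have "{..<t} \<union> {t..} = UNIV" by auto
        then show ?thesis using prob_space by simp
      qed
      also have "\<dots> = measure ?\<mu> {..<t} + q"
        unfolding q_def by (rule finite_measure_Union) auto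
      also have "measure ?\<mu> {..<t} = measure ?\<mu> {..t}"
      proof -
        have "measure ?\<mu> ({..<t} \<union> {t}) = measure ?\<mu> {..<t} + measure ?\<mu> {t}"
          by (rule finite_measure_Union) auto
        moreover have "measure ?\<mu> {t} = 0" using t0 by (simp add: measure_def)
        moreover have "{..<t} \<union> {t} = {..t}" by auto
        ultimately show ?thesis by simp
      qed
      finally show ?thesis by simp
    qed
    have low: "(\<integral>x. indicator {..t} x * \<phi> x \<partial>?\<mu>) = - \<beta>"
    proof -
      have "(\<integral>x. indicator {..t} x * \<phi> x \<partial>?\<mu>) + (\<integral>x. indicator {t..} x * \<phi> x \<partial>?\<mu>)
        = (\<integral>x. indicator {..t} x * \<phi> x + indicator {t..} x * \<phi> x \<partial>?\<mu>)"
        using it by simp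
      also have "\<dots> = (\<integral>x. \<phi> x \<partial>?\<mu>)"
      proof (rule integral_cong_AE)
        have "AE x in ?\<mu>. x \<noteq> t"
          using t0 by (intro AE_I[where N = "{t}"]) auto
        then show "AE x in ?\<mu>. indicator {..t} x * \<phi> x + indicator {t..} x * \<phi> x = \<phi> x"
          by eventually_elim (auto simp: indicator_def)
      qed auto
      finally show ?thesis using mean tail[OF t] by (simp add: \<beta>_def)
    qed
    have "(\<integral>\<^sup>+ x. \<integral>\<^sup>+ y. ennreal (\<phi> y - \<phi> x) * indicator {..t} x * indicator {t..} y \<partial>?\<mu> \<partial>?\<mu>)
      = (\<integral>\<^sup>+ x. ennreal (indicator {..t} x * (\<beta> - q * \<phi> x)) \<partial>?\<mu>)"
      by (rule nn_integral_cong_AE, rule AE_mp[OF AEJ], rule AE_I2, rule impI, rule inner)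
    also have "\<dots> = (\<integral>\<^sup>+ x. ennreal (\<beta> * indicator {..t} x - q * (indicator {..t} x * \<phi> x)) \<partial>?\<mu>)"
      by (intro nn_integral_cong) (auto simp: indicator_def)
    also have "\<dots> = ennreal (\<integral>x. \<beta> * indicator {..t} x - q * (indicator {..t} x * \<phi> x) \<partial>?\<mu>)"
    proof (rule nn_integral_eq_integral)
      show "AE x in ?\<mu>. 0 \<le> \<beta> * indicator {..t} x - q * (indicator {..t} x * \<phi> x)"
        using AEJ
      proof eventually_elim
        case (elim x)
        show ?case using inner0[OF elim] by (auto simp: indicator_def split: if_splits)
      qed
    qed (use it iq in auto)
    also have "(\<integral>x. \<beta> * indicator {..t} x - q * (indicator {..t} x * \<phi> x) \<partial>?\<mu>) = \<beta> * (measure ?\<mu> {..t} + q)"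
      using it iq low by (simp add: algebra_simps)
    finally show ?thesis using one by (simp add: \<beta>_def)
  qed
  show ?thesis
    unfolding poincare_line_def
  proof (intro allI impI)
    fix g g' :: "real \<Rightarrow> real"
    assume g: "\<forall>t. (g has_real_derivative g' t) (at t)" and cg: "continuous_on UNIV g'"
      and bg: "bounded (range g)" and bg': "bounded (range g')"
    have "continuous_on UNIV g"
      using g by (meson DERIV_continuous_on DERIV_subset subset_UNIV)
    then have [measurable]: "g \<in> borel_measurable borel" "g' \<in> borel_measurable borel"
      using cg by (auto intro: borel_measurable_continuous_onI)
    obtain B where B: "\<And>x. \<bar>g x\<bar> \<le> B" using bg unfolding bounded_iff by auto
    obtain B' where B': "\<And>x. \<bar>g' x\<bar> \<le> B'" using bg' unfolding bounded_iff by auto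
    have ints: "integrable ?\<mu> g" "integrable ?\<mu> (\<lambda>x. (g x)\<^sup>2)" "integrable ?\<mu> (\<lambda>x. (g' x)\<^sup>2)"
      using B B' by (auto intro!: integrable_bounded integrable_bounded_square)
    \<comment> \<open>Set to 0 off \<open>J\<close>, where \<phi>' need not be positive. Segments
      between points of \<open>J\<close> stay in \<open>J\<close>, so the bound on increments is
      unaffected.\<close>
    define h where "h t = (if t \<in> J then (g' t)\<^sup>2 / \<phi>' t else 0)" for t
    have [measurable]: "h \<in> borel_measurable borel"
      unfolding h_def by measurable
    \<comment> \<open>The pairs x < y and y < x contribute equally and the diagonal contributes 0,
      so with the factor 1/2 the variance is exactly \<open>?T\<close>.\<close>
    let ?T = "\<integral>\<^sup>+ x. \<integral>\<^sup>+ y. ennreal ((g x - g y)\<^sup>2) * indicator {x<..} y \<partial>?\<mu> \<partial>?\<mu>"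
    have "(\<integral>\<^sup>+ (x, y). ennreal ((g x - g y)\<^sup>2) \<partial>(?\<mu> \<Otimes>\<^sub>M ?\<mu>)) = (\<integral>\<^sup>+ x. \<integral>\<^sup>+ y. ennreal ((g x - g y)\<^sup>2) \<partial>?\<mu> \<partial>?\<mu>)"
      by (subst nn_integral_fst[symmetric]) auto
    also have "\<dots> = (\<integral>\<^sup>+ x. \<integral>\<^sup>+ y. ennreal ((g x - g y)\<^sup>2) * indicator {x<..} y
          + ennreal ((g y - g x)\<^sup>2) * indicator {y<..} x \<partial>?\<mu> \<partial>?\<mu>)"
      by (intro nn_integral_cong) (auto simp: indicator_def power2_commute)
    also have "\<dots> = ?T + (\<integral>\<^sup>+ x. \<integral>\<^sup>+ y. ennreal ((g y - g x)\<^sup>2) * indicator {y<..} x \<partial>?\<mu> \<partial>?\<mu>)"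
      by (simp add: nn_integral_add indicator_def)
    also have "(\<integral>\<^sup>+ x. \<integral>\<^sup>+ y. ennreal ((g y - g x)\<^sup>2) * indicator {y<..} x \<partial>?\<mu> \<partial>?\<mu>) = ?T"
      by (rule P.Fubini') (simp add: indicator_def)
    finally have dbl: "(\<integral>\<^sup>+ (x, y). ennreal ((g x - g y)\<^sup>2) \<partial>(?\<mu> \<Otimes>\<^sub>M ?\<mu>)) = ?T + ?T" .
    have "?T \<le> (\<integral>\<^sup>+ x. \<integral>\<^sup>+ y. ennreal (\<phi> y - \<phi> x) * (\<integral>\<^sup>+ t. ennreal (h t) * indicator {x..} t * indicator {..y} t \<partial>lborel) \<partial>?\<mu> \<partial>?\<mu>)"
    proof (intro nn_integral_mono_AE)
      show "AE x in ?\<mu>. (\<integral>\<^sup>+ y. ennreal ((g x - g y)\<^sup>2) * indicator {x<..} y \<partial>?\<mu>) \<le>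
        (\<integral>\<^sup>+ y. ennreal (\<phi> y - \<phi> x) * (\<integral>\<^sup>+ t. ennreal (h t) * indicator {x..} t * indicator {..y} t \<partial>lborel) \<partial>?\<mu>)"
        using AEJ
      proof eventually_elim
        case x: (elim x)
        show ?case
        proof (intro nn_integral_mono_AE)
          show "AE y in ?\<mu>. ennreal ((g x - g y)\<^sup>2) * indicator {x<..} y \<le>
            ennreal (\<phi> y - \<phi> x) * (\<integral>\<^sup>+ t. ennreal (h t) * indicator {x..} t * indicator {..y} t \<partial>lborel)"
            using AEJ
          proof eventually_elim
            case y: (elim y)
            show ?case
            proof (cases "x < y")
              case True
              have "ennreal ((g x - g y)\<^sup>2) \<le>
                ennreal (\<phi> y - \<phi> x) * (\<integral>\<^sup>+ t. ennreal ((g' t)\<^sup>2 / \<phi>' t) * indicator {x..y} t \<partial>lborel)"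
                by (rule square_increment_le_weighted[OF _ cg \<phi> cp _ True])
                  (use g pos J(2)[OF x y] in auto)
              also have "(\<integral>\<^sup>+ t. ennreal ((g' t)\<^sup>2 / \<phi>' t) * indicator {x..y} t \<partial>lborel)
                = (\<integral>\<^sup>+ t. ennreal (h t) * indicator {x..} t * indicator {..y} t \<partial>lborel)"
                by (intro nn_integral_cong) (use J(2)[OF x y] in \<open>auto simp: indicator_def h_def\<close>)
              finally show ?thesis using True by simp
            qed simp
          qed
        qed
      qed
    qed
    \<comment> \<open>The condition x \<le> t \<le> y splits into one indicator in x and one in y,
      so with t moved outermost the inner double integral is the one computed in
      \<open>key\<close>.\<close>
    also have "\<dots> = (\<integral>\<^sup>+ x. \<integral>\<^sup>+ y. \<integral>\<^sup>+ t. ennreal (h t) * (ennreal (\<phi> y - \<phi> x) * indicator {..t} x * indicator {t..} y) \<partial>lborel \<partial>?\<mu> \<partial>?\<mu>)"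
      by (subst nn_integral_cmult[symmetric])
        (auto simp: indicator_def mult.commute intro!: nn_integral_cong)
    also have "\<dots> = (\<integral>\<^sup>+ x. \<integral>\<^sup>+ t. \<integral>\<^sup>+ y. ennreal (h t) * (ennreal (\<phi> y - \<phi> x) * indicator {..t} x * indicator {t..} y) \<partial>?\<mu> \<partial>lborel \<partial>?\<mu>)"
      by (intro nn_integral_cong L.Fubini'[symmetric]) (simp add: indicator_def)
    also have "\<dots> = (\<integral>\<^sup>+ t. \<integral>\<^sup>+ x. \<integral>\<^sup>+ y. ennreal (h t) * (ennreal (\<phi> y - \<phi> x) * indicator {..t} x * indicator {t..} y) \<partial>?\<mu> \<partial>?\<mu> \<partial>lborel)"
      by (rule L.Fubini'[symmetric]) (simp add: indicator_def)
    also have "\<dots> = (\<integral>\<^sup>+ t. ennreal (h t) * (\<integral>\<^sup>+ x. \<integral>\<^sup>+ y. ennreal (\<phi> y - \<phi> x) * indicator {..t} x * indicator {t..} y \<partial>?\<mu> \<partial>?\<mu>) \<partial>lborel)"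
      by (simp add: nn_integral_cmult indicator_def)
    also have "\<dots> = (\<integral>\<^sup>+ t. ennreal (p t) * ennreal (indicator J t * (c * (g' t)\<^sup>2)) \<partial>lborel)"
    proof (intro nn_integral_cong)
      fix t
      show "ennreal (h t) * (\<integral>\<^sup>+ x. \<integral>\<^sup>+ y. ennreal (\<phi> y - \<phi> x) * indicator {..t} x * indicator {t..} y \<partial>?\<mu> \<partial>?\<mu>)
        = ennreal (p t) * ennreal (indicator J t * (c * (g' t)\<^sup>2))"
      proof (cases "t \<in> J")
        case True
        then have "(g' t)\<^sup>2 / \<phi>' t * (c * p t * \<phi>' t) = p t * (c * (g' t)\<^sup>2)"
          using pos[OF True] by simp
        then show ?thesis
          using True pos[OF True] p0[of t] c by (simp add: key h_def flip: ennreal_mult)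
      qed (simp add: h_def)
    qed
    also have "\<dots> = (\<integral>\<^sup>+ t. ennreal (indicator J t * (c * (g' t)\<^sup>2)) \<partial>?\<mu>)"
      by (subst nn_integral_density) auto
    also have "\<dots> \<le> (\<integral>\<^sup>+ t. ennreal (c * (g' t)\<^sup>2) \<partial>?\<mu>)"
      using c by (intro nn_integral_mono) (auto simp: indicator_def)
    also have "\<dots> = ennreal (c * (\<integral>t. (g' t)\<^sup>2 \<partial>?\<mu>))"
      using ints c by (subst nn_integral_eq_integral) auto
    finally have T: "?T \<le> ennreal (c * (\<integral>t. (g' t)\<^sup>2 \<partial>?\<mu>))" .
    have "ennreal (vari ?\<mu> g) = ennreal (1/2) * (?T + ?T)"
      using half_double_integral_eq_vari[of g] ints dbl by simp
    also have "\<dots> = (ennreal (1/2) + ennreal (1/2)) * ?T"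
      by (simp only: distrib_left distrib_right)
    also have "ennreal (1/2) + ennreal (1/2) = 1"
      by (subst ennreal_plus[symmetric]) auto
    finally have "ennreal (vari ?\<mu> g) = ?T"
      by (simp only: mult_1)
    with T have "ennreal (vari ?\<mu> g) \<le> ennreal (c * (\<integral>t. (g' t)\<^sup>2 \<partial>?\<mu>))"
      by (simp only:)
    moreover have "0 \<le> c * (\<integral>t. (g' t)\<^sup>2 \<partial>?\<mu>)"
      using c by simp
    ultimately show "vari ?\<mu> g \<le> c * (\<integral>t. (g' t)\<^sup>2 \<partial>?\<mu>)"
      by (simp only: ennreal_le_iff)
  qed
qed

section \<open>Tensorization\<close>

lemma (in prob_space) vari_nonneg:
  assumes "integrable M f" "integrable M (\<lambda>x. (f x)\<^sup>2)"
  shows "0 \<le> vari M f"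
  using variance_eq[OF assms] variance_positive[of f] by (simp add: vari_def)

lemma (in prob_space) vari_const [simp]: "vari M (\<lambda>_. a) = 0"
  by (simp add: vari_def prob_space)

lemma (in prob_space) abs_integral_le:
  fixes f :: "'a \<Rightarrow> real"
  assumes "\<And>x. x \<in> space M \<Longrightarrow> \<bar>f x\<bar> \<le> b"
  shows "\<bar>\<integral>x. f x \<partial>M\<bar> \<le> b"
proof -
  have "\<bar>\<integral>x. f x \<partial>M\<bar> \<le> (\<integral>x. \<bar>f x\<bar> \<partial>M)" by (rule integral_abs_bound)
  also have "\<dots> \<le> (\<integral>x. b \<partial>M)"
    using assms by (intro integral_mono') (auto intro: order_trans[OF abs_ge_zero])
  finally show ?thesis by (simp add: prob_space)
qed

lemma (in prob_space) abs_vari_le: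
  fixes f :: "'a \<Rightarrow> real"
  assumes "\<And>x. x \<in> space M \<Longrightarrow> \<bar>f x\<bar> \<le> b"
  shows "\<bar>vari M f\<bar> \<le> b\<^sup>2 + b\<^sup>2"
proof -
  have sq: "\<bar>(f x)\<^sup>2\<bar> \<le> b\<^sup>2" if "x \<in> space M" for x
    using power_mono[OF assms[OF that], of 2] by simp
  have 1: "\<bar>\<integral>x. (f x)\<^sup>2 \<partial>M\<bar> \<le> b\<^sup>2" by (rule abs_integral_le[OF sq])
  have 2: "\<bar>(\<integral>x. f x \<partial>M)\<^sup>2\<bar> \<le> b\<^sup>2"
    using power_mono[OF abs_integral_le[of f b, OF assms], of 2] by simp
  from 1 2 show ?thesis unfolding vari_def by linarith
qed

lemma (in pair_sigma_finite)
  fixes f :: "_ \<Rightarrow> real"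
  assumes "integrable (M1 \<Otimes>\<^sub>M M2) f"
  shows integrable_snd': "integrable M2 (\<lambda>y. \<integral>x. f (x, y) \<partial>M1)"
    and integral_snd': "(\<integral>y. (\<integral>x. f (x, y) \<partial>M1) \<partial>M2) = integral\<^sup>L (M1 \<Otimes>\<^sub>M M2) f"
  using integrable_snd[of "\<lambda>x y. f (x, y)"] integral_snd[of "\<lambda>x y. f (x, y)"] assms by auto

text \<open>Subadditivity of variance (Efron-Stein). With partial means a(y), b(x) and mean m, the
  claim rearranges to: the variance of a is at most the integral of (F - b)^2. This follows from
  Jensen, since a(y) - m is the mean of F - b in the first variable.\<close>

lemma vari_pair_le:
  fixes F :: "'a \<times> 'b \<Rightarrow> real"
  assumes "prob_space M" "prob_space N"
    and [measurable]: "F \<in> borel_measurable (M \<Otimes>\<^sub>M N)"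
    and B: "\<And>z. z \<in> space (M \<Otimes>\<^sub>M N) \<Longrightarrow> \<bar>F z\<bar> \<le> B"
  shows "vari (M \<Otimes>\<^sub>M N) F \<le> (\<integral>y. vari M (\<lambda>x. F (x, y)) \<partial>N) + (\<integral>x. vari N (\<lambda>y. F (x, y)) \<partial>M)"
proof -
  interpret M: prob_space M by fact
  interpret N: prob_space N by fact
  interpret P: pair_prob_space M N ..
  define a where "a y = (\<integral>x. F (x, y) \<partial>M)" for y
  define b where "b x = (\<integral>y. F (x, y) \<partial>N)" for x
  define m where "m = (\<integral>z. F z \<partial>(M \<Otimes>\<^sub>M N))"
  have [measurable]: "a \<in> borel_measurable N" "b \<in> borel_measurable M"
    unfolding a_def b_def by measurable
  have B1: "\<bar>F (x, y)\<bar> \<le> B" if "x \<in> space M" "y \<in> space N" for x y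
    using B[of "(x, y)"] that by (simp add: space_pair_measure)
  have B0: "0 \<le> B"
  proof -
    obtain x y where "x \<in> space M" "y \<in> space N" using M.not_empty N.not_empty by blast
    from B1[OF this] show ?thesis by linarith
  qed
  have slice1: "integrable M (\<lambda>x. F (x, y))" "integrable M (\<lambda>x. (F (x, y))\<^sup>2)" if "y \<in> space N" for y
    using that B1 by (auto intro!: M.integrable_bounded M.integrable_bounded_square)
  have slice2: "integrable N (\<lambda>y. F (x, y))" "integrable N (\<lambda>y. (F (x, y))\<^sup>2)" if "x \<in> space M" for x
    using that B1 by (auto intro!: N.integrable_bounded N.integrable_bounded_square)
  have a_le: "\<bar>a y\<bar> \<le> B" if "y \<in> space N" for y
    unfolding a_def by (rule M.abs_integral_le) (rule B1; use that in auto)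
  have b_le: "\<bar>b x\<bar> \<le> B" if "x \<in> space M" for x
    unfolding b_def by (rule N.abs_integral_le) (rule B1; use that in auto)
  have ia: "integrable N a" "integrable N (\<lambda>y. (a y)\<^sup>2)"
    using a_le by (auto intro!: N.integrable_bounded N.integrable_bounded_square)
  have ib: "integrable M b" "integrable M (\<lambda>x. (b x)\<^sup>2)"
    using b_le by (auto intro!: M.integrable_bounded M.integrable_bounded_square)
  have iF: "integrable (M \<Otimes>\<^sub>M N) F" "integrable (M \<Otimes>\<^sub>M N) (\<lambda>z. (F z)\<^sup>2)"
    using B by (auto intro!: P.integrable_bounded P.integrable_bounded_square)
  have sq: "integrable N (\<lambda>y. \<integral>x. (F (x, y))\<^sup>2 \<partial>M)" "integrable M (\<lambda>x. \<integral>y. (F (x, y))\<^sup>2 \<partial>N)"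
    using P.integrable_snd'[of "\<lambda>z. (F z)\<^sup>2"] P.integrable_fst'[of "\<lambda>z. (F z)\<^sup>2"] iF by auto
  have EF: "(\<integral>y. a y \<partial>N) = m" "(\<integral>x. b x \<partial>M) = m"
    unfolding a_def b_def m_def
    using P.integral_snd'[OF iF(1)] P.integral_fst'[OF iF(1)] by auto
  have EF2: "(\<integral>y. \<integral>x. (F (x, y))\<^sup>2 \<partial>M \<partial>N) = (\<integral>z. (F z)\<^sup>2 \<partial>(M \<Otimes>\<^sub>M N))"
    "(\<integral>x. \<integral>y. (F (x, y))\<^sup>2 \<partial>N \<partial>M) = (\<integral>z. (F z)\<^sup>2 \<partial>(M \<Otimes>\<^sub>M N))"
    using P.integral_snd'[OF iF(2)] P.integral_fst'[OF iF(2)] by auto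
  have 1: "(\<integral>y. vari M (\<lambda>x. F (x, y)) \<partial>N) = (\<integral>z. (F z)\<^sup>2 \<partial>(M \<Otimes>\<^sub>M N)) - (\<integral>y. (a y)\<^sup>2 \<partial>N)"
    unfolding vari_def a_def[symmetric] using sq ia by (simp add: EF2)
  have 2: "(\<integral>x. vari N (\<lambda>y. F (x, y)) \<partial>M) = (\<integral>z. (F z)\<^sup>2 \<partial>(M \<Otimes>\<^sub>M N)) - (\<integral>x. (b x)\<^sup>2 \<partial>M)"
    unfolding vari_def b_def[symmetric] using sq ib by (simp add: EF2)
  have D: "\<bar>F z - b (fst z)\<bar> \<le> 2 * B" if "z \<in> space (M \<Otimes>\<^sub>M N)" for z
    using B[OF that] b_le[of "fst z"] that by (auto simp: space_pair_measure)
  have iD: "integrable (M \<Otimes>\<^sub>M N) (\<lambda>z. (F z - b (fst z))\<^sup>2)"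
    by (rule P.integrable_bounded_square[OF _ D]) auto
  have iD': "integrable N (\<lambda>y. \<integral>x. (F (x, y) - b x)\<^sup>2 \<partial>M)"
    using P.integrable_snd'[OF iD] by simp
  have jensen: "(a y - m)\<^sup>2 \<le> (\<integral>x. (F (x, y) - b x)\<^sup>2 \<partial>M)" if y: "y \<in> space N" for y
  proof -
    have "0 \<le> vari M (\<lambda>x. F (x, y) - b x)"
    proof (rule M.vari_nonneg)
      show "integrable M (\<lambda>x. F (x, y) - b x)" using slice1[OF y] ib by simp
      show "integrable M (\<lambda>x. (F (x, y) - b x)\<^sup>2)"
        using D y by (intro M.integrable_bounded_square[where B = "2 * B"]) (auto simp: space_pair_measure)
    qed
    moreover have "(\<integral>x. F (x, y) - b x \<partial>M) = a y - m"
      using slice1[OF y] ib by (simp add: EF a_def)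
    ultimately show ?thesis by (simp add: vari_def)
  qed
  have "(\<integral>y. (a y)\<^sup>2 \<partial>N) - m\<^sup>2 = (\<integral>y. (a y)\<^sup>2 - 2 * m * a y + m\<^sup>2 \<partial>N)"
    using ia by (simp add: EF N.prob_space power2_eq_square)
  also have "\<dots> = (\<integral>y. (a y - m)\<^sup>2 \<partial>N)"
    by (simp add: power2_diff algebra_simps)
  also have "\<dots> \<le> (\<integral>y. \<integral>x. (F (x, y) - b x)\<^sup>2 \<partial>M \<partial>N)"
  proof (rule integral_mono_AE[OF _ iD'])
    show "integrable N (\<lambda>y. (a y - m)\<^sup>2)"
      using ia by (simp add: power2_diff)
    show "AE y in N. (a y - m)\<^sup>2 \<le> (\<integral>x. (F (x, y) - b x)\<^sup>2 \<partial>M)"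
      using jensen by auto
  qed
  also have "\<dots> = (\<integral>x. \<integral>y. (F (x, y) - b x)\<^sup>2 \<partial>N \<partial>M)"
    using P.integral_snd'[OF iD] P.integral_fst'[OF iD] by simp
  also have "\<dots> = (\<integral>x. (\<integral>y. (F (x, y))\<^sup>2 \<partial>N) - (b x)\<^sup>2 \<partial>M)"
  proof (rule Bochner_Integration.integral_cong[OF refl])
    fix x assume x: "x \<in> space M"
    have "(\<integral>y. (F (x, y) - b x)\<^sup>2 \<partial>N) = (\<integral>y. (F (x, y))\<^sup>2 + (b x)\<^sup>2 - 2 * F (x, y) * b x \<partial>N)"
      by (simp add: power2_diff)
    also have "\<dots> = (\<integral>y. (F (x, y))\<^sup>2 \<partial>N) + (b x)\<^sup>2 - 2 * b x * b x"
      using slice2[OF x] by (simp add: N.prob_space b_def)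
    finally show "(\<integral>y. (F (x, y) - b x)\<^sup>2 \<partial>N) = (\<integral>y. (F (x, y))\<^sup>2 \<partial>N) - (b x)\<^sup>2"
      by (simp add: power2_eq_square)
  qed
  also have "\<dots> = (\<integral>z. (F z)\<^sup>2 \<partial>(M \<Otimes>\<^sub>M N)) - (\<integral>x. (b x)\<^sup>2 \<partial>M)"
    using sq ib by (simp add: EF2)
  finally show ?thesis
    unfolding 1 2 by (simp add: vari_def m_def)
qed

text \<open>Continuity is meant in the product topology, where it holds because
  \<open>rdist n\<close> involves finitely many coordinates. It serves to obtain Borel
  measurability.\<close>

lemma lipn_continuous:
  assumes F: "lipn n L F"
  shows "continuous_on UNIV F"
  unfolding continuous_on_def
proof
  fix x :: "nat \<Rightarrow> real"
  have *: "((\<lambda>y. max L 0 * rdist n y x) \<longlongrightarrow> max L 0 * sqrt (\<Sum>i<n. (x i - x i)\<^sup>2)) (at x within UNIV)"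
    unfolding rdist_def L2_set_def
    by (intro tendsto_intros continuous_on_product_coordinates[unfolded continuous_on_def, rule_format]) auto
  have "((\<lambda>y. F y - F x) \<longlongrightarrow> 0) (at x within UNIV)"
  proof (rule Lim_null_comparison)
    show "\<forall>\<^sub>F y in at x. norm (F y - F x) \<le> max L 0 * rdist n y x"
      using lipnD[OF lipn_nonneg[OF F]] by (simp add: always_eventually)
    show "((\<lambda>y. max L 0 * rdist n y x) \<longlongrightarrow> 0) (at x within UNIV)"
      using * by simp
  qed
  then show "(F \<longlongrightarrow> F x) (at x within UNIV)"
    by (simp add: LIM_zero_iff)
qed

lemma lipn_cong:
  assumes F: "lipn n L F" and "\<And>i. i < n \<Longrightarrow> x i = y i"
  shows "F x = F y"
proof -
  have "rdist n x y = 0"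
    using assms(2) by (simp add: rdist_def L2_set_def)
  then show ?thesis using lipnD[OF F, of x y] by simp
qed

text \<open>Points of the finite product are extensional functions, while the Borel sets of
  \<open>nat \<Rightarrow> real\<close> involve every coordinate. Filling up with 0 moves between
  the two, and \<open>lipn\<close> functions do not notice it.\<close>

lemma measurable_extend_zero:
  fixes n :: nat
  assumes "sets \<mu> = sets borel"
  shows "(\<lambda>x i. if i < n then x i else 0 :: real) \<in> measurable (Pi\<^sub>M {..<n} (\<lambda>_. \<mu>)) borel"
proof -
  have 1: "(\<lambda>x i. if i < n then x i else 0 :: real) \<in> measurable (Pi\<^sub>M {..<n} (\<lambda>_. borel)) (Pi\<^sub>M UNIV (\<lambda>_. borel))"
  proof (rule measurable_PiM_single')
    show "(\<lambda>x. if i < n then x i else 0) \<in> measurable (Pi\<^sub>M {..<n} (\<lambda>_. borel)) borel" for i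
      by (cases "i < n") auto
  qed (auto simp: space_PiM)
  have "measurable (Pi\<^sub>M {..<n} (\<lambda>_. \<mu>)) (borel :: (nat \<Rightarrow> real) measure)
      = measurable (Pi\<^sub>M {..<n} (\<lambda>_. borel)) (Pi\<^sub>M UNIV (\<lambda>_. borel))"
    using assms by (intro measurable_cong_sets sets_PiM_cong sets_PiM_equal_borel[symmetric]) auto
  with 1 show ?thesis by (simp only:)
qed

lemma lipn_measurable:
  assumes F: "lipn n L F" and s: "sets \<mu> = sets borel"
  shows "F \<in> borel_measurable (Pi\<^sub>M {..<n} (\<lambda>_. \<mu>))"
proof -
  have "(\<lambda>x. F (\<lambda>i. if i < n then x i else 0)) \<in> borel_measurable (Pi\<^sub>M {..<n} (\<lambda>_. \<mu>))"
    by (rule measurable_compose[OF measurable_extend_zero[OF s]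
          borel_measurable_continuous_onI[OF lipn_continuous[OF F]]])
  also have "(\<lambda>x. F (\<lambda>i. if i < n then x i else 0)) = F"
    by (intro ext lipn_cong[OF F]) simp
  finally show ?thesis .
qed

lemma rdist_Suc_upd: "rdist (Suc n) (x(n := t)) (y(n := t)) = rdist n x y"
  unfolding rdist_def L2_set_def by (intro arg_cong[where f = sqrt]) simp

lemma lipn_Suc_slice: "lipn (Suc n) L F \<Longrightarrow> lipn n L (\<lambda>x. F (x(n := t)))"
  unfolding lipn_def using rdist_Suc_upd by metis

lemma partial_quad_slice:
  assumes "partial_quad i K F G" "i \<noteq> n"
  shows "partial_quad i K (\<lambda>x. F (x(n := t))) (\<lambda>x. G (x(n := t)))"
  unfolding partial_quad_def
proof (intro allI)
  fix x h
  have "(x(i := x i + h))(n := t) = (x(n := t))(i := (x(n := t)) i + h)"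
    using assms(2) by (auto simp: fun_eq_iff)
  then show "\<bar>F ((x(i := x i + h))(n := t)) - F (x(n := t)) - h * G (x(n := t))\<bar> \<le> K * h\<^sup>2"
    using assms(1) unfolding partial_quad_def by metis
qed

lemma partial_quad_derivative:
  assumes "partial_quad i K F G"
  shows "((\<lambda>t. F (x(i := t))) has_real_derivative G (x(i := t))) (at t)"
  unfolding DERIV_def
proof (subst LIM_zero_iff[symmetric], rule Lim_null_comparison)
  let ?q = "\<lambda>h. (F (x(i := t + h)) - F (x(i := t))) / h - G (x(i := t))"
  have "\<bar>?q h\<bar> \<le> K * \<bar>h\<bar>" if "h \<noteq> 0" for h
  proof -
    have "\<bar>F (x(i := t + h)) - F (x(i := t)) - h * G (x(i := t))\<bar> \<le> K * h\<^sup>2"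
      using assms[unfolded partial_quad_def, rule_format, of "x(i := t)" h] by simp
    moreover have "?q h = (F (x(i := t + h)) - F (x(i := t)) - h * G (x(i := t))) / h"
      using that by (simp add: field_simps)
    ultimately have "\<bar>?q h\<bar> \<le> K * h\<^sup>2 / \<bar>h\<bar>"
      by (simp add: divide_right_mono)
    also have "\<dots> = K * \<bar>h\<bar>"
      using that by (simp add: power2_eq_square abs_mult[symmetric] field_simps)
    finally show ?thesis .
  qed
  then show "\<forall>\<^sub>F h in at 0. norm (?q h) \<le> K * \<bar>h\<bar>"
    by (auto simp: eventually_at_filter)
  show "((\<lambda>h::real. K * \<bar>h\<bar>) \<longlongrightarrow> 0) (at 0)"
    by (auto intro!: tendsto_eq_intros)
qed

text \<open>Induction on \<open>n\<close>: \<open>vari_pair_le\<close> separates the last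
  coordinate. Its slices fall under \<open>poincare_line\<close>, the slices with the last
  coordinate frozen fall under the induction hypothesis, and the constant is the same in
  both.\<close>

lemma poincare_product:
  assumes \<mu>: "prob_space \<mu>" and s: "sets \<mu> = sets borel" and P: "poincare_line c \<mu>"
  shows "lipn n L F \<Longrightarrow> (\<And>x. \<bar>F x\<bar> \<le> B) \<Longrightarrow> (\<And>i. i < n \<Longrightarrow> lipn n K (G i)) \<Longrightarrow>
    (\<And>i x. i < n \<Longrightarrow> \<bar>G i x\<bar> \<le> B') \<Longrightarrow> (\<And>i. i < n \<Longrightarrow> partial_quad i K F (G i)) \<Longrightarrow>
    vari (Pi\<^sub>M {..<n} (\<lambda>_. \<mu>)) F \<le> c * (\<Sum>i<n. \<integral>x. (G i x)\<^sup>2 \<partial>Pi\<^sub>M {..<n} (\<lambda>_. \<mu>))"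
proof (induction n arbitrary: F G)
  case 0
  interpret prob_space "Pi\<^sub>M {..<0::nat} (\<lambda>_. \<mu>)"
    by (rule prob_space_PiM) (rule \<mu>)
  have "F x = F (\<lambda>_. 0)" for x
    by (rule lipn_cong[OF 0(1)]) simp
  then have "F = (\<lambda>_. F (\<lambda>_. 0))" by blast
  then have "vari (Pi\<^sub>M {..<0::nat} (\<lambda>_. \<mu>)) F = 0" by (metis vari_const)
  then show ?case by simp
next
  case (Suc n)
  let ?N = "Pi\<^sub>M {..<n} (\<lambda>_. \<mu>)" and ?N' = "Pi\<^sub>M {..<Suc n} (\<lambda>_. \<mu>)"
  let ?T = "\<lambda>(t, X). X(n := t) :: nat \<Rightarrow> real"
  interpret M: prob_space \<mu> by fact
  interpret N: prob_space ?N by (rule prob_space_PiM) (rule \<mu>)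
  interpret N': prob_space ?N' by (rule prob_space_PiM) (rule \<mu>)
  interpret Q: pair_prob_space \<mu> ?N ..
  have distr: "distr (\<mu> \<Otimes>\<^sub>M ?N) ?N' ?T = ?N'"
    using distr_pair_PiM_eq_PiM[of "{..<n}" "\<lambda>_. \<mu>" n] \<mu> by (simp add: lessThan_Suc)
  have T[measurable]: "?T \<in> measurable (\<mu> \<Otimes>\<^sub>M ?N) ?N'"
    unfolding lessThan_Suc by measurable
  have FT: "(\<lambda>z. F (?T z)) \<in> borel_measurable (\<mu> \<Otimes>\<^sub>M ?N)"
    by (rule measurable_compose[OF T lipn_measurable[OF Suc.prems(1) s]])
  have GT: "(\<lambda>z. G i (?T z)) \<in> borel_measurable (\<mu> \<Otimes>\<^sub>M ?N)" if "i < Suc n" for i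
    by (rule measurable_compose[OF T lipn_measurable[OF Suc.prems(3)[OF that] s]])
  have iG: "integrable (\<mu> \<Otimes>\<^sub>M ?N) (\<lambda>z. (G i (?T z))\<^sup>2)" if "i < Suc n" for i
    by (rule Q.integrable_bounded_square[OF GT[OF that]]) (rule Suc.prems(4)[OF that])
  have intG: "(\<integral>x. (G i x)\<^sup>2 \<partial>?N') = (\<integral>z. (G i (?T z))\<^sup>2 \<partial>(\<mu> \<Otimes>\<^sub>M ?N))" if "i < Suc n" for i
  proof -
    have [measurable]: "G i \<in> borel_measurable ?N'"
      by (rule lipn_measurable[OF Suc.prems(3)[OF that] s])
    show ?thesis by (subst distr[symmetric], rule integral_distr[OF T]) measurable
  qed
  have "vari ?N' F = vari (\<mu> \<Otimes>\<^sub>M ?N) (\<lambda>z. F (?T z))"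
  proof -
    have [measurable]: "F \<in> borel_measurable ?N'"
      by (rule lipn_measurable[OF Suc.prems(1) s])
    show ?thesis unfolding vari_def
      by (subst (1 2) distr[symmetric], subst (1 2) integral_distr[OF T]) measurable
  qed
  also have "\<dots> \<le> (\<integral>X. vari \<mu> (\<lambda>t. F (?T (t, X))) \<partial>?N) + (\<integral>t. vari ?N (\<lambda>X. F (?T (t, X))) \<partial>\<mu>)"
    by (rule vari_pair_le[OF \<mu> N.prob_space_axioms FT]) (rule Suc.prems(2))
  also have "\<dots> \<le> c * (\<integral>z. (G n (?T z))\<^sup>2 \<partial>(\<mu> \<Otimes>\<^sub>M ?N)) + c * (\<Sum>i<n. \<integral>z. (G i (?T z))\<^sup>2 \<partial>(\<mu> \<Otimes>\<^sub>M ?N))"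
  proof (rule add_mono)
    have iF: "integrable (\<mu> \<Otimes>\<^sub>M ?N) (\<lambda>z. F (?T z))" "integrable (\<mu> \<Otimes>\<^sub>M ?N) (\<lambda>z. (F (?T z))\<^sup>2)"
      using Suc.prems(2) FT by (auto intro!: Q.integrable_bounded Q.integrable_bounded_square)
    have [measurable]: "(\<lambda>z. F (?T z)) \<in> borel_measurable (\<mu> \<Otimes>\<^sub>M ?N)" by (rule FT)
    show "(\<integral>X. vari \<mu> (\<lambda>t. F (?T (t, X))) \<partial>?N) \<le> c * (\<integral>z. (G n (?T z))\<^sup>2 \<partial>(\<mu> \<Otimes>\<^sub>M ?N))"
    proof -
      have iGn: "integrable ?N (\<lambda>X. \<integral>t. (G n (?T (t, X)))\<^sup>2 \<partial>\<mu>)"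
        using Q.integrable_snd'[OF iG[of n]] by simp
      have "(\<integral>X. vari \<mu> (\<lambda>t. F (?T (t, X))) \<partial>?N) \<le> (\<integral>X. c * (\<integral>t. (G n (?T (t, X)))\<^sup>2 \<partial>\<mu>) \<partial>?N)"
      proof (rule integral_mono)
        show "integrable ?N (\<lambda>X. vari \<mu> (\<lambda>t. F (?T (t, X))))"
        proof (rule N.integrable_bounded)
          show "(\<lambda>X. vari \<mu> (\<lambda>t. F (?T (t, X)))) \<in> borel_measurable ?N"
            unfolding vari_def by measurable
          show "\<bar>vari \<mu> (\<lambda>t. F (?T (t, X)))\<bar> \<le> B\<^sup>2 + B\<^sup>2" for X by (rule M.abs_vari_le) (rule Suc.prems(2))
        qed
        show "integrable ?N (\<lambda>X. c * (\<integral>t. (G n (?T (t, X)))\<^sup>2 \<partial>\<mu>))"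
          using iGn by simp
        fix X
        show "vari \<mu> (\<lambda>t. F (?T (t, X))) \<le> c * (\<integral>t. (G n (?T (t, X)))\<^sup>2 \<partial>\<mu>)"
        proof -
          have "\<forall>t. ((\<lambda>t. F (X(n := t))) has_real_derivative G n (X(n := t))) (at t)"
            by (intro allI partial_quad_derivative[OF Suc.prems(5)]) simp
          moreover have "continuous_on UNIV (\<lambda>t. G n (X(n := t)))"
            by (rule lipn_slice_continuous[OF Suc.prems(3)]) simp
          moreover have "bounded (range (\<lambda>t. F (X(n := t))))" "bounded (range (\<lambda>t. G n (X(n := t))))"
            using Suc.prems(2) Suc.prems(4)[of n] unfolding bounded_iff by auto
          ultimately show ?thesis
            using P unfolding poincare_line_def by simp
        qed
      qed
      also have "\<dots> = c * (\<integral>z. (G n (?T z))\<^sup>2 \<partial>(\<mu> \<Otimes>\<^sub>M ?N))"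
        using Q.integral_snd'[OF iG[of n]] by simp
      finally show ?thesis .
    qed
    show "(\<integral>t. vari ?N (\<lambda>X. F (?T (t, X))) \<partial>\<mu>) \<le> c * (\<Sum>i<n. \<integral>z. (G i (?T z))\<^sup>2 \<partial>(\<mu> \<Otimes>\<^sub>M ?N))"
    proof -
      have iGi: "integrable \<mu> (\<lambda>t. \<integral>X. (G i (?T (t, X)))\<^sup>2 \<partial>?N)" if "i < n" for i
        using Q.integrable_fst'[OF iG[of i]] that by simp
      have "(\<integral>t. vari ?N (\<lambda>X. F (?T (t, X))) \<partial>\<mu>) \<le> (\<integral>t. c * (\<Sum>i<n. \<integral>X. (G i (?T (t, X)))\<^sup>2 \<partial>?N) \<partial>\<mu>)"
      proof (rule integral_mono)
        show "integrable \<mu> (\<lambda>t. vari ?N (\<lambda>X. F (?T (t, X))))"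
        proof (rule M.integrable_bounded)
          show "(\<lambda>t. vari ?N (\<lambda>X. F (?T (t, X)))) \<in> borel_measurable \<mu>"
            unfolding vari_def by measurable
          show "\<bar>vari ?N (\<lambda>X. F (?T (t, X)))\<bar> \<le> B\<^sup>2 + B\<^sup>2" for t by (rule N.abs_vari_le) (rule Suc.prems(2))
        qed
        show "integrable \<mu> (\<lambda>t. c * (\<Sum>i<n. \<integral>X. (G i (?T (t, X)))\<^sup>2 \<partial>?N))"
          using iGi by auto
        fix t
        show "vari ?N (\<lambda>X. F (?T (t, X))) \<le> c * (\<Sum>i<n. \<integral>X. (G i (?T (t, X)))\<^sup>2 \<partial>?N)"
        proof -
          have "lipn n K (\<lambda>X. G i (X(n := t)))" if "i < n" for i
            by (rule lipn_Suc_slice[OF Suc.prems(3)]) (use that in simp)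
          moreover have "partial_quad i K (\<lambda>X. F (X(n := t))) (\<lambda>X. G i (X(n := t)))" if "i < n" for i
            by (rule partial_quad_slice[OF Suc.prems(5)]) (use that in simp_all)
          ultimately show ?thesis
            using Suc.IH[of "\<lambda>X. F (X(n := t))" "\<lambda>i X. G i (X(n := t))"] lipn_Suc_slice[OF Suc.prems(1)]
              Suc.prems(2) Suc.prems(4) by simp
        qed
      qed
      also have "\<dots> = c * (\<Sum>i<n. \<integral>t. \<integral>X. (G i (?T (t, X)))\<^sup>2 \<partial>?N \<partial>\<mu>)"
        using iGi by (simp add: integral_sum)
      also have "\<dots> = c * (\<Sum>i<n. \<integral>z. (G i (?T z))\<^sup>2 \<partial>(\<mu> \<Otimes>\<^sub>M ?N))"
        using Q.integral_fst'[OF iG] by (simp cong: sum.cong_simp)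
      finally show ?thesis .
    qed
  qed
  also have "\<dots> = c * (\<Sum>i<Suc n. \<integral>x. (G i x)\<^sup>2 \<partial>?N')"
    by (simp add: intG algebra_simps)
  finally show ?case .
qed

section \<open>The Gauss and uniform measures\<close>

text \<open>The Gaussian density p satisfies (-p)'(x) = x p(x) and vanishes at infinity. This is the
  tail condition of \<open>poincare_line_density\<close> for \<phi>(x) = x and c = 1.\<close>

lemma gauss_tail:
  "(\<integral>x. indicator {t..} x * x \<partial>density lborel (\<lambda>x. ennreal (std_normal_density x))) = std_normal_density t"
proof -
  let ?f = "\<lambda>x. std_normal_density x * x"
  have int: "integrable lborel ?f"
    using integrable_std_normal_moment[of 1] by simp
  have "(\<integral>x. indicator {t..} x * x \<partial>density lborel (\<lambda>x. ennreal (std_normal_density x)))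
    = (\<integral>x. std_normal_density x * (indicator {t..} x * x) \<partial>lborel)"
    by (subst integral_density) (auto simp: normal_density_nonneg)
  also have "\<dots> = (\<integral>x. indicator {t<..} x * ?f x \<partial>lborel)"
  proof (rule integral_cong_AE)
    show "AE x in lborel. std_normal_density x * (indicator {t..} x * x) = indicator {t<..} x * ?f x"
      using AE_lborel_singleton[of t] by eventually_elim (auto simp: indicator_def)
  qed auto
  also have "\<dots> = (LBINT x=ereal t..\<infinity>. ?f x)"
    by (simp add: interval_integral_to_infinity_eq set_lebesgue_integral_def)
  also have "\<dots> = 0 - (- std_normal_density t)"
  proof (rule interval_integral_FTC_integrable[where F = "\<lambda>x. - std_normal_density x"])
    have "((\<lambda>x. - (c * exp (- x\<^sup>2 / 2))) has_real_derivative c * exp (- x\<^sup>2 / 2) * x) (at x)" for c x :: real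
      by (auto intro!: derivative_eq_intros)
    then show "((\<lambda>x. - std_normal_density x) has_vector_derivative ?f x) (at x)" for x
      unfolding has_real_derivative_iff_has_vector_derivative[symmetric] std_normal_density_def .
    show "isCont ?f x" for x
      unfolding std_normal_density_def by (intro continuous_intros) auto
    show "set_integrable lborel (einterval (ereal t) \<infinity>) ?f"
      unfolding set_integrable_def by (intro integrable_mult_indicator int) simp
    have "isCont std_normal_density t"
      unfolding std_normal_density_def by (intro continuous_intros) auto
    then show "(((\<lambda>x. - std_normal_density x) \<circ> real_of_ereal) \<longlongrightarrow> - std_normal_density t) (at_right (ereal t))"
      unfolding ereal_tendsto_simps
      by (intro tendsto_intros) (simp add: continuous_at_imp_continuous_at_within isCont_def filterlim_at_split)
    have "filterlim (\<lambda>x::real. - (x\<^sup>2 * (1 / 2))) at_bot at_top"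
      unfolding filterlim_uminus_at_top[symmetric]
      by (intro filterlim_at_top_mult_tendsto_pos[OF tendsto_const] filterlim_pow_at_top filterlim_ident) auto
    then have "((\<lambda>x::real. exp (- (x\<^sup>2 * (1 / 2)))) \<longlongrightarrow> 0) at_top"
      by (rule filterlim_compose[OF exp_at_bot])
    then have "((\<lambda>x::real. - (1 / sqrt (2 * pi) * exp (- x\<^sup>2 / 2))) \<longlongrightarrow> - (1 / sqrt (2 * pi) * 0)) at_top"
      by (intro tendsto_intros) simp
    then show "(((\<lambda>x. - std_normal_density x) \<circ> real_of_ereal) \<longlongrightarrow> 0) (at_left \<infinity>)"
      unfolding ereal_tendsto_simps std_normal_density_def by simp
  qed simp
  finally show ?thesis by simp
qed

lemma poincare_line_gauss:
  "poincare_line 1 (density lborel (\<lambda>x. ennreal (std_normal_density x)))"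
proof (rule poincare_line_density[where \<phi> = "\<lambda>x. x" and \<phi>' = "\<lambda>_. 1" and J = UNIV])
  show "integrable (density lborel (\<lambda>x. ennreal (std_normal_density x))) (\<lambda>x. x)"
    using integrable_std_normal_moment[of 1] by (subst integrable_density) (auto simp: normal_density_nonneg)
  show "(\<integral>x. x \<partial>density lborel (\<lambda>x. ennreal (std_normal_density x))) = 0"
    using integral_std_normal_moment_odd[of 0] by (subst integral_density) (auto simp: normal_density_nonneg)
qed (auto simp: gauss_tail normal_density_nonneg prob_space_normal_density)

text \<open>The measure of \<open>unit_interval\<close> spread over the whole line, so that its sets
  are all Borel sets and the results on R^n apply.\<close>

definition unif01 :: "real measure" where
  "unif01 = density lborel (\<lambda>x. ennreal (indicator {0..1} x))"

lemma prob_space_unif01: "prob_space unif01"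
  unfolding unif01_def by (rule prob_spaceI) (simp add: emeasure_density ennreal_indicator)

lemma sets_unif01 [simp, measurable_cong]: "sets unif01 = sets borel"
  and space_unif01 [simp]: "space unif01 = UNIV"
  by (simp_all add: unif01_def)

lemma integral_unif01:
  fixes f :: "real \<Rightarrow> real"
  assumes "f \<in> borel_measurable borel"
  shows "(\<integral>x. f x \<partial>unif01) = (\<integral>x. f x * indicator {0..1} x \<partial>lborel)"
  using assms unfolding unif01_def by (subst integral_density) (auto simp: mult.commute)

text \<open>The antiderivative -sin(pi x) / pi vanishes at 1. The value is \<phi>'(t) / pi^2 for
  \<phi>(x) = -cos(pi x), which is the origin of the constant 1 / pi^2.\<close>

lemma unif01_tail:
  assumes "0 \<le> t" "t \<le> 1"
  shows "(\<integral>x. indicator {t..} x * - cos (pi * x) \<partial>unif01) = sin (pi * t) / pi"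
proof -
  have "(\<integral>x. indicator {t..} x * - cos (pi * x) \<partial>unif01) = (\<integral>x. - cos (pi * x) * indicator {t..1} x \<partial>lborel)"
    using assms by (subst integral_unif01) (auto simp: indicator_def intro!: Bochner_Integration.integral_cong)
  also have "\<dots> = - sin (pi * 1) / pi - (- sin (pi * t) / pi)"
    by (rule integral_FTC_Icc_real) (auto intro!: derivative_eq_intros simp: assms)
  finally show ?thesis by simp
qed

lemma poincare_line_unif01: "poincare_line (1 / pi\<^sup>2) unif01"
  unfolding unif01_def
\<comment> \<open>\<open>J\<close> omits the endpoints because \<phi>' vanishes there.\<close>
proof (rule poincare_line_density[where \<phi> = "\<lambda>x. - cos (pi * x)" and \<phi>' = "\<lambda>x. pi * sin (pi * x)" and J = "{0<..<1}"])
  let ?\<mu> = "density lborel (\<lambda>x::real. ennreal (indicator {0..1} x))"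
  interpret prob_space ?\<mu> using prob_space_unif01 by (simp add: unif01_def)
  show "prob_space ?\<mu>" by unfold_locales
  show "((\<lambda>x. - cos (pi * x)) has_real_derivative pi * sin (pi * t)) (at t)" for t
    by (auto intro!: derivative_eq_intros)
  show "continuous_on UNIV (\<lambda>x. pi * sin (pi * x))"
    by (intro continuous_intros)
  show "AE x in ?\<mu>. x \<in> {0<..<1}"
  proof (subst AE_density)
    show "AE x in lborel. 0 < ennreal (indicator {0..1} x) \<longrightarrow> x \<in> {0<..<1::real}"
      using AE_lborel_singleton[of 0] AE_lborel_singleton[of 1]
      by eventually_elim (auto simp: indicator_def)
  qed auto
  show "0 < pi * sin (pi * t)" if "t \<in> {0<..<1}" for t
    using that by (auto intro!: mult_pos_pos sin_gt_zero)
  show "integrable ?\<mu> (\<lambda>x. - cos (pi * x))"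
    by (rule integrable_bounded[where B = 1]) auto
  have "(\<integral>x. indicator {0..} x * - cos (pi * x) \<partial>unif01) = (\<integral>x. - cos (pi * x) \<partial>unif01)"
    by (subst (1 2) integral_unif01) (auto simp: indicator_def intro!: Bochner_Integration.integral_cong)
  then show "(\<integral>x. - cos (pi * x) \<partial>?\<mu>) = 0"
    using unif01_tail[of 0] by (simp add: unif01_def)
  show "(\<integral>x. indicator {t..} x * - cos (pi * x) \<partial>?\<mu>) = 1 / pi\<^sup>2 * indicator {0..1} t * (pi * sin (pi * t))"
    if "t \<in> {0<..<1}" for t
    using unif01_tail[of t] that by (simp add: unif01_def power2_eq_square)
qed auto

section \<open>The nonlocal Poincare inequality\<close>

text \<open>Closeness is measured in L^1, since in the application nothing better than boundedness
  holds on an exceptional set of small measure. The second moment and the squared mean each change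
  by at most 2 B d.\<close>

lemma (in prob_space) vari_le_of_close:
  fixes f g :: "'a \<Rightarrow> real"
  assumes [measurable]: "f \<in> borel_measurable M" "g \<in> borel_measurable M"
    and f: "\<And>x. x \<in> space M \<Longrightarrow> \<bar>f x\<bar> \<le> B" and g: "\<And>x. x \<in> space M \<Longrightarrow> \<bar>g x\<bar> \<le> B"
    and d: "(\<integral>x. \<bar>f x - g x\<bar> \<partial>M) \<le> d"
  shows "vari M f \<le> vari M g + 4 * B * d"
proof -
  have B: "0 \<le> B" using f not_empty by fastforce
  have i: "integrable M f" "integrable M g" "integrable M (\<lambda>x. (f x)\<^sup>2)" "integrable M (\<lambda>x. (g x)\<^sup>2)"
    using f g by (auto intro!: integrable_bounded integrable_bounded_square)
  have "(\<integral>x. (f x)\<^sup>2 \<partial>M) - (\<integral>x. (g x)\<^sup>2 \<partial>M) = (\<integral>x. (f x)\<^sup>2 - (g x)\<^sup>2 \<partial>M)"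
    using i by simp
  also have "\<dots> \<le> (\<integral>x. 2 * B * \<bar>f x - g x\<bar> \<partial>M)"
  proof (rule integral_mono)
    fix x assume x: "x \<in> space M"
    have "(f x)\<^sup>2 - (g x)\<^sup>2 = (f x + g x) * (f x - g x)"
      by (simp add: power2_eq_square algebra_simps)
    also have "\<dots> \<le> \<bar>f x + g x\<bar> * \<bar>f x - g x\<bar>"
      by (metis abs_ge_self abs_mult)
    also have "\<dots> \<le> 2 * B * \<bar>f x - g x\<bar>"
      using f[OF x] g[OF x] by (intro mult_right_mono) auto
    finally show "(f x)\<^sup>2 - (g x)\<^sup>2 \<le> 2 * B * \<bar>f x - g x\<bar>" .
  qed (use i in auto)
  also have "\<dots> = 2 * B * (\<integral>x. \<bar>f x - g x\<bar> \<partial>M)" by simp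
  also have "\<dots> \<le> 2 * B * d"
    using d B by (intro mult_left_mono) auto
  finally have 1: "(\<integral>x. (f x)\<^sup>2 \<partial>M) - (\<integral>x. (g x)\<^sup>2 \<partial>M) \<le> 2 * B * d" .
  let ?a = "\<integral>x. f x \<partial>M" and ?b = "\<integral>x. g x \<partial>M"
  have ab: "\<bar>?a\<bar> \<le> B" "\<bar>?b\<bar> \<le> B"
    using f g by (auto intro!: abs_integral_le)
  have "\<bar>?b - ?a\<bar> = \<bar>\<integral>x. f x - g x \<partial>M\<bar>"
    using i by (simp add: abs_minus_commute)
  also have "\<dots> \<le> (\<integral>x. \<bar>f x - g x\<bar> \<partial>M)" by (rule integral_abs_bound)
  also have "\<dots> \<le> d" by (rule d)
  finally have dd: "\<bar>?b - ?a\<bar> \<le> d" .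
  have "?b\<^sup>2 - ?a\<^sup>2 = (?b + ?a) * (?b - ?a)"
    by (simp add: power2_eq_square algebra_simps)
  also have "\<dots> \<le> \<bar>?b + ?a\<bar> * \<bar>?b - ?a\<bar>"
    by (metis abs_ge_self abs_mult)
  also have "\<dots> \<le> 2 * B * d"
    using ab dd B by (intro mult_mono) auto
  finally show ?thesis using 1 by (simp add: vari_def)
qed

text \<open>Smooth \<open>F\<close> at a scale so small that balls of positive radius remain. There
  the local constant \<open>R x\<close> of \<open>F\<close> is inherited by the smoothed function
  and dominates its gradient, so \<open>poincare_product\<close> applies up to a uniform
  error.\<close>

lemma nonlocal_poincare_product:
  assumes \<mu>: "prob_space \<mu>" and s: "sets \<mu> = sets borel" and P: "poincare_line c \<mu>" and c: "0 \<le> c"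
    and F: "lipn n L F" and B: "\<And>x. \<bar>F x\<bar> \<le> B" and r: "0 < r"
    and R[measurable]: "R \<in> borel_measurable (Pi\<^sub>M {..<n} (\<lambda>_. \<mu>))"
    and R0: "\<And>x. 0 \<le> R x" and RB: "\<And>x. R x \<le> B'"
    and loc: "\<And>x. loclip n r (R x) x F"
  shows "vari (Pi\<^sub>M {..<n} (\<lambda>_. \<mu>)) F \<le> c * (\<integral>x. (R x)\<^sup>2 \<partial>Pi\<^sub>M {..<n} (\<lambda>_. \<mu>))"
proof -
  let ?N = "Pi\<^sub>M {..<n} (\<lambda>_. \<mu>)"
  interpret N: prob_space ?N by (rule prob_space_PiM) (rule \<mu>)
  define L' where "L' = max L 0"
  have F': "lipn n L' F" and L': "0 \<le> L'"
    using lipn_nonneg[OF F] by (auto simp: L'_def)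
  have B0: "0 \<le> B" using B[of undefined] by linarith
  have "vari ?N F \<le> c * (\<integral>x. (R x)\<^sup>2 \<partial>?N) + 4 * B * \<delta>" if \<delta>: "0 < \<delta>" for \<delta>
  proof -
    \<comment> \<open>The first entry keeps r - n \<epsilon> positive, the second bounds the uniform
      error n L' \<epsilon> by \<delta>; the added 1s exclude division by 0.\<close>
    define \<epsilon> where "\<epsilon> = min (r / (2 * (n + 1))) (\<delta> / ((n + 1) * (L' + 1)))"
    have e: "0 < \<epsilon>" using r \<delta> L' by (auto simp: \<epsilon>_def)
    have "n * \<epsilon> \<le> n * (r / (2 * (n + 1)))"
      by (intro mult_left_mono) (auto simp: \<epsilon>_def)
    also have "\<dots> < r" using r by (simp add: field_simps add_nonneg_pos)
    finally have e1: "0 < r - n * \<epsilon>" by simp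
    have "n * L' * \<epsilon> \<le> (n + 1) * (L' + 1) * \<epsilon>"
      using e L' by (intro mult_right_mono mult_mono) auto
    also have "\<dots> \<le> (n + 1) * (L' + 1) * (\<delta> / ((n + 1) * (L' + 1)))"
      using L' by (intro mult_left_mono) (auto simp: \<epsilon>_def)
    also have "\<dots> = \<delta>"
    proof -
      have "real (n + 1) * (L' + 1) \<noteq> 0" using L' by auto
      then show ?thesis by (rule trans[OF times_divide_eq_right nonzero_mult_div_cancel_left])
    qed
    finally have e2: "n * L' * \<epsilon> \<le> \<delta>" .
    obtain H G K where H: "lipn n L' H" and HB: "\<And>x. \<bar>H x\<bar> \<le> B"
      and cl: "\<And>x. \<bar>H x - F x\<bar> \<le> n * L' * \<epsilon>"
      and lH: "\<And>r \<rho> x. loclip n r \<rho> x F \<Longrightarrow> loclip n (r - n * \<epsilon>) \<rho> x H"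
      and G: "\<And>i. i < n \<Longrightarrow> lipn n K (G i)" and pd: "\<And>i. i < n \<Longrightarrow> partial_quad i K H (G i)"
      using smoothing[OF F' L' e B, of n] by metis
    have [measurable]: "H \<in> borel_measurable ?N" "F \<in> borel_measurable ?N"
      using lipn_measurable[OF H s] lipn_measurable[OF F s] by auto
    have Gm[measurable]: "G i \<in> borel_measurable ?N" if "i < n" for i
      by (rule lipn_measurable[OF G[OF that] s])
    have GR: "(\<Sum>i<n. (G i x)\<^sup>2) \<le> (R x)\<^sup>2" for x
      by (rule gradient_le_loclip[OF G pd lH[OF loc] e1 R0])
    \<comment> \<open>The bound \<open>L'\<close> on the derivatives comes from the global Lipschitz
      constant and only secures integrability; the sharp bound is \<open>GR\<close>.\<close>
    have GL: "\<bar>G i x\<bar> \<le> L'" if "i < n" for i x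
    proof -
      have "loclip n 1 L' x H"
        using lipnD[OF H] by (auto simp: loclip_def)
      from gradient_le_loclip[OF G pd this _ L'] have "(\<Sum>i<n. (G i x)\<^sup>2) \<le> L'\<^sup>2"
        by simp
      moreover have "(G i x)\<^sup>2 \<le> (\<Sum>i<n. (G i x)\<^sup>2)"
        using that by (intro member_le_sum) auto
      ultimately show ?thesis
        using L' by (intro power2_le_imp_le[of "\<bar>G i x\<bar>"]) auto
    qed
    have iG: "integrable ?N (\<lambda>x. (G i x)\<^sup>2)" if "i < n" for i
      by (rule N.integrable_bounded_square[OF Gm[OF that] GL[OF that]])
    have iR: "integrable ?N (\<lambda>x. (R x)\<^sup>2)"
      by (rule N.integrable_bounded_square[OF R]) (use R0 RB in auto)
    have "vari ?N F \<le> vari ?N H + 4 * B * \<delta>"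
    proof (rule N.vari_le_of_close)
      have "(\<integral>x. \<bar>F x - H x\<bar> \<partial>?N) \<le> (\<integral>x. \<delta> \<partial>?N)"
      proof (rule integral_mono')
        show "\<bar>F x - H x\<bar> \<le> \<delta>" for x using cl[of x] e2 by linarith
      qed (use \<delta> in auto)
      then show "(\<integral>x. \<bar>F x - H x\<bar> \<partial>?N) \<le> \<delta>" by (simp add: N.prob_space)
    qed (use B HB in auto)
    also have "vari ?N H \<le> c * (\<Sum>i<n. \<integral>x. (G i x)\<^sup>2 \<partial>?N)"
      by (rule poincare_product[OF \<mu> s P H HB G GL pd])
    also have "(\<Sum>i<n. \<integral>x. (G i x)\<^sup>2 \<partial>?N) = (\<integral>x. (\<Sum>i<n. (G i x)\<^sup>2) \<partial>?N)"
      using iG by (subst Bochner_Integration.integral_sum) auto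
    also have "c * \<dots> \<le> c * (\<integral>x. (R x)\<^sup>2 \<partial>?N)"
      using iG iR GR c by (intro mult_left_mono integral_mono) auto
    finally show ?thesis by simp
  qed
  note * = this
  show ?thesis
  proof (rule field_le_epsilon)
    fix e :: real assume e: "0 < e"
    have "vari ?N F \<le> c * (\<integral>x. (R x)\<^sup>2 \<partial>?N) + 4 * B * (e / (4 * B + 1))"
      by (rule *) (use e B0 in auto)
    also have "4 * B * (e / (4 * B + 1)) \<le> e"
      using e B0 by (simp add: field_simps)
    finally show "vari ?N F \<le> c * (\<integral>x. (R x)\<^sup>2 \<partial>?N) + e" by simp
  qed
qed

section \<open>Measurability on abstract pm-spaces, and transfer along Lipschitz images\<close>

lemma pm_space_props:
  assumes "pm_space X"
  shows "space (meas X) = mspace (met X)" "prob_space (meas X)"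
    "sets (meas X) = sigma_sets (mspace (met X)) {U. openin (mtopology_of (met X)) U}"
  using assms by (auto simp: pm_space_def)

lemma openin_mtopology_of_iff:
  "openin (mtopology_of m) U \<longleftrightarrow>
     U \<subseteq> mspace m \<and> (\<forall>x\<in>U. \<exists>r>0. \<forall>y\<in>mspace m. mdist m x y < r \<longrightarrow> y \<in> U)"
proof -
  interpret Metric_space "mspace m" "mdist m" by (rule Metric_space_mspace_mdist)
  have *: "mball x r \<subseteq> U \<longleftrightarrow> (\<forall>y\<in>mspace m. mdist m x y < r \<longrightarrow> y \<in> U)"
    if "x \<in> mspace m" for x r
    using that by (auto simp: subset_iff)
  show ?thesis
  proof (cases "U \<subseteq> mspace m")
    case True
    then have "(\<forall>x\<in>U. \<exists>r>0. mball x r \<subseteq> U)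
        \<longleftrightarrow> (\<forall>x\<in>U. \<exists>r>0. \<forall>y\<in>mspace m. mdist m x y < r \<longrightarrow> y \<in> U)"
      by (intro ball_cong refl) (simp add: * subsetD)
    then show ?thesis
      unfolding mtopology_of_def openin_mtopology by (simp add: Ball_def)
  qed (simp add: mtopology_of_def openin_mtopology)
qed

lemma pm_open_sets:
  assumes "pm_space X" "openin (mtopology_of (met X)) U"
  shows "U \<in> sets (meas X)"
  unfolding pm_space_props[OF assms(1)] using assms(2) by (auto intro: sigma_sets.Basic)

lemma pm_lipschitz_measurable:
  assumes X: "pm_space X"
    and f: "\<And>x y. x \<in> mspace (met X) \<Longrightarrow> y \<in> mspace (met X) \<Longrightarrow> \<bar>f x - f y\<bar> \<le> L * mdist (met X) x y"
    and L: "0 \<le> L"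
  shows "f \<in> borel_measurable (meas X)"
proof (rule borel_measurableI)
  fix S :: "real set" assume S: "open S"
  have "openin (mtopology_of (met X)) (f -` S \<inter> mspace (met X))"
    unfolding openin_mtopology_of_iff
  proof (intro conjI ballI)
    fix x assume x: "x \<in> f -` S \<inter> mspace (met X)"
    then obtain e where e: "0 < e" "\<And>z. dist z (f x) < e \<Longrightarrow> z \<in> S"
      using S unfolding open_dist by blast
    show "\<exists>r>0. \<forall>y\<in>mspace (met X). mdist (met X) x y < r \<longrightarrow> y \<in> f -` S \<inter> mspace (met X)"
    proof (intro exI[of _ "e / (L + 1)"] conjI ballI impI IntI vimageI2 e(2))
      fix y assume y: "y \<in> mspace (met X)" "mdist (met X) x y < e / (L + 1)"
      have "dist (f y) (f x) \<le> L * mdist (met X) x y"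
        using f[of x y] x y by (simp add: dist_real_def abs_minus_commute)
      also have "\<dots> \<le> (L + 1) * mdist (met X) x y"
        by (intro mult_right_mono) auto
      also have "\<dots> < e"
        using y L by (simp add: pos_less_divide_eq mult.commute)
      finally show "dist (f y) (f x) < e" .
    qed (use e L in auto)
  qed auto
  then show "f -` S \<inter> space (meas X) \<in> sets (meas X)"
    using pm_open_sets[OF X] pm_space_props[OF X] by simp
qed

lemma measurable_into_pm_space:
  assumes Z: "pm_space Z" and f: "f \<in> space M \<rightarrow> mspace (met Z)"
    and op: "\<And>U. openin (mtopology_of (met Z)) U \<Longrightarrow> f -` U \<inter> space M \<in> sets M"
  shows "f \<in> measurable M (meas Z)"
proof (rule measurable_sigma_sets[OF pm_space_props(3)[OF Z] _ f])
  show "{U. openin (mtopology_of (met Z)) U} \<subseteq> Pow (mspace (met Z))"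
    by (auto simp: openin_mtopology_of_iff)
  show "f -` U \<inter> space M \<in> sets M" if "U \<in> {U. openin (mtopology_of (met Z)) U}" for U
    using op[of U] that by simp
qed

text \<open>
  Unlike the Poincare inequality with \<^const>\<open>lip_a\<close>, this version, in which the local Lipschitz
  constant is taken on balls of a fixed positive radius, is stable under small perturbations of the space.
\<close>
definition nonlocal_poincare :: "real \<Rightarrow> 'a pm \<Rightarrow> bool" where
  "nonlocal_poincare c Z \<longleftrightarrow>
     (\<forall>g R L B r. 0 < r \<longrightarrow> 0 \<le> L \<longrightarrow>
        (\<forall>x\<in>mspace (met Z). \<forall>y\<in>mspace (met Z). \<bar>g x - g y\<bar> \<le> L * mdist (met Z) x y) \<longrightarrow>
        (\<forall>x\<in>mspace (met Z). \<bar>g x\<bar> \<le> B) \<longrightarrow>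
        R \<in> borel_measurable (meas Z) \<longrightarrow>
        (\<forall>x\<in>mspace (met Z). 0 \<le> R x \<and> R x \<le> L) \<longrightarrow>
        (\<forall>x\<in>mspace (met Z). \<forall>y\<in>mspace (met Z). \<forall>y'\<in>mspace (met Z).
           mdist (met Z) y x < r \<longrightarrow> mdist (met Z) y' x < r \<longrightarrow> \<bar>g y - g y'\<bar> \<le> R x * mdist (met Z) y y') \<longrightarrow>
        vari (meas Z) g \<le> c * (\<integral>x. (R x)\<^sup>2 \<partial>meas Z))"

text \<open>Applying \<pi> in each coordinate and then the map \<phi> gives a map \<Phi> from R^n to
  \<open>Z\<close> that is 1-Lipschitz and sends the product of \<mu> to the measure of
  \<open>Z\<close>. Local Lipschitz bounds on balls of radius r pull back along \<Phi> with the same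
  radius and constant, so \<open>nonlocal_poincare_product\<close> transfers.\<close>

lemma nonlocal_poincare_lip_le:
  fixes X :: "real pm" and Z :: "'z pm" and \<pi> :: "real \<Rightarrow> real"
  assumes \<mu>: "prob_space \<mu>" and s: "sets \<mu> = sets borel" and P: "poincare_line c \<mu>" and c: "0 \<le> c"
    and X: "pm_space X" and \<pi>: "\<pi> \<in> measurable \<mu> (meas X)" and distr: "distr \<mu> (meas X) \<pi> = meas X"
    and lip: "\<And>s t. mdist (met X) (\<pi> s) (\<pi> t) \<le> \<bar>s - t\<bar>"
    and id: "(\<lambda>x. x) \<in> measurable (meas X) borel" and retr: "\<And>x. x \<in> mspace (met X) \<Longrightarrow> \<pi> x = x"
    and Z: "pm_space Z" and le: "Z \<prec>\<^sub>L l2_power n X"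
  shows "nonlocal_poincare c Z"
proof -
  let ?N = "Pi\<^sub>M {..<n} (\<lambda>_. \<mu>)" and ?NX = "Pi\<^sub>M {..<n} (\<lambda>_. meas X)"
  interpret \<mu>: prob_space \<mu> by fact
  interpret mX: prob_space "meas X" by (rule pm_space_props[OF X])
  have \<pi>mem: "\<pi> t \<in> mspace (met X)" for t
    using measurable_space[OF \<pi>, of t] sets_eq_imp_space_eq[OF s] pm_space_props[OF X] by simp
  obtain \<phi> where \<phi>: "\<phi> \<in> ({..<n} \<rightarrow>\<^sub>E mspace (met X)) \<rightarrow> mspace (met Z)"
    and \<phi>lip: "\<And>x y. x \<in> {..<n} \<rightarrow>\<^sub>E mspace (met X) \<Longrightarrow> y \<in> {..<n} \<rightarrow>\<^sub>E mspace (met X) \<Longrightarrow>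
       mdist (met Z) (\<phi> x) (\<phi> y) \<le> l2_dist n (met X) x y"
    and \<phi>distr: "distr ?NX (meas Z) \<phi> = meas Z"
    using le unfolding lip_le_def l2_power_def by (simp (no_asm_use)) blast
  define \<Phi> where "\<Phi> x = \<phi> (compose {..<n} \<pi> x)" for x
  have cmem: "compose {..<n} \<pi> x \<in> {..<n} \<rightarrow>\<^sub>E mspace (met X)" for x
    using \<pi>mem by (auto simp: compose_def)
  have \<Phi>mem: "\<Phi> x \<in> mspace (met Z)" for x
    using \<phi> cmem unfolding \<Phi>_def by blast
  have \<Phi>lip: "mdist (met Z) (\<Phi> x) (\<Phi> y) \<le> rdist n x y" for x y
  proof -
    have "mdist (met Z) (\<Phi> x) (\<Phi> y) \<le> l2_dist n (met X) (compose {..<n} \<pi> x) (compose {..<n} \<pi> y)"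
      unfolding \<Phi>_def by (rule \<phi>lip[OF cmem cmem])
    also have "\<dots> \<le> L2_set (\<lambda>i. \<bar>x i - y i\<bar>) {..<n}"
      unfolding l2_dist_def by (rule L2_set_mono) (auto simp: compose_def lip)
    also have "\<dots> = rdist n x y"
      by (simp add: rdist_def L2_set_def)
    finally show ?thesis .
  qed
  have \<Phi>cong: "\<Phi> (\<lambda>i. if i < n then x i else 0) = \<Phi> x" for x
    unfolding \<Phi>_def by (intro arg_cong[where f = \<phi>]) (auto simp: compose_def)
  have \<Phi>borel: "\<Phi> \<in> measurable borel (meas Z)"
  proof (rule measurable_into_pm_space[OF Z])
    fix U assume U: "openin (mtopology_of (met Z)) U"
    have "open (\<Phi> -` U)"
    proof (subst open_subopen, rule ballI)
      fix x assume "x \<in> \<Phi> -` U"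
      then obtain e where e: "0 < e" "\<And>y. y \<in> mspace (met Z) \<Longrightarrow> mdist (met Z) (\<Phi> x) y < e \<Longrightarrow> y \<in> U"
        using U unfolding openin_mtopology_of_iff by blast
      have "lipn n 1 (\<lambda>y. rdist n x y)"
        unfolding lipn_def using rdist_triangle[of n x] by (smt (verit) rdist_commute)
      from open_Collect_less[OF lipn_continuous[OF this] continuous_on_const[of UNIV e]]
      have "open {y. rdist n x y < e}" .
      moreover have "{y. rdist n x y < e} \<subseteq> \<Phi> -` U"
        using e(2)[OF \<Phi>mem le_less_trans[OF \<Phi>lip]] by auto
      ultimately show "\<exists>T. open T \<and> x \<in> T \<and> T \<subseteq> \<Phi> -` U"
        using e(1) by (intro exI[of _ "{y. rdist n x y < e}"]) auto
    qed
    then show "\<Phi> -` U \<inter> space borel \<in> sets borel" by simp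
  qed (use \<Phi>mem in auto)
  have \<Phi>N: "\<Phi> \<in> measurable (Pi\<^sub>M {..<n} (\<lambda>_. M)) (meas Z)" if "sets M = sets borel" for M
    using measurable_compose[OF measurable_extend_zero[OF that, of n] \<Phi>borel] by (simp add: \<Phi>cong)
  \<comment> \<open>\<open>lip_le\<close> does not state that \<phi> is measurable, but computing
    the push-forward through a composition requires it. Since \<pi> fixes the carrier, \<phi> agrees
    there with the Borel map \<Phi>; this is where the measurability of the inclusion into the reals
    enters.\<close>
  have \<phi>meas: "\<phi> \<in> measurable ?NX (meas Z)"
  proof -
    have "(\<lambda>x. \<lambda>i\<in>{..<n}. x i) \<in> measurable ?NX (Pi\<^sub>M {..<n} (\<lambda>_. borel :: real measure))"
    proof (rule measurable_restrict)
      show "(\<lambda>x. x i) \<in> borel_measurable ?NX" if "i \<in> {..<n}" for i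
        using measurable_compose[of "\<lambda>x. x i" ?NX "meas X" "\<lambda>x. x" borel] id
          measurable_component_singleton[OF that, of "\<lambda>_. meas X"] by simp
    qed
    from measurable_compose[OF this \<Phi>N[OF refl]]
    have "(\<lambda>x. \<Phi> (\<lambda>i\<in>{..<n}. x i)) \<in> measurable ?NX (meas Z)" .
    moreover have "\<Phi> (\<lambda>i\<in>{..<n}. x i) = \<phi> x" if x: "x \<in> space ?NX" for x
      unfolding \<Phi>_def
    proof (rule arg_cong[where f = \<phi>])
      have x': "x \<in> {..<n} \<rightarrow>\<^sub>E mspace (met X)"
        using x pm_space_props[OF X] by (simp add: space_PiM)
      show "compose {..<n} \<pi> (\<lambda>i\<in>{..<n}. x i) = x"
        by (rule PiE_ext[OF cmem x']) (use x' in \<open>auto simp: compose_def intro!: retr dest: PiE_mem\<close>)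
    qed
    ultimately show ?thesis by (simp cong: measurable_cong)
  qed
  have cm: "compose {..<n} \<pi> \<in> measurable ?N ?NX"
    unfolding compose_def
  proof (rule measurable_restrict)
    show "(\<lambda>x. \<pi> (x i)) \<in> measurable ?N (meas X)" if "i \<in> {..<n}" for i
      using measurable_compose[of "\<lambda>x. x i" ?N \<mu> \<pi> "meas X"] \<pi>
        measurable_component_singleton[OF that, of "\<lambda>_. \<mu>"] by simp
  qed
  have "distr ?N (meas Z) \<Phi> = distr (distr ?N ?NX (compose {..<n} \<pi>)) (meas Z) \<phi>"
  proof -
    have "\<Phi> = \<phi> \<circ> compose {..<n} \<pi>" by (simp add: fun_eq_iff \<Phi>_def)
    then show ?thesis by (simp add: distr_distr[OF \<phi>meas cm])
  qed
  also have "distr ?N ?NX (compose {..<n} \<pi>) = ?NX"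
    using distr_PiM_finite_prob_space'[of "{..<n}" "\<lambda>_. \<mu>" "\<lambda>_. meas X" \<pi>] \<mu> mX.prob_space_axioms \<pi>
    by (simp add: distr)
  also note \<phi>distr
  finally have \<Phi>distr: "distr ?N (meas Z) \<Phi> = meas Z" .
  show ?thesis
    unfolding nonlocal_poincare_def
  proof (intro allI impI)
    fix g R L B and r :: real
    assume r: "0 < r" and L: "0 \<le> L"
      and g: "\<forall>x\<in>mspace (met Z). \<forall>y\<in>mspace (met Z). \<bar>g x - g y\<bar> \<le> L * mdist (met Z) x y"
      and B: "\<forall>x\<in>mspace (met Z). \<bar>g x\<bar> \<le> B" and R[measurable]: "R \<in> borel_measurable (meas Z)"
      and RB: "\<forall>x\<in>mspace (met Z). 0 \<le> R x \<and> R x \<le> L"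
      and loc: "\<forall>x\<in>mspace (met Z). \<forall>y\<in>mspace (met Z). \<forall>y'\<in>mspace (met Z).
           mdist (met Z) y x < r \<longrightarrow> mdist (met Z) y' x < r \<longrightarrow> \<bar>g y - g y'\<bar> \<le> R x * mdist (met Z) y y'"
    have [measurable]: "g \<in> borel_measurable (meas Z)"
      by (rule pm_lipschitz_measurable[OF Z _ L]) (use g in blast)
    note [measurable] = \<Phi>N[OF s]
    have F: "lipn n L (\<lambda>x. g (\<Phi> x))"
      unfolding lipn_def
    proof (intro allI)
      fix x y
      have "\<bar>g (\<Phi> x) - g (\<Phi> y)\<bar> \<le> L * mdist (met Z) (\<Phi> x) (\<Phi> y)"
        using g \<Phi>mem by blast
      also have "\<dots> \<le> L * rdist n x y"
        by (rule mult_left_mono[OF \<Phi>lip L])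
      finally show "\<bar>g (\<Phi> x) - g (\<Phi> y)\<bar> \<le> L * rdist n x y" .
    qed
    have lF: "loclip n r (R (\<Phi> x)) x (\<lambda>x. g (\<Phi> x))" for x
      unfolding loclip_def
    proof (intro allI impI)
      fix y y' assume "rdist n y x < r" "rdist n y' x < r"
      then have "mdist (met Z) (\<Phi> y) (\<Phi> x) < r" "mdist (met Z) (\<Phi> y') (\<Phi> x) < r"
        using \<Phi>lip by (auto intro: le_less_trans)
      then have "\<bar>g (\<Phi> y) - g (\<Phi> y')\<bar> \<le> R (\<Phi> x) * mdist (met Z) (\<Phi> y) (\<Phi> y')"
        using loc \<Phi>mem by blast
      also have "\<dots> \<le> R (\<Phi> x) * rdist n y y'"
        using RB \<Phi>mem by (intro mult_left_mono \<Phi>lip) blast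
      finally show "\<bar>g (\<Phi> y) - g (\<Phi> y')\<bar> \<le> R (\<Phi> x) * rdist n y y'" .
    qed
    have "vari ?N (\<lambda>x. g (\<Phi> x)) \<le> c * (\<integral>x. (R (\<Phi> x))\<^sup>2 \<partial>?N)"
      by (rule nonlocal_poincare_product[OF \<mu> s P c F _ r, where B = B and B' = L])
        (use B RB \<Phi>mem lF in auto)
    also have "vari ?N (\<lambda>x. g (\<Phi> x)) = vari (distr ?N (meas Z) \<Phi>) g"
      unfolding vari_def by (simp add: integral_distr[OF \<Phi>N[OF s]])
    also have "(\<integral>x. (R (\<Phi> x))\<^sup>2 \<partial>?N) = (\<integral>x. (R x)\<^sup>2 \<partial>distr ?N (meas Z) \<Phi>)"
      by (simp add: integral_distr[OF \<Phi>N[OF s]])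
    finally show "vari (meas Z) g \<le> c * (\<integral>x. (R x)\<^sup>2 \<partial>meas Z)"
      by (simp only: \<Phi>distr)
  qed
qed

section \<open>Stability under the box distance\<close>

lemma mem_mball_of: "y \<in> mball_of m x r \<longleftrightarrow> x \<in> mspace m \<and> y \<in> mspace m \<and> mdist m x y < r"
  and mem_mcball_of: "y \<in> mcball_of m x r \<longleftrightarrow> x \<in> mspace m \<and> y \<in> mspace m \<and> mdist m x y \<le> r"
proof -
  interpret Metric_space "mspace m" "mdist m" by (rule Metric_space_mspace_mdist)
  show "y \<in> mball_of m x r \<longleftrightarrow> x \<in> mspace m \<and> y \<in> mspace m \<and> mdist m x y < r"
    "y \<in> mcball_of m x r \<longleftrightarrow> x \<in> mspace m \<and> y \<in> mspace m \<and> mdist m x y \<le> r"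
    by (auto simp: mball_of_def mcball_of_def)
qed

text \<open>The infimum defining \<open>lip_const\<close> is attained: each pair at positive
  distance bounds every admissible constant from below by its difference quotient.\<close>

lemma lip_const_le_iff:
  assumes A: "A \<subseteq> mspace m" and c: "0 \<le> c"
  shows "lip_const m f A \<le> ennreal c \<longleftrightarrow> (\<forall>x\<in>A. \<forall>y\<in>A. \<bar>f x - f y\<bar> \<le> c * mdist m x y)"
proof
  interpret Metric_space "mspace m" "mdist m" by (rule Metric_space_mspace_mdist)
  assume le: "lip_const m f A \<le> ennreal c"
  show "\<forall>x\<in>A. \<forall>y\<in>A. \<bar>f x - f y\<bar> \<le> c * mdist m x y"
  proof (intro ballI)
    fix x y assume x: "x \<in> A" and y: "y \<in> A"
    show "\<bar>f x - f y\<bar> \<le> c * mdist m x y"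
    proof (cases "mdist m x y = 0")
      case True
      then show ?thesis using x y A zero[of x y] by auto
    next
      case False
      then have d: "0 < mdist m x y" using nonneg[of x y] by linarith
      have "ennreal (\<bar>f x - f y\<bar> / mdist m x y) \<le> lip_const m f A"
        unfolding lip_const_def
      proof (rule Inf_greatest)
        fix z assume "z \<in> {ennreal L |L. 0 \<le> L \<and> (\<forall>x\<in>A. \<forall>y\<in>A. \<bar>f x - f y\<bar> \<le> L * mdist m x y)}"
        then obtain L where "z = ennreal L" "\<bar>f x - f y\<bar> \<le> L * mdist m x y" using x y by blast
        then show "ennreal (\<bar>f x - f y\<bar> / mdist m x y) \<le> z"
          using d by (simp add: pos_divide_le_eq ennreal_leI)
      qed
      with le have "ennreal (\<bar>f x - f y\<bar> / mdist m x y) \<le> ennreal c" by (rule order_trans[rotated])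
      then show ?thesis using c d by (simp add: pos_divide_le_eq ennreal_le_iff)
    qed
  qed
next
  assume "\<forall>x\<in>A. \<forall>y\<in>A. \<bar>f x - f y\<bar> \<le> c * mdist m x y"
  then show "lip_const m f A \<le> ennreal c"
    unfolding lip_const_def using c by (intro Inf_lower) auto
qed

lemma lip_const_mono: "A \<subseteq> B \<Longrightarrow> lip_const m f A \<le> lip_const m f B"
  unfolding lip_const_def by (intro Inf_superset_mono) blast

text \<open>Real-valued, for Bochner integrals; for Lipschitz \<open>f\<close> the conversion loses
  nothing (\<open>ennreal_slope\<close>). Open balls, in place of the closed ones in
  \<open>lip_a\<close>, make it lower semicontinuous in the centre.\<close>

definition slope :: "'a metric \<Rightarrow> ('a \<Rightarrow> real) \<Rightarrow> real \<Rightarrow> 'a \<Rightarrow> real" where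
  "slope m f r x = enn2real (lip_const m f (mball_of m x r))"

lemma mball_of_subset: "mball_of m x r \<subseteq> mspace m"
  by (auto simp: mem_mball_of)

context
  fixes m :: "'a metric" and f :: "'a \<Rightarrow> real" and L :: real
  assumes L: "0 \<le> L"
    and f: "\<And>x y. x \<in> mspace m \<Longrightarrow> y \<in> mspace m \<Longrightarrow> \<bar>f x - f y\<bar> \<le> L * mdist m x y"
begin

lemma lip_const_mball_le: "lip_const m f (mball_of m x r) \<le> ennreal L"
  by (subst lip_const_le_iff[OF mball_of_subset L]) (use f in \<open>auto simp: mem_mball_of\<close>)

lemma ennreal_slope: "ennreal (slope m f r x) = lip_const m f (mball_of m x r)"
  unfolding slope_def
  by (rule ennreal_enn2real) (use lip_const_mball_le[of x r] in \<open>auto simp: top_unique intro: le_less_trans\<close>)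

lemma slope_nonneg: "0 \<le> slope m f r x"
  by (simp add: slope_def)

lemma slope_le: "slope m f r x \<le> L"
  using lip_const_mball_le[of x r] L unfolding ennreal_slope[symmetric] by (simp add: ennreal_le_iff)

lemma slope_le_iff:
  assumes "0 \<le> c"
  shows "slope m f r x \<le> c \<longleftrightarrow> (\<forall>y\<in>mball_of m x r. \<forall>z\<in>mball_of m x r. \<bar>f y - f z\<bar> \<le> c * mdist m y z)"
  using lip_const_le_iff[OF mball_of_subset assms, of m f x r] assms
  unfolding ennreal_slope[symmetric] by (simp add: ennreal_le_iff)

lemma slope_bound:
  assumes "y \<in> mball_of m x r" "z \<in> mball_of m x r"
  shows "\<bar>f y - f z\<bar> \<le> slope m f r x * mdist m y z"
  using slope_le_iff[OF slope_nonneg, of r x r x] assms by blast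

lemma slope_mono:
  assumes "mball_of m x r \<subseteq> mball_of m y s"
  shows "slope m f r x \<le> slope m f s y"
  using lip_const_mono[OF assms, of m f] slope_nonneg
  unfolding ennreal_slope[symmetric] by (simp add: ennreal_le_iff)

end

text \<open>Superlevel sets are open: a pair of points witnessing slope above c in one open ball
  still lies in the balls of the same radius around nearby centres.\<close>

lemma slope_measurable:
  assumes X: "pm_space X" and L: "0 \<le> L"
    and f: "\<And>x y. x \<in> mspace (met X) \<Longrightarrow> y \<in> mspace (met X) \<Longrightarrow> \<bar>f x - f y\<bar> \<le> L * mdist (met X) x y"
  shows "slope (met X) f r \<in> borel_measurable (meas X)"
proof (rule borel_measurableI_greater)
  let ?m = "met X"
  interpret Metric_space "mspace ?m" "mdist ?m" by (rule Metric_space_mspace_mdist)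
  fix c :: real
  note slope_le_iff = slope_le_iff[of L ?m f, OF L f]
  have "openin (mtopology_of ?m) {x \<in> mspace ?m. c < slope ?m f r x}"
  proof (cases "0 \<le> c")
    case False
    have "c < slope ?m f r x" for x using slope_nonneg[of L ?m f r x, OF L f] False by linarith
    then have "{x \<in> mspace ?m. c < slope ?m f r x} = mspace ?m" by auto
    then show ?thesis by (simp add: mtopology_of_def)
  next
    case c: True
    show ?thesis
      unfolding openin_mtopology_of_iff
    proof (intro conjI ballI)
      fix x assume x: "x \<in> {x \<in> mspace ?m. c < slope ?m f r x}"
      then have "\<not> slope ?m f r x \<le> c" by auto
      then obtain y z where yz: "y \<in> mball_of ?m x r" "z \<in> mball_of ?m x r"
        and nle: "\<not> \<bar>f y - f z\<bar> \<le> c * mdist ?m y z"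
        using slope_le_iff[OF _ _ c] by blast
      define e where "e = min (r - mdist ?m x y) (r - mdist ?m x z)"
      have e: "0 < e" using yz by (auto simp: e_def mem_mball_of)
      show "\<exists>d>0. \<forall>x'\<in>mspace ?m. mdist ?m x x' < d \<longrightarrow> x' \<in> {x \<in> mspace ?m. c < slope ?m f r x}"
      proof (intro exI[of _ e] conjI ballI impI e)
        fix x' assume x': "x' \<in> mspace ?m" "mdist ?m x x' < e"
        have "mdist ?m x' y < r" "mdist ?m x' z < r"
          using x' x yz triangle[of x' x y] triangle[of x' x z] commute[of x x']
          by (auto simp: e_def mem_mball_of)
        then have "y \<in> mball_of ?m x' r" "z \<in> mball_of ?m x' r"
          using x' yz by (auto simp: mem_mball_of)
        with nle have "\<not> slope ?m f r x' \<le> c" using slope_le_iff[OF _ _ c] by blast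
        then show "x' \<in> {x \<in> mspace ?m. c < slope ?m f r x}" using x' by auto
      qed
    qed auto
  qed
  from pm_open_sets[OF X this]
  show "{x \<in> space (meas X). c < slope ?m f r x} \<in> sets (meas X)"
    by (simp add: pm_space_props[OF X])
qed

text \<open>
  A McShane extension with a cone of slope \<open>\<sigma> s\<close> at \<open>b s\<close>.  As \<open>\<sigma> s\<close> exceeds the local Lipschitz
  constant of the data at \<open>s\<close> by \<open>\<eta>\<close>, near-minimisers of the infimum at \<open>z\<close> stay close to \<open>z\<close>;
  the extra penalty beyond distance \<open>r / 4\<close> keeps away remote points, where only the global constant
  \<open>K\<close> is available.
\<close>
lemma local_mcshane_extension:
  fixes mZ :: "'z metric" and b :: "'i \<Rightarrow> 'z" and u \<sigma> \<sigma>' :: "'i \<Rightarrow> real" and \<delta> :: "'i \<Rightarrow> 'i \<Rightarrow> real"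
  assumes S: "S \<noteq> {}" and b: "\<And>s. s \<in> S \<Longrightarrow> b s \<in> mspace mZ"
    and K: "1 \<le> K" and \<eta>: "0 < \<eta>" "\<eta> \<le> 1" and r: "0 < r" and \<epsilon>: "0 \<le> \<epsilon>" "\<epsilon> \<le> r'"
    and r': "r' = r * \<eta> / (40 * K)"
    and M: "\<And>s. s \<in> S \<Longrightarrow> \<bar>u s\<bar> \<le> M"
    and \<delta>: "\<And>s t. s \<in> S \<Longrightarrow> t \<in> S \<Longrightarrow> \<bar>\<delta> s t - mdist mZ (b s) (b t)\<bar> \<le> \<epsilon>"
    and \<sigma>: "\<And>s. s \<in> S \<Longrightarrow> \<eta> \<le> \<sigma> s" "\<And>s. s \<in> S \<Longrightarrow> \<sigma> s \<le> K"
    and u: "\<And>s t. s \<in> S \<Longrightarrow> t \<in> S \<Longrightarrow> \<bar>u s - u t\<bar> \<le> K * \<delta> s t"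
    and uloc: "\<And>s t. s \<in> S \<Longrightarrow> t \<in> S \<Longrightarrow> \<delta> s t < r \<Longrightarrow> \<bar>u s - u t\<bar> \<le> (\<sigma> s - \<eta>) * \<delta> s t"
    and \<sigma>': "\<And>s t. s \<in> S \<Longrightarrow> t \<in> S \<Longrightarrow> \<delta> s t < r \<Longrightarrow> \<sigma> s \<le> \<sigma>' t"
  shows "\<exists>g. (\<forall>z\<in>mspace mZ. \<forall>z'\<in>mspace mZ. \<bar>g z - g z'\<bar> \<le> 3 * K * mdist mZ z z') \<and>
    (\<forall>z. \<bar>g z\<bar> \<le> M) \<and> (\<forall>s\<in>S. \<bar>g (b s) - u s\<bar> \<le> K * \<epsilon>) \<and>
    (\<forall>s\<in>S. \<forall>z\<in>mspace mZ. \<forall>z'\<in>mspace mZ. mdist mZ (b s) z < r' \<longrightarrow> mdist mZ (b s) z' < r' \<longrightarrow>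
       \<bar>g z - g z'\<bar> \<le> \<sigma>' s * mdist mZ z z')"
proof -
  interpret Z: Metric_space "mspace mZ" "mdist mZ" by (rule Metric_space_mspace_mdist)
  let ?d = "mdist mZ"
  \<comment> \<open>Slope at most K up to distance r / 4 and at most K + 2 K beyond, hence the
    global Lipschitz constant 3 K.\<close>
  define \<psi> where "\<psi> s t = \<sigma> s * t + 2 * K * max 0 (t - r / 4)" for s t
  define g where "g z = (INF s\<in>S. u s + \<psi> s (?d z (b s)))" for z
  define clip where "clip t = max (- M) (min M t)" for t :: real
  have \<sigma>0: "0 < \<sigma> s" if "s \<in> S" for s using \<sigma>(1)[OF that] \<eta> by linarith
  have \<psi>0: "0 \<le> \<psi> s t" if "s \<in> S" "0 \<le> t" for s t
    using that \<sigma>0[of s] K by (auto simp: \<psi>_def)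
  have \<psi>mono: "\<psi> s t \<le> \<psi> s t'" if "s \<in> S" "t \<le> t'" for s t t'
    unfolding \<psi>_def using that \<sigma>0[of s] K by (intro add_mono mult_left_mono) auto
  have \<psi>lip: "\<psi> s (t + h) \<le> \<psi> s t + 3 * K * h" if "s \<in> S" "0 \<le> h" for s t h
  proof -
    have "\<sigma> s * h \<le> K * h" using that \<sigma>(2) by (intro mult_right_mono) auto
    moreover have "2 * K * max 0 (t + h - r / 4) \<le> 2 * K * (max 0 (t - r / 4) + h)"
      using K that by (intro mult_left_mono) auto
    ultimately show ?thesis by (simp add: \<psi>_def algebra_simps)
  qed
  have bdd: "bdd_below ((\<lambda>s. u s + \<psi> s (?d z (b s))) ` S)" for z
  proof (rule bdd_belowI2)
    fix s assume "s \<in> S"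
    then show "- M \<le> u s + \<psi> s (?d z (b s))"
      using M[of s] \<psi>0[of s "?d z (b s)"] by auto
  qed
  have g_le: "g z \<le> u s + \<psi> s (?d z (b s))" if "s \<in> S" for s z
    unfolding g_def by (rule cINF_lower[OF bdd that])
  have g_ge: "c \<le> g z" if "\<And>s. s \<in> S \<Longrightarrow> c \<le> u s + \<psi> s (?d z (b s))" for c z
    unfolding g_def by (rule cINF_greatest[OF S that])
  have g_near: "\<exists>s\<in>S. u s + \<psi> s (?d z (b s)) < g z + \<kappa>" if "0 < \<kappa>" for z \<kappa>
    using cINF_less_iff[OF S bdd, of z "g z + \<kappa>"] that unfolding g_def[symmetric] by simp
  have g_lip: "g z \<le> g z' + 3 * K * ?d z z'" if z: "z \<in> mspace mZ" "z' \<in> mspace mZ" for z z'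
  proof -
    have "g z - 3 * K * ?d z z' \<le> g z'"
    proof (rule g_ge)
      fix s assume s: "s \<in> S"
      have "g z \<le> u s + \<psi> s (?d z (b s))" by (rule g_le[OF s])
      also have "\<psi> s (?d z (b s)) \<le> \<psi> s (?d z' (b s) + ?d z z')"
        using Z.triangle[OF z b[OF s]] by (intro \<psi>mono[OF s]) simp
      also have "\<dots> \<le> \<psi> s (?d z' (b s)) + 3 * K * ?d z z'" by (rule \<psi>lip[OF s]) simp
      finally show "g z - 3 * K * ?d z z' \<le> u s + \<psi> s (?d z' (b s))" by simp
    qed
    then show ?thesis by simp
  qed
  have r'0: "0 < r'" using r \<eta> K by (simp add: r')
  have r'r: "40 * r' \<le> r"
  proof -
    have "r * \<eta> \<le> r * K" using r \<eta> K by (intro mult_left_mono) auto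
    then show ?thesis using K by (simp add: r' pos_divide_le_eq)
  qed
  have Kr': "40 * (K * r') = r * \<eta>" using K by (simp add: r')
  have K\<epsilon>: "0 \<le> K * \<epsilon>" using K \<epsilon> by simp
  have upper: "g (b s) \<le> u s" if s: "s \<in> S" for s
    using g_le[OF s, of "b s"] b[OF s] r by (simp add: \<psi>_def)
  have lower: "u t - K * \<epsilon> \<le> g (b t)" if t: "t \<in> S" for t
  proof (rule g_ge)
    fix s assume s: "s \<in> S"
    let ?t = "?d (b t) (b s)"
    have \<delta>st: "\<delta> s t \<le> ?t + \<epsilon>" "?t \<le> \<delta> s t + \<epsilon>"
      using \<delta>[OF s t] Z.commute[of "b s" "b t"] by auto
    show "u t - K * \<epsilon> \<le> u s + \<psi> s ?t"
    proof (cases "\<delta> s t < r")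
      case True
      have "u t - u s \<le> (\<sigma> s - \<eta>) * \<delta> s t" using uloc[OF s t True] by linarith
      also have "\<dots> \<le> (\<sigma> s - \<eta>) * (?t + \<epsilon>)"
        using \<sigma>(1)[OF s] \<delta>st by (intro mult_left_mono) auto
      also have "\<dots> \<le> \<sigma> s * (?t + \<epsilon>)"
        using \<eta> \<epsilon> by (intro mult_right_mono) auto
      also have "\<dots> \<le> \<sigma> s * ?t + K * \<epsilon>"
        using \<sigma>(2)[OF s] \<epsilon> by (simp add: distrib_left mult_right_mono)
      also have "\<sigma> s * ?t \<le> \<psi> s ?t" using K by (simp add: \<psi>_def)
      finally show ?thesis by simp
    next
      case False
      then have t2: "r / 2 \<le> ?t" using \<delta>st \<epsilon> r'r r'0 by linarith
      have "u t - u s \<le> K * \<delta> s t" using u[OF s t] by linarith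
      also have "\<dots> \<le> K * (?t + \<epsilon>)" using K \<delta>st by (intro mult_left_mono) auto
      \<comment> \<open>At distance t \<ge> r / 2 one has t \<le> 2 (t - r / 4), so the penalty
        alone outweighs the global bound K t.\<close>
      also have "K * ?t \<le> K * (2 * (?t - r / 4))" using t2 K by (intro mult_left_mono) auto
      then have "K * (?t + \<epsilon>) \<le> 2 * K * max 0 (?t - r / 4) + K * \<epsilon>"
        using t2 r by (simp add: algebra_simps max_def)
      also have "2 * K * max 0 (?t - r / 4) \<le> \<psi> s ?t"
        using \<sigma>0[OF s] by (simp add: \<psi>_def)
      finally show ?thesis by simp
    qed
  qed
  have loc: "g z' \<le> g z + \<sigma>' t * ?d z z'"
    if t: "t \<in> S" and z: "z \<in> mspace mZ" "z' \<in> mspace mZ"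
      and zt: "?d (b t) z < r'" "?d (b t) z' < r'" for t z z'
  proof (rule field_le_epsilon)
    fix e :: real assume e: "0 < e"
    define \<kappa> where "\<kappa> = min e (K * r')"
    have \<kappa>: "0 < \<kappa>" "\<kappa> \<le> e" "\<kappa> \<le> K * r'" using e K r'0 by (auto simp: \<kappa>_def)
    obtain s where s: "s \<in> S" and near: "u s + \<psi> s (?d z (b s)) < g z + \<kappa>"
      using g_near[OF \<kappa>(1)] by blast
    let ?D = "?d z (b s)"
    have D0: "0 \<le> ?D" by simp
    have "?d (b s) (b t) \<le> ?d (b s) z + ?d z (b t)" by (rule Z.triangle) (use s t z b in auto)
    then have \<delta>st: "\<delta> s t \<le> ?D + 2 * r'"
      using \<delta>[OF s t] zt \<epsilon> Z.commute[of "b s" z] Z.commute[of z "b t"] by linarith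
    have "g z \<le> u t + \<psi> t (?d z (b t))" by (rule g_le[OF t])
    also have "\<psi> t (?d z (b t)) \<le> K * r'"
    proof -
      have "?d z (b t) \<le> r'" "?d z (b t) \<le> r / 4" using zt r'r r'0 Z.commute[of z "b t"] by linarith+
      then have "\<psi> t (?d z (b t)) = \<sigma> t * ?d z (b t)" by (simp add: \<psi>_def)
      also have "\<dots> \<le> K * r'"
        using \<sigma>(2)[OF t] \<sigma>0[OF t] K \<open>?d z (b t) \<le> r'\<close> by (intro mult_mono) auto
      finally show ?thesis .
    qed
    finally have star: "\<psi> s ?D \<le> (u t - u s) + 2 * (K * r')"
      using near \<kappa> by linarith
    have ut: "u t - u s \<le> K * (?D + 2 * r')"
    proof -
      have "u t - u s \<le> K * \<delta> s t" using u[OF s t] by linarith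
      also have "\<dots> \<le> K * (?D + 2 * r')" using K \<delta>st by (intro mult_left_mono) auto
      finally show ?thesis .
    qed
    \<comment> \<open>First localisation: the penalty grows at rate 2 K but the data at rate at most
      K, so a near-minimiser satisfies ?D \<le> r / 2 + 4 r'. Then \<delta> s t < r, and the local
      bound \<open>uloc\<close> becomes available.\<close>
    have "2 * K * (?D - r / 4) \<le> 2 * K * max 0 (?D - r / 4)"
      using K by (intro mult_left_mono) auto
    also have "\<dots> \<le> \<psi> s ?D" using \<sigma>0[OF s] by (simp add: \<psi>_def)
    also have "\<dots> \<le> K * (?D + 2 * r') + 2 * (K * r')" using star ut by linarith
    finally have "K * ?D \<le> K * (r / 2 + 4 * r')" by (simp add: algebra_simps)
    then have "?D \<le> r / 2 + 4 * r'" using K by simp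
    then have "\<delta> s t < r" using \<delta>st r'r r'0 by linarith
    note ul = uloc[OF s t this]
    \<comment> \<open>Second localisation: the margin \<eta> between \<sigma> s and the local
      constant yields \<eta> ?D \<le> 4 K r', which is r \<eta> / 10 by the choice of r'.\<close>
    have "u t - u s \<le> (\<sigma> s - \<eta>) * \<delta> s t" using ul by linarith
    also have "\<dots> \<le> (\<sigma> s - \<eta>) * (?D + 2 * r')"
      using \<sigma>(1)[OF s] \<delta>st by (intro mult_left_mono) auto
    also have "\<dots> \<le> \<sigma> s * ?D - \<eta> * ?D + 2 * (K * r')"
    proof -
      have "(\<sigma> s - \<eta>) * (2 * r') \<le> K * (2 * r')"
        using \<sigma>(2)[OF s] \<eta> r'0 by (intro mult_right_mono) auto
      then show ?thesis by (simp add: algebra_simps)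
    qed
    finally have "\<psi> s ?D \<le> \<sigma> s * ?D - \<eta> * ?D + 4 * (K * r')" using star by linarith
    moreover have "\<sigma> s * ?D \<le> \<psi> s ?D" using K by (simp add: \<psi>_def)
    ultimately have "\<eta> * ?D \<le> r * \<eta> / 10" using Kr' by linarith
    then have "\<eta> * ?D \<le> \<eta> * (r / 10)" by (simp add: mult.commute)
    then have D: "?D \<le> r / 10" using \<eta> by simp
    have zz: "?d z z' \<le> 2 * r'"
      using Z.triangle[of z "b t" z'] z b[OF t] zt Z.commute[of z "b t"] by linarith
    have D': "?d z' (b s) \<le> ?D + ?d z z'"
      using Z.triangle[of z' z "b s"] z b[OF s] Z.commute[of z z'] by linarith
    \<comment> \<open>Also z' lies within r / 4 of b s, where the penalty is inactive. Passing from
      z to z' therefore costs only the slope \<sigma> s, which \<sigma>' t dominates.\<close>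
    have "g z' \<le> u s + \<psi> s (?d z' (b s))" by (rule g_le[OF s])
    also have "\<psi> s (?d z' (b s)) = \<sigma> s * ?d z' (b s)"
    proof -
      have "?d z' (b s) \<le> r / 4" using D' D zz r'r r by linarith
      then show ?thesis by (simp add: \<psi>_def)
    qed
    also have "\<dots> \<le> \<sigma> s * (?D + ?d z z')"
      using D' \<sigma>0[OF s] by (intro mult_left_mono) auto
    also have "\<dots> = \<sigma> s * ?D + \<sigma> s * ?d z z'" by (simp add: distrib_left)
    also have "\<sigma> s * ?d z z' \<le> \<sigma>' t * ?d z z'"
      using \<sigma>'[OF s t \<open>\<delta> s t < r\<close>] by (intro mult_right_mono) auto
    also have "\<sigma> s * ?D \<le> \<psi> s ?D" by fact
    finally show "g z' \<le> g z + \<sigma>' t * ?d z z' + e" using near \<kappa> by linarith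
  qed
  \<comment> \<open>Truncation to [-M, M] is 1-Lipschitz and fixes the data, so the sup bound comes
    without loss in the other estimates.\<close>
  have clip: "\<bar>clip x - clip y\<bar> \<le> \<bar>x - y\<bar>" for x y by (auto simp: clip_def)
  have M0: "0 \<le> M" using M S by fastforce
  show ?thesis
  proof (intro exI[of _ "\<lambda>z. clip (g z)"] conjI ballI allI impI)
    fix z z' assume z: "z \<in> mspace mZ" "z' \<in> mspace mZ"
    have "\<bar>g z - g z'\<bar> \<le> 3 * K * ?d z z'"
      using g_lip[OF z] g_lip[OF z(2,1)] Z.commute[of z z'] by (simp add: abs_le_iff)
    then show "\<bar>clip (g z) - clip (g z')\<bar> \<le> 3 * K * ?d z z'"
      using clip by (rule order_trans[rotated])
  next
    show "\<bar>clip (g z)\<bar> \<le> M" for z using M0 by (auto simp: clip_def)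
  next
    fix s assume s: "s \<in> S"
    have "clip (u s) = u s" using M[OF s] by (auto simp: clip_def)
    then have "\<bar>clip (g (b s)) - u s\<bar> \<le> \<bar>g (b s) - u s\<bar>" using clip[of "g (b s)" "u s"] by simp
    also have "\<dots> \<le> K * \<epsilon>" using upper[OF s] lower[OF s] by (simp add: abs_le_iff)
    finally show "\<bar>clip (g (b s)) - u s\<bar> \<le> K * \<epsilon>" .
  next
    fix s z z' assume s: "s \<in> S" and z: "z \<in> mspace mZ" "z' \<in> mspace mZ"
      and zs: "?d (b s) z < r'" "?d (b s) z' < r'"
    have "\<bar>g z - g z'\<bar> \<le> \<sigma>' s * ?d z z'"
      using loc[OF s z zs] loc[OF s z(2,1) zs(2,1)] Z.commute[of z z'] by (simp add: abs_le_iff)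
    then show "\<bar>clip (g z) - clip (g z')\<bar> \<le> \<sigma>' s * ?d z z'"
      using clip by (rule order_trans[rotated])
  qed
qed

text \<open>Both variances are computed on the unit interval through the parameters a and b, for f
  and for a McShane extension g of its values. On the good set the slope of g is at most that of f
  on balls of radius 2 r, plus \<eta>. On the bad set, of measure at most \<epsilon>, only the
  constant 3 K is known, hence 9 K^2 \<epsilon>; the last summand comes from
  \<open>vari_le_of_close\<close>.\<close>

lemma vari_le_of_box_close:
  fixes X :: "'a pm" and Z :: "'b pm"
  assumes X: "pm_space X" and Z: "pm_space Z" and np: "nonlocal_poincare c Z" and c: "0 \<le> c"
    and box: "box_dist X Z < ennreal \<epsilon>" and L: "0 \<le> L"
    and f: "\<And>x y. x \<in> mspace (met X) \<Longrightarrow> y \<in> mspace (met X) \<Longrightarrow> \<bar>f x - f y\<bar> \<le> L * mdist (met X) x y"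
    and M: "\<And>x. x \<in> mspace (met X) \<Longrightarrow> \<bar>f x\<bar> \<le> M"
    and \<eta>: "0 < \<eta>" "\<eta> \<le> 1" and r: "0 < r" and K: "K = L + 1"
    and \<epsilon>: "\<epsilon> \<le> r * \<eta> / (40 * K)" "\<epsilon> < 1"
  shows "vari (meas X) f \<le>
    c * ((\<integral>x. (slope (met X) f (2 * r) x + \<eta>)\<^sup>2 \<partial>meas X) + 9 * K\<^sup>2 * \<epsilon>) + 4 * M * ((K + 2 * M) * \<epsilon>)"
proof -
  interpret dX: Metric_space "mspace (met X)" "mdist (met X)" by (rule Metric_space_mspace_mdist)
  interpret dZ: Metric_space "mspace (met Z)" "mdist (met Z)" by (rule Metric_space_mspace_mdist)
  interpret U: prob_space unit_leb
    using pm_space_unit_interval by (simp add: pm_space_def unit_interval_def)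
  define r' where "r' = r * \<eta> / (40 * K)"
  have K1: "1 \<le> K" using L K by simp
  have r'0: "0 < r'" using r \<eta> K1 by (simp add: r'_def)
  obtain e a b S where e: "0 < e" "e < \<epsilon>" and a: "parameter X a" and b: "parameter Z b"
    and S[measurable]: "S \<in> sets unit_leb" and mS: "1 - e \<le> measure unit_leb S"
    and ab: "\<And>s t. s \<in> S \<Longrightarrow> t \<in> S \<Longrightarrow> \<bar>mdist (met X) (a s) (a t) - mdist (met Z) (b s) (b t)\<bar> \<le> e"
    using box unfolding box_dist_def Inf_less_iff by (auto simp: ennreal_less_iff)
  have am[measurable]: "a \<in> measurable unit_leb (meas X)" and ad: "distr unit_leb (meas X) a = meas X"
    and bm[measurable]: "b \<in> measurable unit_leb (meas Z)" and bd: "distr unit_leb (meas Z) b = meas Z"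
    using a b by (auto simp: parameter_def)
  have aX: "a s \<in> mspace (met X)" and bZ: "b s \<in> mspace (met Z)" if "s \<in> space unit_leb" for s
    using measurable_space[OF am that] measurable_space[OF bm that] pm_space_props(1)[OF X] pm_space_props(1)[OF Z]
    by auto
  have Sp: "s \<in> space unit_leb" if "s \<in> S" for s using sets.sets_into_space[OF S] that by blast
  \<comment> \<open>As the measure of S is at least 1 - e > 0; the infimum in the extension must run
    over a nonempty set.\<close>
  have S0: "S \<noteq> {}" using mS e \<epsilon> by auto
  \<comment> \<open>Radius 2 r, because the r-ball at a s lies in the 2 r-ball at a t once these
    points are closer than r. The choice K = L + 1 leaves room for adding \<eta> \<le> 1.\<close>
  define \<sigma>' where "\<sigma>' s = slope (met X) f (2 * r) (a s) + \<eta>" for s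
  let ?sl = "slope (met X) f"
  note sl0 = slope_nonneg[of L "met X" f, OF L f] and slL = slope_le[of L "met X" f, OF L f]
    and slb = slope_bound[of L "met X" f, OF L f]
  have "\<exists>g. (\<forall>z\<in>mspace (met Z). \<forall>z'\<in>mspace (met Z). \<bar>g z - g z'\<bar> \<le> 3 * K * mdist (met Z) z z') \<and>
    (\<forall>z. \<bar>g z\<bar> \<le> M) \<and> (\<forall>s\<in>S. \<bar>g (b s) - f (a s)\<bar> \<le> K * e) \<and>
    (\<forall>s\<in>S. \<forall>z\<in>mspace (met Z). \<forall>z'\<in>mspace (met Z).
       mdist (met Z) (b s) z < r' \<longrightarrow> mdist (met Z) (b s) z' < r' \<longrightarrow>
       \<bar>g z - g z'\<bar> \<le> \<sigma>' s * mdist (met Z) z z')"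
  proof (rule local_mcshane_extension[where \<sigma> = "\<lambda>s. ?sl r (a s) + \<eta>" and \<delta> = "\<lambda>s t. mdist (met X) (a s) (a t)"
        and u = "\<lambda>s. f (a s)", OF S0 bZ[OF Sp] K1 \<eta> r less_imp_le[OF e(1)] _ r'_def M[OF aX[OF Sp]] ab])
    show "e \<le> r'" using e \<epsilon> by (simp add: r'_def)
    fix s assume s: "s \<in> S"
    show "\<eta> \<le> ?sl r (a s) + \<eta>" using sl0 by simp
    show "?sl r (a s) + \<eta> \<le> K" using slL[of r "a s"] \<eta> K by simp
    fix t assume t: "t \<in> S"
    note st = aX[OF Sp[OF s]] aX[OF Sp[OF t]]
    have "\<bar>f (a s) - f (a t)\<bar> \<le> L * mdist (met X) (a s) (a t)" by (rule f[OF st])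
    also have "\<dots> \<le> K * mdist (met X) (a s) (a t)" using K by (intro mult_right_mono) auto
    finally show "\<bar>f (a s) - f (a t)\<bar> \<le> K * mdist (met X) (a s) (a t)" .
    assume lt: "mdist (met X) (a s) (a t) < r"
    show "\<bar>f (a s) - f (a t)\<bar> \<le> (?sl r (a s) + \<eta> - \<eta>) * mdist (met X) (a s) (a t)"
      using slb[of "a s" "a s" r "a t"] st lt r by (simp add: mem_mball_of)
    have "mball_of (met X) (a s) r \<subseteq> mball_of (met X) (a t) (2 * r)"
    proof
      fix y assume "y \<in> mball_of (met X) (a s) r"
      then show "y \<in> mball_of (met X) (a t) (2 * r)"
        using dX.triangle[of "a t" "a s" y] dX.commute[of "a s" "a t"] st lt by (simp add: mem_mball_of)
    qed
    then have "?sl r (a s) \<le> ?sl (2 * r) (a t)" by (rule slope_mono[OF L f, rotated 2])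
    then show "?sl r (a s) + \<eta> \<le> \<sigma>' t" by (simp add: \<sigma>'_def)
  qed
  then obtain g where g: "\<And>z z'. z \<in> mspace (met Z) \<Longrightarrow> z' \<in> mspace (met Z) \<Longrightarrow> \<bar>g z - g z'\<bar> \<le> 3 * K * mdist (met Z) z z'"
    and gM: "\<And>z. \<bar>g z\<bar> \<le> M" and gf: "\<And>s. s \<in> S \<Longrightarrow> \<bar>g (b s) - f (a s)\<bar> \<le> K * e"
    and gloc: "\<And>s z z'. s \<in> S \<Longrightarrow> z \<in> mspace (met Z) \<Longrightarrow> z' \<in> mspace (met Z) \<Longrightarrow>
       mdist (met Z) (b s) z < r' \<Longrightarrow> mdist (met Z) (b s) z' < r' \<Longrightarrow> \<bar>g z - g z'\<bar> \<le> \<sigma>' s * mdist (met Z) z z'"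
    by blast
  have K3: "0 \<le> 3 * K" using K1 by simp
  define R where "R = slope (met Z) g r'"
  have [measurable]: "R \<in> borel_measurable (meas Z)" "g \<in> borel_measurable (meas Z)"
    "f \<in> borel_measurable (meas X)" "?sl (2 * r) \<in> borel_measurable (meas X)"
    unfolding R_def using slope_measurable[OF Z K3 g] slope_measurable[OF X L f]
      pm_lipschitz_measurable[OF Z g K3] pm_lipschitz_measurable[OF X f L] by auto
  have R: "0 \<le> R z" "R z \<le> 3 * K" for z
    unfolding R_def by (rule slope_nonneg[OF K3 g] slope_le[OF K3 g]; assumption)+
  have "vari (meas Z) g \<le> c * (\<integral>x. (R x)\<^sup>2 \<partial>meas Z)"
  proof (rule np[unfolded nonlocal_poincare_def, rule_format, OF r'0 K3, where B = M])
    fix x y y' assume "x \<in> mspace (met Z)" "y \<in> mspace (met Z)" "y' \<in> mspace (met Z)"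
      "mdist (met Z) y x < r'" "mdist (met Z) y' x < r'"
    then show "\<bar>g y - g y'\<bar> \<le> R x * mdist (met Z) y y'"
      unfolding R_def by (intro slope_bound[OF K3 g]) (auto simp: mem_mball_of dZ.commute)
  qed (use g gM R in auto)
  also have "vari (meas Z) g = vari unit_leb (\<lambda>s. g (b s))"
    by (subst bd[symmetric]) (simp add: vari_def integral_distr)
  also have "(\<integral>x. (R x)\<^sup>2 \<partial>meas Z) = (\<integral>s. (R (b s))\<^sup>2 \<partial>unit_leb)"
    by (subst bd[symmetric]) (simp add: integral_distr)
  finally have 1: "vari unit_leb (\<lambda>s. g (b s)) \<le> c * (\<integral>s. (R (b s))\<^sup>2 \<partial>unit_leb)" .
  have bad: "measure unit_leb (space unit_leb - S) \<le> e"
    using U.prob_compl[OF S] mS by simp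
  let ?i = "indicator (space unit_leb - S) :: real \<Rightarrow> real"
  have ibad: "integrable unit_leb ?i" "(\<integral>s. ?i s \<partial>unit_leb) \<le> \<epsilon>"
    using bad e by (auto simp: U.emeasure_eq_measure intro!: integrable_real_indicator)
  have \<sigma>m: "(\<lambda>s. (\<sigma>' s)\<^sup>2) \<in> borel_measurable unit_leb"
    unfolding \<sigma>'_def by measurable
  have \<sigma>'0: "0 \<le> \<sigma>' s" for s using sl0[of "2 * r" "a s"] \<eta> by (simp add: \<sigma>'_def)
  have \<sigma>'K: "\<sigma>' s \<le> K" for s using slL[of "2 * r" "a s"] \<eta> K by (simp add: \<sigma>'_def)
  have i\<sigma>: "integrable unit_leb (\<lambda>s. (\<sigma>' s)\<^sup>2)"
    by (rule U.integrable_bounded_square[where B = K]) (use \<sigma>'0 \<sigma>'K in \<open>auto simp: \<sigma>'_def\<close>)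
  have "(\<integral>s. (R (b s))\<^sup>2 \<partial>unit_leb) \<le> (\<integral>s. (\<sigma>' s)\<^sup>2 + 9 * K\<^sup>2 * ?i s \<partial>unit_leb)"
  proof (rule integral_mono)
    show "integrable unit_leb (\<lambda>s. (R (b s))\<^sup>2)"
      by (rule U.integrable_bounded_square[where B = "3 * K"]) (use R in auto)
    show "integrable unit_leb (\<lambda>s. (\<sigma>' s)\<^sup>2 + 9 * K\<^sup>2 * ?i s)"
      using i\<sigma> ibad by auto
    fix s assume s: "s \<in> space unit_leb"
    show "(R (b s))\<^sup>2 \<le> (\<sigma>' s)\<^sup>2 + 9 * K\<^sup>2 * ?i s"
    proof (cases "s \<in> S")
      case True
      have "R (b s) \<le> \<sigma>' s"
        unfolding R_def
        by (subst slope_le_iff[OF K3 g \<sigma>'0]) (use gloc[OF True] in \<open>auto simp: mem_mball_of\<close>)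
      then show ?thesis using True R by (simp add: power_mono)
    next
      case False
      have "(R (b s))\<^sup>2 \<le> (3 * K)\<^sup>2" using R by (intro power_mono) auto
      then show ?thesis using False s by (simp add: power_mult_distrib add_increasing)
    qed
  qed
  also have "\<dots> = (\<integral>s. (\<sigma>' s)\<^sup>2 \<partial>unit_leb) + 9 * K\<^sup>2 * (\<integral>s. ?i s \<partial>unit_leb)"
    using i\<sigma> ibad by simp
  also have "\<dots> \<le> (\<integral>s. (\<sigma>' s)\<^sup>2 \<partial>unit_leb) + 9 * K\<^sup>2 * \<epsilon>"
    using ibad by (intro add_left_mono mult_left_mono) auto
  also have "(\<integral>s. (\<sigma>' s)\<^sup>2 \<partial>unit_leb) = (\<integral>x. (?sl (2 * r) x + \<eta>)\<^sup>2 \<partial>meas X)"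
    by (subst ad[symmetric]) (simp add: \<sigma>'_def integral_distr)
  finally have 2: "(\<integral>s. (R (b s))\<^sup>2 \<partial>unit_leb) \<le> (\<integral>x. (?sl (2 * r) x + \<eta>)\<^sup>2 \<partial>meas X) + 9 * K\<^sup>2 * \<epsilon>" .
  have "vari (meas X) f = vari unit_leb (\<lambda>s. f (a s))"
    by (subst ad[symmetric]) (simp add: vari_def integral_distr)
  also have "\<dots> \<le> vari unit_leb (\<lambda>s. g (b s)) + 4 * M * ((K + 2 * M) * \<epsilon>)"
  proof (rule U.vari_le_of_close)
    have M0: "0 \<le> M" using gM[of undefined] by linarith
    have "(\<integral>s. \<bar>f (a s) - g (b s)\<bar> \<partial>unit_leb) \<le> (\<integral>s. K * \<epsilon> + 2 * M * ?i s \<partial>unit_leb)"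
    proof (rule integral_mono)
      show "integrable unit_leb (\<lambda>s. \<bar>f (a s) - g (b s)\<bar>)"
      proof (rule U.integrable_bounded[where B = "2 * M"])
        show "\<bar>\<bar>f (a s) - g (b s)\<bar>\<bar> \<le> 2 * M" if "s \<in> space unit_leb" for s
          using M[OF aX[OF that]] gM[of "b s"] by linarith
      qed measurable
      show "integrable unit_leb (\<lambda>s. K * \<epsilon> + 2 * M * ?i s)" using ibad by auto
      fix s assume s: "s \<in> space unit_leb"
      have "K * e \<le> K * \<epsilon>" "0 \<le> K * e" using K1 e by auto
      then show "\<bar>f (a s) - g (b s)\<bar> \<le> K * \<epsilon> + 2 * M * ?i s"
        using gf[of s] M[OF aX[OF s]] gM[of "b s"] s by (cases "s \<in> S") auto
    qed
    also have "\<dots> = K * \<epsilon> + 2 * M * (\<integral>s. ?i s \<partial>unit_leb)"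
      using ibad by (simp add: U.prob_space)
    also have "\<dots> \<le> K * \<epsilon> + 2 * M * \<epsilon>"
      using ibad M0 by (intro add_left_mono mult_left_mono) auto
    finally show "(\<integral>s. \<bar>f (a s) - g (b s)\<bar> \<partial>unit_leb) \<le> (K + 2 * M) * \<epsilon>"
      by (simp add: algebra_simps)
  qed (use M[OF aX] gM in auto)
  finally show ?thesis
    using 1 mult_left_mono[OF 2 c] by linarith
qed

text \<open>Apply \<open>vari_le_of_box_close\<close> with radius r / 2. With \<eta> fixed,
  \<epsilon> tends to 0 through ever closer spaces \<open>Z\<close>; then \<eta> tends to 0.\<close>

lemma vari_le_slope:
  fixes X :: "'a pm"
  assumes X: "pm_space X" and c: "0 \<le> c"
    and approx: "\<And>\<epsilon>. 0 < \<epsilon> \<Longrightarrow> \<exists>Z :: 'b pm. pm_space Z \<and> nonlocal_poincare c Z \<and> box_dist X Z < \<epsilon>"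
    and L: "0 \<le> L"
    and f: "\<And>x y. x \<in> mspace (met X) \<Longrightarrow> y \<in> mspace (met X) \<Longrightarrow> \<bar>f x - f y\<bar> \<le> L * mdist (met X) x y"
    and M: "\<And>x. x \<in> mspace (met X) \<Longrightarrow> \<bar>f x\<bar> \<le> M"
    and r: "0 < r"
  shows "vari (meas X) f \<le> c * (\<integral>x. (slope (met X) f r x)\<^sup>2 \<partial>meas X)"
proof -
  interpret prob_space "meas X" by (rule pm_space_props[OF X])
  let ?K = "L + 1" and ?r = "r / 2"
  let ?sl = "slope (met X) f r"
  note sl0 = slope_nonneg[of L "met X" f, OF L f] and slL = slope_le[of L "met X" f, OF L f]
  have slm[measurable]: "?sl \<in> borel_measurable (meas X)" by (rule slope_measurable[OF X L f])
  have isl: "integrable (meas X) ?sl" "integrable (meas X) (\<lambda>x. (?sl x)\<^sup>2)"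
    using sl0 slL by (auto intro!: integrable_bounded[where B = L] integrable_bounded_square[where B = L])
  have 1: "vari (meas X) f \<le> c * (\<integral>x. (?sl x + \<eta>)\<^sup>2 \<partial>meas X)" if \<eta>: "0 < \<eta>" "\<eta> \<le> 1" for \<eta>
  proof (rule tendsto_lowerbound)
    let ?I = "\<integral>x. (?sl x + \<eta>)\<^sup>2 \<partial>meas X"
    let ?F = "\<lambda>\<epsilon>. c * (?I + 9 * ?K\<^sup>2 * \<epsilon>) + 4 * M * ((?K + 2 * M) * \<epsilon>)"
    show "(?F \<longlongrightarrow> c * ?I) (at_right 0)"
      by (auto intro!: tendsto_eq_intros)
    have "eventually (\<lambda>\<epsilon>. \<epsilon> < ?r * \<eta> / (40 * ?K)) (at_right 0)"
      using r \<eta> L by (intro order_tendstoD(2)[OF tendsto_ident_at]) auto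
    moreover have "eventually (\<lambda>\<epsilon>::real. \<epsilon> < 1) (at_right 0)"
      by (intro order_tendstoD(2)[OF tendsto_ident_at]) auto
    moreover have "eventually (\<lambda>\<epsilon>::real. 0 < \<epsilon>) (at_right 0)"
      by (simp add: eventually_at_right_less)
    ultimately show "eventually (\<lambda>\<epsilon>. vari (meas X) f \<le> ?F \<epsilon>) (at_right 0)"
    proof eventually_elim
      case (elim \<epsilon>)
      obtain Z :: "'b pm" where Z: "pm_space Z" "nonlocal_poincare c Z" "box_dist X Z < ennreal \<epsilon>"
        using approx[of "ennreal \<epsilon>"] elim by auto
      have "r / 2 > 0" using r by simp
      from vari_le_of_box_close[OF X Z(1,2) c Z(3) L f M \<eta> this refl less_imp_le[OF elim(1)] elim(2)]
      show ?case by simp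
    qed
  qed simp
  show ?thesis
  proof (rule tendsto_lowerbound)
    let ?I1 = "\<integral>x. ?sl x \<partial>meas X" and ?I2 = "\<integral>x. (?sl x)\<^sup>2 \<partial>meas X"
    show "((\<lambda>\<eta>. c * (?I2 + 2 * ?I1 * \<eta> + \<eta>\<^sup>2)) \<longlongrightarrow> c * ?I2) (at_right 0)"
      by (auto intro!: tendsto_eq_intros)
    have "eventually (\<lambda>\<eta>::real. \<eta> < 1) (at_right 0)"
      by (intro order_tendstoD(2)[OF tendsto_ident_at]) auto
    moreover have "eventually (\<lambda>\<eta>::real. 0 < \<eta>) (at_right 0)"
      by (simp add: eventually_at_right_less)
    ultimately show "eventually (\<lambda>\<eta>. vari (meas X) f \<le> c * (?I2 + 2 * ?I1 * \<eta> + \<eta>\<^sup>2)) (at_right 0)"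
    proof eventually_elim
      case (elim \<eta>)
      have "(\<integral>x. (?sl x + \<eta>)\<^sup>2 \<partial>meas X) = (\<integral>x. (?sl x)\<^sup>2 + 2 * \<eta> * ?sl x + \<eta>\<^sup>2 \<partial>meas X)"
        by (simp add: power2_sum algebra_simps)
      also have "\<dots> = ?I2 + 2 * ?I1 * \<eta> + \<eta>\<^sup>2"
        using isl by (simp add: prob_space)
      finally show ?case using 1[of \<eta>] elim by simp
    qed
  qed simp
qed

text \<open>Open and closed balls give the same limit: each open ball lies in the closed one of
  equal radius, which lies in every larger open ball. This also shows that the limit in
  \<open>lip_a\<close> exists.\<close>

lemma lip_a_tendsto:
  fixes m :: "'a metric"
  shows "((\<lambda>r. lip_const m f (mcball_of m x r)) \<longlongrightarrow> (INF r\<in>{0<..}. lip_const m f (mball_of m x r))) (at_right 0)"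
    (is "(?h \<longlongrightarrow> ?l) _")
proof (rule order_tendstoI)
  fix a assume a: "a < ?l"
  have "eventually (\<lambda>r::real. 0 < r) (at_right 0)" by (simp add: eventually_at_right_less)
  then show "eventually (\<lambda>r. a < ?h r) (at_right 0)"
  proof eventually_elim
    case (elim r)
    have "?l \<le> lip_const m f (mball_of m x r)" using elim by (intro INF_lower) auto
    also have "\<dots> \<le> ?h r" by (rule lip_const_mono) (auto simp: mem_mball_of mem_mcball_of)
    finally show ?case using a by simp
  qed
next
  fix a assume "?l < a"
  then obtain q where q: "0 < q" "lip_const m f (mball_of m x q) < a"
    by (auto simp: INF_less_iff)
  have "eventually (\<lambda>r::real. r < q) (at_right 0)"
    using q by (intro order_tendstoD(2)[OF tendsto_ident_at]) auto
  then show "eventually (\<lambda>r. ?h r < a) (at_right 0)"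
  proof eventually_elim
    case (elim r)
    have "?h r \<le> lip_const m f (mball_of m x q)"
      using elim by (intro lip_const_mono) (auto simp: mem_mball_of mem_mcball_of)
    with q show ?case by simp
  qed
qed

lemma lip_a_eq_INF: "lip_a m f x = (INF r\<in>{0<..}. lip_const m f (mball_of m x r))"
  unfolding lip_a_def by (rule tendsto_Lim[OF _ lip_a_tendsto]) simp

lemma lip_a_le: "0 < r \<Longrightarrow> lip_a m f x \<le> lip_const m f (mball_of m x r)"
  unfolding lip_a_eq_INF by (intro INF_lower) auto

text \<open>Use \<open>vari_le_slope\<close> at the radii 1 / (n + 1). The slopes decrease pointwise
  to \<open>lip_a\<close>, and their squares can be integrated to the limit.\<close>

lemma C22_le:
  fixes X :: "'a pm"
  assumes X: "pm_space X" and C: "0 \<le> C"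
    and approx: "\<And>\<epsilon>. 0 < \<epsilon> \<Longrightarrow> \<exists>Z :: 'b pm. pm_space Z \<and> nonlocal_poincare (C\<^sup>2) Z \<and> box_dist X Z < \<epsilon>"
  shows "C22 X \<le> ennreal C"
  unfolding C22_def
proof (rule Inf_lower, rule CollectI, intro exI conjI allI impI)
  interpret prob_space "meas X" by (rule pm_space_props[OF X])
  show "0 \<le> C" by fact
  fix f :: "'a \<Rightarrow> real"
  assume "Lipschitz_continuous_map (met X) euclidean_metric f \<and> bounded (f ` mspace (met X))"
  then have "Lipschitz_continuous_map (met X) euclidean_metric f" "bounded (f ` mspace (met X))"
    by auto
  then obtain L0 M
    where L0: "\<forall>x\<in>mspace (met X). \<forall>y\<in>mspace (met X). \<bar>f x - f y\<bar> \<le> L0 * mdist (met X) x y"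
      and "\<forall>x\<in>mspace (met X). \<bar>f x\<bar> \<le> M"
    unfolding Lipschitz_continuous_map_def bounded_iff by (auto simp: dist_real_def)
  then have M: "\<And>x. x \<in> mspace (met X) \<Longrightarrow> \<bar>f x\<bar> \<le> M"
    by blast
  define L where "L = max L0 0"
  have L: "0 \<le> L" by (simp add: L_def)
  have f: "\<bar>f x - f y\<bar> \<le> L * mdist (met X) x y" if "x \<in> mspace (met X)" "y \<in> mspace (met X)" for x y
  proof -
    have "L0 * mdist (met X) x y \<le> L * mdist (met X) x y"
      by (intro mult_right_mono) (auto simp: L_def)
    with L0 that show ?thesis by fastforce
  qed
  let ?m = "met X"
  note sl0 = slope_nonneg[of L ?m f, OF L f] and slL = slope_le[of L ?m f, OF L f]
  have fm: "f \<in> borel_measurable (meas X)" by (rule pm_lipschitz_measurable[OF X f L])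
  have slm[measurable]: "slope ?m f r \<in> borel_measurable (meas X)" for r by (rule slope_measurable[OF X L f])
  have "integrable (meas X) f" "integrable (meas X) (\<lambda>x. (f x)\<^sup>2)"
    using fm M pm_space_props[OF X] by (auto intro!: integrable_bounded integrable_bounded_square)
  from half_double_integral_eq_vari[OF fm this]
  have "ennreal (1/2) * (\<integral>\<^sup>+ (x, y). ennreal ((f x - f y)\<^sup>2) \<partial>(meas X \<Otimes>\<^sub>M meas X)) = ennreal (vari (meas X) f)" .
  also have "\<dots> \<le> ennreal (C\<^sup>2) * (\<integral>\<^sup>+ x. (lip_a ?m f x)\<^sup>2 \<partial>meas X)"
  proof -
    define h where "h n x = ennreal ((slope ?m f (1 / (real n + 1)) x)\<^sup>2)" for n x
    have es: "ennreal (slope ?m f r x) = lip_const ?m f (mball_of ?m x r)" for r x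
      by (rule ennreal_slope[OF L f])
    have hdec: "decseq (\<lambda>n. slope ?m f (1 / (real n + 1)) x)" for x
    proof (rule antimonoI)
      fix i j :: nat assume "i \<le> j"
      then have "1 / (real j + 1) \<le> 1 / (real i + 1)" by (simp add: field_simps)
      then show "slope ?m f (1 / (real j + 1)) x \<le> slope ?m f (1 / (real i + 1)) x"
        by (intro slope_mono[OF L f]) (auto simp: mem_mball_of)
    qed
    have hd: "decseq h"
    proof (intro antimonoI le_funI)
      fix i j :: nat and x assume "i \<le> j"
      from decseqD[OF hdec this] show "h j x \<le> h i x"
        unfolding h_def by (intro ennreal_leI power_mono sl0)
    qed
    have lim: "(\<lambda>n. h n x) \<longlonglongrightarrow> (lip_a ?m f x)\<^sup>2" for x
    proof -
      have "(\<lambda>n. ennreal (slope ?m f (1 / (real n + 1)) x)) \<longlonglongrightarrow> lip_a ?m f x"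
      proof -
        have "lip_a ?m f x = (INF n. ennreal (slope ?m f (1 / (real n + 1)) x))"
          unfolding es
        proof (rule antisym)
          show "lip_a ?m f x \<le> (INF n. lip_const ?m f (mball_of ?m x (1 / (real n + 1))))"
            by (intro INF_greatest lip_a_le) simp
          show "(INF n. lip_const ?m f (mball_of ?m x (1 / (real n + 1)))) \<le> lip_a ?m f x"
            unfolding lip_a_eq_INF
          proof (rule INF_greatest)
            fix r :: real assume "r \<in> {0<..}"
            then obtain n where n: "1 / (real n + 1) < r"
              using nat_approx_posE[of r] by (auto simp: add.commute)
            have "(INF n. lip_const ?m f (mball_of ?m x (1 / (real n + 1)))) \<le> lip_const ?m f (mball_of ?m x (1 / (real n + 1)))"
              by (rule INF_lower) simp
            also have "\<dots> \<le> lip_const ?m f (mball_of ?m x r)"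
              using n by (intro lip_const_mono) (auto simp: mem_mball_of)
            finally show "(INF n. lip_const ?m f (mball_of ?m x (1 / (real n + 1)))) \<le> lip_const ?m f (mball_of ?m x r)" .
          qed
        qed
        moreover have "decseq (\<lambda>n. ennreal (slope ?m f (1 / (real n + 1)) x))"
          using hdec[of x] unfolding antimono_def by (auto intro: ennreal_leI)
        ultimately show ?thesis by (simp add: LIMSEQ_INF)
      qed
      from tendsto_mult_ennreal[OF this this] show ?thesis
        by (auto simp: h_def power2_eq_square ennreal_mult sl0)
    qed
    have "(\<integral>\<^sup>+ x. (lip_a ?m f x)\<^sup>2 \<partial>meas X) = (\<integral>\<^sup>+ x. (INF n. h n x) \<partial>meas X)"
    proof (rule nn_integral_cong)
      fix x
      have "decseq (\<lambda>n. h n x)"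
        by (intro antimonoI le_funD[OF decseqD[OF hd]])
      from LIMSEQ_unique[OF lim LIMSEQ_INF[OF this]] show "(lip_a ?m f x)\<^sup>2 = (INF n. h n x)" .
    qed
    \<comment> \<open>For a decreasing sequence one finite integral is required; the slopes are at
      most \<open>L\<close> and the total mass is 1.\<close>
    also have "\<dots> = (INF n. \<integral>\<^sup>+ x. h n x \<partial>meas X)"
    proof (rule nn_integral_monotone_convergence_INF_decseq)
      show "decseq h" by (rule hd)
      show "h n \<in> borel_measurable (meas X)" for n unfolding h_def by measurable
      have "(\<integral>\<^sup>+ x. h 0 x \<partial>meas X) \<le> (\<integral>\<^sup>+ x. ennreal (L\<^sup>2) \<partial>meas X)"
        unfolding h_def using sl0 slL by (intro nn_integral_mono ennreal_leI power_mono) auto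
      also have "\<dots> < \<infinity>" by (simp add: emeasure_space_1)
      finally show "(\<integral>\<^sup>+ x. h 0 x \<partial>meas X) < \<infinity>" .
    qed
    finally have INF: "(\<integral>\<^sup>+ x. (lip_a ?m f x)\<^sup>2 \<partial>meas X) = (INF n. \<integral>\<^sup>+ x. h n x \<partial>meas X)" .
    have "ennreal (vari (meas X) f) \<le> ennreal (C\<^sup>2) * (\<integral>\<^sup>+ x. h n x \<partial>meas X)" for n
    proof -
      let ?r = "1 / (real n + 1)"
      have "vari (meas X) f \<le> C\<^sup>2 * (\<integral>x. (slope ?m f ?r x)\<^sup>2 \<partial>meas X)"
        by (rule vari_le_slope[OF X _ approx L f M]) auto
      then have "ennreal (vari (meas X) f) \<le> ennreal (C\<^sup>2) * ennreal (\<integral>x. (slope ?m f ?r x)\<^sup>2 \<partial>meas X)"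
        by (simp add: ennreal_mult'[symmetric] ennreal_leI)
      also have "ennreal (\<integral>x. (slope ?m f ?r x)\<^sup>2 \<partial>meas X) = (\<integral>\<^sup>+ x. h n x \<partial>meas X)"
        unfolding h_def using sl0 slL
        by (intro nn_integral_eq_integral[symmetric] integrable_bounded_square[where B = L]) auto
      finally show ?thesis .
    qed
    moreover have "(\<lambda>n. ennreal (C\<^sup>2) * (\<integral>\<^sup>+ x. h n x \<partial>meas X))
        \<longlonglongrightarrow> ennreal (C\<^sup>2) * (\<integral>\<^sup>+ x. (lip_a ?m f x)\<^sup>2 \<partial>meas X)"
      unfolding INF
    proof (intro ennreal_tendsto_cmult LIMSEQ_INF antimonoI nn_integral_mono)
      show "h j x \<le> h i x" if "i \<le> j" for i j x
        using decseqD[OF hd that] by (rule le_funD)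
    qed simp
    ultimately show ?thesis
      by (intro LIMSEQ_le_const) auto
  qed
  finally show "ennreal (1/2) * (\<integral>\<^sup>+ (x, y). ennreal ((f x - f y)\<^sup>2) \<partial>(meas X \<Otimes>\<^sub>M meas X))
      \<le> ennreal (C\<^sup>2) * (\<integral>\<^sup>+ x. (lip_a ?m f x)\<^sup>2 \<partial>meas X)" .
qed simp

text \<open>The approximants \<open>Z\<close> come from the definition of the closure. Their powers
  \<open>n\<close> may grow without control as \<open>Z\<close> approaches \<open>Y\<close>, since
  the constant is independent of \<open>n\<close>.\<close>

lemma C22_pyramid_l2_infinity_le:
  fixes X :: "real pm" and \<pi> :: "real \<Rightarrow> real"
  assumes "prob_space \<mu>" "sets \<mu> = sets borel" "poincare_line (C\<^sup>2) \<mu>" and C: "0 \<le> C"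
    and "pm_space X" "\<pi> \<in> measurable \<mu> (meas X)" "distr \<mu> (meas X) \<pi> = meas X"
    and "\<And>s t. mdist (met X) (\<pi> s) (\<pi> t) \<le> \<bar>s - t\<bar>"
    and "(\<lambda>x. x) \<in> measurable (meas X) borel" "\<And>x. x \<in> mspace (met X) \<Longrightarrow> \<pi> x = x"
  shows "C22_pyramid (l2_infinity X) \<le> ennreal C"
  unfolding C22_pyramid_def
proof (rule SUP_least)
  fix Y assume "Y \<in> l2_infinity X"
  then have Y: "pm_space Y"
    and appr: "\<And>\<epsilon>. 0 < \<epsilon> \<Longrightarrow> \<exists>Z\<in>(\<Union>n\<in>{1..}. lip_below (l2_power n X)). box_dist Y Z < \<epsilon>"
    by (auto simp: l2_infinity_def box_closure_def pm_classes_def)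
  show "C22 Y \<le> ennreal C"
  proof (rule C22_le[OF Y C])
    fix \<epsilon> :: ennreal assume "0 < \<epsilon>"
    from appr[OF this] obtain n Z where Z: "Z \<in> lip_below (l2_power n X)" "box_dist Y Z < \<epsilon>"
      by blast
    then have "pm_space Z" "Z \<prec>\<^sub>L l2_power n X"
      by (auto simp: lip_below_def pm_classes_def)
    with nonlocal_poincare_lip_le[OF assms(1-3) _ assms(5-10)] Z
    show "\<exists>Z :: real pm. pm_space Z \<and> nonlocal_poincare (C\<^sup>2) Z \<and> box_dist Y Z < \<epsilon>"
      by (intro exI[of _ Z]) auto
  qed
qed

section \<open>Lower bounds\<close>

lemma lip_le_l2_power_1:
  assumes X: "pm_space X"
  shows "X \<prec>\<^sub>L l2_power 1 X"
  unfolding lip_le_def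
proof (intro bexI[of _ "\<lambda>x. x 0"] conjI ballI)
  fix x y
  have "l2_dist 1 (met X) x y = mdist (met X) (x 0) (y 0)"
    by (simp add: l2_dist_def L2_set_def)
  then show "mdist (met X) (x 0) (y 0) \<le> mdist (met (l2_power 1 X)) x y"
    by (simp add: l2_power_def)
next
  show "distr (meas (l2_power 1 X)) (meas X) (\<lambda>x. x 0) = meas X"
    using distr_PiM_component[of "{..<1::nat}" "\<lambda>_. meas X" 0] pm_space_props(2)[OF X]
    by (simp add: l2_power_def)
qed (auto simp: l2_power_def)

text \<open>A parameter is assumed because otherwise the infimum in \<open>box_dist\<close> would be
  over the empty set, hence infinite.\<close>

lemma box_dist_self_less:
  assumes a: "parameter X a" and \<epsilon>: "0 < \<epsilon>"
  shows "box_dist X X < \<epsilon>"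
proof -
  interpret U: prob_space unit_leb
    using pm_space_unit_interval by (simp add: pm_space_def unit_interval_def)
  obtain q where q: "0 < q" "q < \<epsilon>" using dense[OF \<epsilon>] by blast
  then obtain e where e: "q = ennreal e" "0 < e"
    by (cases q) (auto simp: ennreal_less_zero_iff)
  have "\<exists>a b I\<^sub>0. parameter X a \<and> parameter X b \<and> I\<^sub>0 \<in> sets unit_leb \<and> 1 - e \<le> measure unit_leb I\<^sub>0 \<and>
        (\<forall>s \<in> I\<^sub>0. \<forall>t \<in> I\<^sub>0. \<bar>mdist (met X) (a s) (a t) - mdist (met X) (b s) (b t)\<bar> \<le> e)"
    using a e U.prob_space by (intro exI[of _ a] exI[of _ "space unit_leb"]) auto
  then have "box_dist X X \<le> ennreal e"
    unfolding box_dist_def using e by (intro Inf_lower) auto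
  then show ?thesis using q e by simp
qed

lemma self_in_l2_infinity:
  assumes X: "X \<in> pm_classes" and a: "parameter X a"
  shows "X \<in> l2_infinity X"
  unfolding l2_infinity_def box_closure_def
proof (intro CollectI conjI X allI impI)
  fix \<epsilon> :: ennreal assume "0 < \<epsilon>"
  moreover have "X \<in> lip_below (l2_power 1 X)"
    using X lip_le_l2_power_1[of X] by (simp add: lip_below_def pm_classes_def)
  ultimately show "\<exists>Z\<in>(\<Union>n\<in>{1..}. lip_below (l2_power n X)). box_dist X Z < \<epsilon>"
    using box_dist_self_less[OF a] by (intro bexI[of _ X]) auto
qed

text \<open>The density is positive everywhere, so an open set that is null for the Gauss measure is
  Lebesgue null and cannot contain an interval.\<close>

lemma gauss_line_pm_classes: "gauss_line \<in> pm_classes"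
proof -
  have "0 < emeasure (meas gauss_line) U" if U: "open U" "x \<in> U" for x U
  proof (rule ccontr)
    assume "\<not> 0 < emeasure (meas gauss_line) U"
    then have "emeasure (density lborel (\<lambda>x. ennreal (std_normal_density x))) U = 0"
      by (simp add: gauss_line_def)
    then have "AE x in lborel. ennreal (std_normal_density x) * indicator U x = 0"
      using U by (simp add: emeasure_density nn_integral_0_iff_AE)
    moreover have "\<not> std_normal_density x \<le> 0" for x
      by (simp add: not_le normal_density_pos)
    ultimately have "AE x in lborel. x \<notin> U"
      by (auto simp: indicator_def ennreal_eq_0_iff split: if_splits)
    then have U0: "emeasure lborel U = 0"
      using U by (subst (asm) AE_iff_measurable[OF _ refl]) auto
    obtain e where e: "0 < e" "\<And>y. dist y x < e \<Longrightarrow> y \<in> U"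
      using U unfolding open_dist by blast
    have "emeasure lborel {x - e<..<x + e} \<le> emeasure lborel U"
      using U e(2) by (intro emeasure_mono) (auto simp: dist_real_def abs_less_iff)
    then show False using U0 e(1) by simp
  qed
  then show ?thesis
    using pm_space_gauss_line by (auto simp: pm_classes_def pm_support_def gauss_line_def)
qed

lemma unit_interval_pm_classes: "unit_interval \<in> pm_classes"
proof -
  have "0 < emeasure unit_leb U" if U: "openin (top_of_set {0..1}) U" "x \<in> U" for x U
  proof -
    obtain V where V: "open V" "U = {0..1} \<inter> V" using U(1) by (auto simp: openin_open)
    then obtain e where e: "0 < e" "\<And>y. dist y x < e \<Longrightarrow> y \<in> V"
      using U(2) unfolding open_dist by blast
    \<comment> \<open>Cutting at 0 and 1 leaves a nonempty open interval, even when x is an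
      endpoint.\<close>
    let ?l = "max 0 (x - e)" and ?u = "min 1 (x + e)"
    have x: "0 \<le> x" "x \<le> 1" using U(2) V by auto
    have "0 < emeasure lborel {?l<..<?u}" using x e by simp
    also have "\<dots> \<le> emeasure lborel U"
    proof (rule emeasure_mono)
      show "{?l<..<?u} \<subseteq> U" using e(2) by (auto simp: V dist_real_def)
    qed (use V in auto)
    also have "\<dots> = emeasure unit_leb U"
      using V by (simp add: unit_leb_def emeasure_restrict_space)
    finally show ?thesis .
  qed
  then show ?thesis
    using pm_space_unit_interval
    by (auto simp: pm_classes_def pm_support_def unit_interval_def mtopology_of_submetric)
qed

lemma parameter_unit_interval: "parameter unit_interval (\<lambda>x. x)"
  by (simp add: parameter_def unit_interval_def distr_id)

text \<open>The parameter is the quantile function \<open>M.I\<close>, the generalised inverse of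
  the distribution function. It is given on the open unit interval; the value 0 at the two endpoints
  affects a null set only.\<close>

lemma parameter_real_distribution:
  assumes M: "real_distribution (meas X)" "sets (meas X) = sets borel"
  shows "\<exists>a. parameter X a"
proof -
  interpret M: cdf_distribution "meas X"
    using M unfolding cdf_distribution_def by simp
  define a where "a s = (if s \<in> {0<..<1} then M.I s else 0)" for s :: real
  have a[measurable]: "a \<in> borel_measurable borel"
    using M.measurable_CI unfolding a_def by (subst (asm) measurable_restrict_space_iff[where c = 0]) auto
  have am: "a \<in> measurable unit_leb (meas X)"
    using M(2) unfolding unit_leb_def by (simp cong: measurable_cong_sets add: measurable_restrict_space1)
  have "distr unit_leb (meas X) a = distr (restrict_space lborel {0<..<1}) borel M.I"
  proof (rule measure_eqI)
    fix A assume "A \<in> sets (distr unit_leb (meas X) a)"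
    then have A[measurable]: "A \<in> sets borel" using M(2) by simp
    have "emeasure (distr unit_leb (meas X) a) A = emeasure unit_leb (a -` A \<inter> {0..1})"
      using A M(2) am by (subst emeasure_distr) (auto simp: unit_leb_def space_restrict_space)
    also have "\<dots> = emeasure lborel (a -` A \<inter> {0..1})"
      unfolding unit_leb_def by (subst emeasure_restrict_space) auto
    also have "\<dots> = emeasure lborel (a -` A \<inter> {0<..<1})"
    proof (rule emeasure_eq_AE)
      show "AE x in lborel. (x \<in> a -` A \<inter> {0..1}) = (x \<in> a -` A \<inter> {0<..<1})"
        using AE_lborel_singleton[of 0] AE_lborel_singleton[of 1] by eventually_elim auto
    qed (use measurable_sets[OF a A] in auto)
    also have "a -` A \<inter> {0<..<1} = M.I -` A \<inter> {0<..<1}" by (auto simp: a_def)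
    also have "emeasure lborel (M.I -` A \<inter> {0<..<1}) = emeasure (restrict_space lborel {0<..<1}) (M.I -` A \<inter> {0<..<1})"
      by (subst emeasure_restrict_space) auto
    also have "\<dots> = emeasure (distr (restrict_space lborel {0<..<1}) borel M.I) A"
      using A M.measurable_CI
      by (subst emeasure_distr) (auto simp: space_restrict_space cong: measurable_cong_sets)
    finally show "emeasure (distr unit_leb (meas X) a) A = emeasure (distr (restrict_space lborel {0<..<1}) borel M.I) A" .
  qed (simp add: M(2))
  also have "\<dots> = meas X" by (rule M.distr_I_eq_M)
  finally show ?thesis using am by (auto simp: parameter_def)
qed

lemma parameter_gauss_line: "\<exists>a. parameter gauss_line a"
proof (rule parameter_real_distribution)
  interpret prob_space "meas gauss_line"
    using pm_space_gauss_line by (rule pm_space_props)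
  show "real_distribution (meas gauss_line)"
    by unfold_locales (simp_all add: gauss_line_def)
qed (simp add: gauss_line_def)

text \<open>The extremal function x is unbounded and so not admissible. Its truncations to [-k, k]
  have local Lipschitz constant at most 1, and their variances tend to 1 by dominated
  convergence.\<close>

lemma C22_gauss_line_ge: "1 \<le> C22 gauss_line"
  unfolding C22_def
proof (rule Inf_greatest)
  let ?G = "density lborel (\<lambda>x. ennreal (std_normal_density x))"
  fix z assume "z \<in> {ennreal C | C. 0 \<le> C \<and>
     (\<forall>f. Lipschitz_continuous_map (met gauss_line) euclidean_metric f \<and> bounded (f ` mspace (met gauss_line)) \<longrightarrow>
        ennreal (1/2) * (\<integral>\<^sup>+ (x, y). ennreal ((f x - f y)\<^sup>2) \<partial>(meas gauss_line \<Otimes>\<^sub>M meas gauss_line))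
          \<le> ennreal (C\<^sup>2) * (\<integral>\<^sup>+ x. (lip_a (met gauss_line) f x)\<^sup>2 \<partial>meas gauss_line))}"
  then obtain C where z: "z = ennreal C" and C: "0 \<le> C"
    and P: "\<And>f. Lipschitz_continuous_map euclidean_metric euclidean_metric f \<Longrightarrow> bounded (range f) \<Longrightarrow>
        ennreal (1/2) * (\<integral>\<^sup>+ (x, y). ennreal ((f x - f y)\<^sup>2) \<partial>(?G \<Otimes>\<^sub>M ?G))
          \<le> ennreal (C\<^sup>2) * (\<integral>\<^sup>+ x. (lip_a euclidean_metric f x)\<^sup>2 \<partial>?G)"
    by (auto simp: gauss_line_def)
  interpret prob_space ?G by (simp add: prob_space_normal_density)
  define f where "f k x = max (- real k) (min (real k) x)" for k x
  have flip: "\<bar>f k x - f k y\<bar> \<le> \<bar>x - y\<bar>" for k x y by (auto simp: f_def)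
  have fb: "\<bar>f k x\<bar> \<le> k" for k x by (auto simp: f_def)
  have fx: "\<bar>f k x\<bar> \<le> \<bar>x\<bar>" for k x by (auto simp: f_def)
  have [measurable]: "f k \<in> borel_measurable borel" for k unfolding f_def by measurable
  have vk: "vari ?G (f k) \<le> C\<^sup>2" for k
  proof -
    have "ennreal (vari ?G (f k)) = ennreal (1/2) * (\<integral>\<^sup>+ (x, y). ennreal ((f k x - f k y)\<^sup>2) \<partial>(?G \<Otimes>\<^sub>M ?G))"
      using fb by (intro half_double_integral_eq_vari[symmetric]) (auto intro!: integrable_bounded integrable_bounded_square)
    also have "\<dots> \<le> ennreal (C\<^sup>2) * (\<integral>\<^sup>+ x. (lip_a euclidean_metric (f k) x)\<^sup>2 \<partial>?G)"
    proof (rule P)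
      show "Lipschitz_continuous_map euclidean_metric euclidean_metric (f k)"
        unfolding Lipschitz_continuous_map_def using flip by (auto simp: dist_real_def intro!: exI[of _ 1])
      show "bounded (range (f k))" using fb unfolding bounded_iff by auto
    qed
    also have "\<dots> \<le> ennreal (C\<^sup>2) * (\<integral>\<^sup>+ x. 1 \<partial>?G)"
    proof (intro mult_left_mono nn_integral_mono)
      fix x
      have "lip_a euclidean_metric (f k) x \<le> lip_const euclidean_metric (f k) (mball_of euclidean_metric x 1)"
        by (rule lip_a_le) simp
      also have "\<dots> \<le> ennreal 1"
        using flip by (subst lip_const_le_iff) (auto simp: dist_real_def)
      finally have "(lip_a euclidean_metric (f k) x)\<^sup>2 \<le> 1\<^sup>2"
        by (intro power_mono) auto
      then show "(lip_a euclidean_metric (f k) x)\<^sup>2 \<le> 1" by simp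
    qed simp
    also have "\<dots> = ennreal (C\<^sup>2)" using emeasure_space_1 by simp
    finally show ?thesis by (simp add: ennreal_le_iff)
  qed
  have i1: "integrable ?G (\<lambda>x. \<bar>x\<bar>)"
    using integrable_std_normal_moment_abs[of 1] by (subst integrable_density) (auto simp: normal_density_nonneg)
  have i2: "integrable ?G (\<lambda>x. x\<^sup>2)"
    using integrable_std_normal_moment[of 2] by (subst integrable_density) (auto simp: normal_density_nonneg)
  have m1: "(\<integral>x. x \<partial>?G) = 0"
    using integral_std_normal_moment_odd[of 0] by (subst integral_density) (auto simp: normal_density_nonneg)
  have m2: "(\<integral>x. x\<^sup>2 \<partial>?G) = 1"
    using integral_std_normal_moment_even[of 1] by (subst integral_density) (auto simp: normal_density_nonneg)
  have conv: "(\<lambda>k. f k x) \<longlonglongrightarrow> x" for x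
  proof (rule tendsto_eventually)
    obtain N where N: "\<bar>x\<bar> \<le> real N" using real_arch_simple by blast
    show "eventually (\<lambda>k. f k x = x) sequentially"
      using eventually_ge_at_top[of N]
    proof eventually_elim
      case (elim k)
      then have "\<bar>x\<bar> \<le> real k" using N by linarith
      then show ?case by (auto simp: f_def)
    qed
  qed
  have "(\<lambda>k. vari ?G (f k)) \<longlonglongrightarrow> 1 - 0\<^sup>2"
    unfolding vari_def
  proof (intro tendsto_diff tendsto_power)
    have "(\<lambda>k. \<integral>x. (f k x)\<^sup>2 \<partial>?G) \<longlonglongrightarrow> (\<integral>x. x\<^sup>2 \<partial>?G)"
    proof (rule integral_dominated_convergence[OF _ _ i2])
      show "AE x in ?G. (\<lambda>k. (f k x)\<^sup>2) \<longlonglongrightarrow> x\<^sup>2"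
        using tendsto_power[OF conv, where n = 2] by simp
      show "AE x in ?G. norm ((f k x)\<^sup>2) \<le> x\<^sup>2" for k
        using fx[of k] by (auto simp: abs_le_square_iff)
    qed auto
    then show "(\<lambda>k. \<integral>x. (f k x)\<^sup>2 \<partial>?G) \<longlonglongrightarrow> 1" by (simp add: m2)
    have "(\<lambda>k. \<integral>x. f k x \<partial>?G) \<longlonglongrightarrow> (\<integral>x. x \<partial>?G)"
      by (rule integral_dominated_convergence[OF _ _ i1]) (use conv fx in auto)
    then show "(\<lambda>k. \<integral>x. f k x \<partial>?G) \<longlonglongrightarrow> 0" by (simp add: m1)
  qed
  then have "1 - 0\<^sup>2 \<le> C\<^sup>2"
    by (rule LIMSEQ_le_const2) (use vk in auto)
  then have "1\<^sup>2 \<le> C\<^sup>2" by simp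
  then have "1 \<le> C" using C by (rule power2_le_imp_le)
  then show "1 \<le> z" unfolding z by (simp add: ennreal_leI flip: ennreal_1)
qed

lemma integral_unit_leb_FTC:
  fixes F f :: "real \<Rightarrow> real"
  assumes "\<And>x. (F has_real_derivative f x) (at x)" "\<And>x. isCont f x"
  shows "(\<integral>x. f x \<partial>unit_leb) = F 1 - F 0"
proof -
  have "(\<integral>x. f x \<partial>unit_leb) = (\<integral>x. f x * indicator {0..1} x \<partial>lborel)"
    unfolding unit_leb_def by (subst integral_restrict_space) (auto simp: mult.commute)
  also have "\<dots> = F 1 - F 0"
    by (rule integral_FTC_Icc_real) (use assms in auto)
  finally show ?thesis .
qed

lemma lip_a_cos_pi_le:
  assumes x: "x \<in> {0..1}"
  shows "lip_a (submetric euclidean_metric {0..1}) (\<lambda>x. cos (pi * x)) x \<le> ennreal (pi * \<bar>sin (pi * x)\<bar>)"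
proof (rule ennreal_le_epsilon)
  let ?m = "submetric (euclidean_metric :: real metric) {0..1}"
  fix e :: real assume e: "0 < e"
  \<comment> \<open>On a ball of this radius the derivative of cos(pi x) changes in absolute value
    by at most pi pi r = e.\<close>
  define r where "r = e / (pi * pi)"
  have r: "0 < r" using e by (simp add: r_def)
  let ?B = "pi * \<bar>sin (pi * x)\<bar> + e"
  have B: "0 \<le> ?B" using e by simp
  have "lip_a ?m (\<lambda>x. cos (pi * x)) x \<le> lip_const ?m (\<lambda>x. cos (pi * x)) (mball_of ?m x r)"
    by (rule lip_a_le[OF r])
  also have "\<dots> \<le> ennreal ?B"
  proof (subst lip_const_le_iff[OF mball_of_subset B], intro ballI)
    fix y z assume "y \<in> mball_of ?m x r" "z \<in> mball_of ?m x r"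
    then have yz: "y \<in> ball x r" "z \<in> ball x r"
      by (auto simp: mem_mball_of)
    have "norm (cos (pi * y) - cos (pi * z)) \<le> ?B * norm (y - z)"
    proof (rule field_differentiable_bound[OF convex_ball _ _ yz])
      fix w assume w: "w \<in> ball x r"
      show "((\<lambda>x. cos (pi * x)) has_field_derivative (- sin (pi * w) * pi)) (at w within ball x r)"
        by (auto intro!: derivative_eq_intros)
      have "norm (sin (pi * w) - sin (pi * x)) \<le> 1 * norm (pi * w - pi * x)"
        by (rule field_differentiable_bound[of UNIV sin cos]) (auto intro!: derivative_eq_intros)
      also have "\<dots> = pi * \<bar>w - x\<bar>"
        by (simp add: abs_mult flip: right_diff_distrib)
      also have "\<dots> \<le> pi * r" using w by (intro mult_left_mono) (auto simp: dist_real_def abs_minus_commute)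
      finally have "\<bar>sin (pi * w)\<bar> \<le> \<bar>sin (pi * x)\<bar> + pi * r" by simp
      then have "pi * \<bar>sin (pi * w)\<bar> \<le> pi * (\<bar>sin (pi * x)\<bar> + pi * r)" by simp
      also have "\<dots> = ?B" by (simp add: r_def distrib_left)
      finally show "norm (- sin (pi * w) * pi) \<le> ?B" by (simp add: abs_mult mult.commute)
    qed
    then show "\<bar>cos (pi * y) - cos (pi * z)\<bar> \<le> ?B * mdist ?m y z"
      by (simp add: dist_real_def)
  qed
  also have "\<dots> = ennreal (pi * \<bar>sin (pi * x)\<bar>) + ennreal e"
    using e by (simp add: ennreal_plus)
  finally show "lip_a ?m (\<lambda>x. cos (pi * x)) x \<le> ennreal (pi * \<bar>sin (pi * x)\<bar>) + ennreal e" .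
qed

text \<open>The eigenfunction cos(pi x) has variance 1/2 and energy at most pi^2 / 2, so any
  admissible C satisfies C pi \<ge> 1.\<close>

lemma C22_unit_interval_ge: "ennreal (1 / pi) \<le> C22 unit_interval"
  unfolding C22_def
proof (rule Inf_greatest)
  let ?m = "submetric (euclidean_metric :: real metric) {0..1}"
  interpret prob_space unit_leb
    using pm_space_unit_interval by (simp add: pm_space_def unit_interval_def)
  fix z assume "z \<in> {ennreal C | C. 0 \<le> C \<and>
     (\<forall>f. Lipschitz_continuous_map (met unit_interval) euclidean_metric f \<and> bounded (f ` mspace (met unit_interval)) \<longrightarrow>
        ennreal (1/2) * (\<integral>\<^sup>+ (x, y). ennreal ((f x - f y)\<^sup>2) \<partial>(meas unit_interval \<Otimes>\<^sub>M meas unit_interval))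
          \<le> ennreal (C\<^sup>2) * (\<integral>\<^sup>+ x. (lip_a (met unit_interval) f x)\<^sup>2 \<partial>meas unit_interval))}"
  then obtain C where z: "z = ennreal C" and C: "0 \<le> C"
    and P: "\<And>f. Lipschitz_continuous_map ?m euclidean_metric f \<Longrightarrow> bounded (f ` {0..1}) \<Longrightarrow>
        ennreal (1/2) * (\<integral>\<^sup>+ (x, y). ennreal ((f x - f y)\<^sup>2) \<partial>(unit_leb \<Otimes>\<^sub>M unit_leb))
          \<le> ennreal (C\<^sup>2) * (\<integral>\<^sup>+ x. (lip_a ?m f x)\<^sup>2 \<partial>unit_leb)"
    by (auto simp: unit_interval_def)
  define f where "f x = cos (pi * x)" for x
  have meas: "g \<in> borel_measurable borel \<Longrightarrow> g \<in> borel_measurable unit_leb" for g :: "real \<Rightarrow> real"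
    unfolding unit_leb_def by (simp add: measurable_restrict_space1)
  have fm: "f \<in> borel_measurable unit_leb" unfolding f_def by (rule meas) measurable
  have sm: "(\<lambda>x. pi * \<bar>sin (pi * x)\<bar>) \<in> borel_measurable unit_leb" by (rule meas) measurable
  have sb: "\<bar>pi * \<bar>sin (pi * x)\<bar>\<bar> \<le> pi" for x by (simp add: abs_mult)
  have if1: "integrable unit_leb f"
    by (rule integrable_bounded[OF fm, where B = 1]) (simp add: f_def)
  have if2: "integrable unit_leb (\<lambda>x. (f x)\<^sup>2)"
    by (rule integrable_bounded_square[OF fm, where B = 1]) (simp add: f_def)
  have sin2: "sin (2 * pi * t) = 2 * sin (pi * t) * cos (pi * t)" for t
    using sin_double[of "pi * t"] by (simp add: mult.assoc)
  have cos2: "cos (2 * pi * t) = 2 * (cos (pi * t))\<^sup>2 - 1" "cos (2 * pi * t) = 1 - 2 * (sin (pi * t))\<^sup>2" for t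
    using cos_double_cos[of "pi * t"] cos_double_sin[of "pi * t"] by (simp_all add: mult.assoc)
  have I1: "(\<integral>x. f x \<partial>unit_leb) = 0"
  proof -
    have "(\<integral>x. f x \<partial>unit_leb) = sin (pi * 1) / pi - sin (pi * 0) / pi"
      unfolding f_def by (rule integral_unit_leb_FTC[of "\<lambda>x. sin (pi * x) / pi"]) (auto intro!: derivative_eq_intros)
    then show ?thesis by simp
  qed
  have I2: "(\<integral>x. (f x)\<^sup>2 \<partial>unit_leb) = 1 / 2"
  proof -
    have "(\<integral>x. (f x)\<^sup>2 \<partial>unit_leb) = (1 / 2 + sin (2 * pi * 1) / (4 * pi)) - (0 / 2 + sin (2 * pi * 0) / (4 * pi))"
      unfolding f_def
    proof (rule integral_unit_leb_FTC[of "\<lambda>x. x / 2 + sin (2 * pi * x) / (4 * pi)"])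
      show "((\<lambda>x. x / 2 + sin (2 * pi * x) / (4 * pi)) has_real_derivative (cos (pi * x))\<^sup>2) (at x)" for x
        by (auto intro!: derivative_eq_intros simp: cos2(1)) (simp add: field_simps)
    qed auto
    then show ?thesis by simp
  qed
  have I3: "(\<integral>x. (pi * \<bar>sin (pi * x)\<bar>)\<^sup>2 \<partial>unit_leb) = pi\<^sup>2 / 2"
  proof -
    have "(\<integral>x. (sin (pi * x))\<^sup>2 \<partial>unit_leb) = (1 / 2 - sin (2 * pi * 1) / (4 * pi)) - (0 / 2 - sin (2 * pi * 0) / (4 * pi))"
    proof (rule integral_unit_leb_FTC[of "\<lambda>x. x / 2 - sin (2 * pi * x) / (4 * pi)"])
      show "((\<lambda>x. x / 2 - sin (2 * pi * x) / (4 * pi)) has_real_derivative (sin (pi * x))\<^sup>2) (at x)" for x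
        by (auto intro!: derivative_eq_intros simp: cos2(2)) (simp add: field_simps)
    qed auto
    then have "(\<integral>x. (sin (pi * x))\<^sup>2 \<partial>unit_leb) = 1 / 2" by simp
    then show ?thesis by (simp add: power_mult_distrib)
  qed
  have "ennreal (1 / 2) = ennreal (vari unit_leb f)" by (simp add: vari_def I1 I2)
  also have "\<dots> = ennreal (1/2) * (\<integral>\<^sup>+ (x, y). ennreal ((f x - f y)\<^sup>2) \<partial>(unit_leb \<Otimes>\<^sub>M unit_leb))"
    by (rule half_double_integral_eq_vari[OF fm if1 if2, symmetric])
  also have "\<dots> \<le> ennreal (C\<^sup>2) * (\<integral>\<^sup>+ x. (lip_a ?m f x)\<^sup>2 \<partial>unit_leb)"
  proof (rule P)
    have "\<bar>f x - f y\<bar> \<le> pi * \<bar>x - y\<bar>" for x y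
    proof -
      have "norm (cos (pi * x) - cos (pi * y)) \<le> 1 * norm (pi * x - pi * y)"
        by (rule field_differentiable_bound[of UNIV cos "\<lambda>x. - sin x"]) (auto intro!: derivative_eq_intros)
      also have "\<dots> = pi * \<bar>x - y\<bar>" by (simp add: abs_mult flip: right_diff_distrib)
      finally show ?thesis by (simp add: f_def)
    qed
    then show "Lipschitz_continuous_map ?m euclidean_metric f"
      unfolding Lipschitz_continuous_map_def by (auto simp: dist_real_def)
    show "bounded (f ` {0..1})" unfolding bounded_iff f_def by (auto intro!: exI[of _ 1])
  qed
  also have "(\<integral>\<^sup>+ x. (lip_a ?m f x)\<^sup>2 \<partial>unit_leb) \<le> (\<integral>\<^sup>+ x. ennreal ((pi * \<bar>sin (pi * x)\<bar>)\<^sup>2) \<partial>unit_leb)"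
  proof (rule nn_integral_mono)
    fix x assume "x \<in> space unit_leb"
    then have "x \<in> {0..1}" by (simp add: unit_leb_def space_restrict_space)
    from power_mono[OF lip_a_cos_pi_le[OF this], of 2]
    show "(lip_a ?m f x)\<^sup>2 \<le> ennreal ((pi * \<bar>sin (pi * x)\<bar>)\<^sup>2)"
      by (simp add: f_def[abs_def] ennreal_power)
  qed
  also have "\<dots> = ennreal (\<integral>x. (pi * \<bar>sin (pi * x)\<bar>)\<^sup>2 \<partial>unit_leb)"
    by (rule nn_integral_eq_integral[OF integrable_bounded_square[OF sm sb]]) simp
  also have "ennreal (C\<^sup>2) * \<dots> = ennreal (C\<^sup>2 * (pi\<^sup>2 / 2))"
    unfolding I3 by (rule ennreal_mult[symmetric]) auto
  finally have "ennreal (1 / 2) \<le> ennreal (C\<^sup>2 * (pi\<^sup>2 / 2))"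
    by (simp add: mult_left_mono)
  then have "1 / 2 \<le> C\<^sup>2 * (pi\<^sup>2 / 2)"
    by (subst (asm) ennreal_le_iff) auto
  then have "1\<^sup>2 \<le> (C * pi)\<^sup>2" by (simp add: power_mult_distrib)
  then have "1 \<le> C * pi" using C by (intro power2_le_imp_le[of 1 "C * pi"]) auto
  then show "ennreal (1 / pi) \<le> z"
    unfolding z by (intro ennreal_leI) (simp add: pos_divide_le_eq)
qed

text \<open>Clipping is the identity on the unit interval, which carries all of
  \<open>unif01\<close>. It is the retraction \<pi> used for \<open>I_infinity\<close>.\<close>

lemma distr_unif01_clip: "distr unif01 unit_leb (\<lambda>t. max 0 (min 1 t)) = unit_leb"
  and measurable_clip: "(\<lambda>t. max 0 (min 1 t)) \<in> measurable unif01 unit_leb"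
proof -
  show m: "(\<lambda>t. max 0 (min 1 t)) \<in> measurable unif01 unit_leb"
    unfolding unit_leb_def by (intro measurable_restrict_space2) (auto simp: unif01_def)
  show "distr unif01 unit_leb (\<lambda>t. max 0 (min 1 t)) = unit_leb"
  proof (rule measure_eqI)
    fix A assume "A \<in> sets (distr unif01 unit_leb (\<lambda>t. max 0 (min 1 t)))"
    then have A: "A \<in> sets unit_leb" by simp
    then have A01: "A \<subseteq> {0..1}" "A \<in> sets borel"
      using sets.sets_into_space[OF A] by (auto simp: unit_leb_def space_restrict_space sets_restrict_space)
    let ?V = "(\<lambda>t. max 0 (min 1 t)) -` A :: real set"
    have V[measurable]: "?V \<in> sets borel" using measurable_sets[OF m A] by simp
    have "emeasure (distr unif01 unit_leb (\<lambda>t. max 0 (min 1 t))) A = emeasure unif01 ?V"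
      using m A by (simp add: emeasure_distr)
    also have "\<dots> = emeasure lborel ({0..1} \<inter> ?V)"
      unfolding unif01_def
      by (simp add: emeasure_density ennreal_indicator flip: indicator_inter_arith)
    also have "{0..1} \<inter> ?V = A" using A01(1) by (auto simp: max_def min_def subset_iff split: if_splits)
    also have "emeasure lborel A = emeasure unit_leb A"
      using A01 by (simp add: unit_leb_def emeasure_restrict_space)
    finally show "emeasure (distr unif01 unit_leb (\<lambda>t. max 0 (min 1 t))) A = emeasure unit_leb A" .
  qed simp
qed

theorem corollary5p6:
  shows "C22_pyramid Gamma_infinity = 1 \<and> C22_pyramid I_infinity = ennreal (1 / pi)"
proof
  show "C22_pyramid Gamma_infinity = 1"
  proof (rule antisym)
    have "C22_pyramid (l2_infinity gauss_line) \<le> ennreal 1"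
      by (rule C22_pyramid_l2_infinity_le[where \<mu> = "meas gauss_line" and \<pi> = "\<lambda>x. x"])
        (use pm_space_gauss_line poincare_line_gauss in
          \<open>auto simp: gauss_line_def dist_real_def prob_space_normal_density distr_id2\<close>)
    then show "C22_pyramid Gamma_infinity \<le> 1" by (simp add: Gamma_infinity_def)
    obtain a where "parameter gauss_line a" using parameter_gauss_line by blast
    from self_in_l2_infinity[OF gauss_line_pm_classes this]
    show "1 \<le> C22_pyramid Gamma_infinity"
      unfolding C22_pyramid_def Gamma_infinity_def by (intro order_trans[OF C22_gauss_line_ge] SUP_upper)
  qed
  show "C22_pyramid I_infinity = ennreal (1 / pi)"
  proof (rule antisym)
    show "C22_pyramid I_infinity \<le> ennreal (1 / pi)"
      unfolding I_infinity_def
    proof (rule C22_pyramid_l2_infinity_le[OF prob_space_unif01 sets_unif01, where \<pi> = "\<lambda>t. max 0 (min 1 t)"])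
      show "poincare_line ((1 / pi)\<^sup>2) unif01"
        using poincare_line_unif01 by (simp add: power_divide)
      show "(\<lambda>x. x) \<in> borel_measurable (meas unit_interval)"
        by (simp add: unit_interval_def unit_leb_def measurable_restrict_space1)
      show "mdist (met unit_interval) (max 0 (min 1 s)) (max 0 (min 1 t)) \<le> \<bar>s - t\<bar>" for s t
        by (auto simp: unit_interval_def dist_real_def)
    qed (use pm_space_unit_interval measurable_clip distr_unif01_clip in \<open>auto simp: unit_interval_def\<close>)
    show "ennreal (1 / pi) \<le> C22_pyramid I_infinity"
      unfolding C22_pyramid_def I_infinity_def
      by (intro order_trans[OF C22_unit_interval_ge] SUP_upper
          self_in_l2_infinity[OF unit_interval_pm_classes parameter_unit_interval])
  qed
qed

end
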